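(* Let $M$ be a connected smooth manifold, let $p\colon\mathbb{R}\times M\to\mathbb{R}$ and $q\colon J^1(\mathbb{R},M)\times\mathbb{R}\to J^1(\mathbb{R},M)$ be the canonical projections, and let $O^2\subset J^2(q)$ be the dense open subset of $2$-jets $j^2_a\mathcal{L}$ ($a\in J^1(\mathbb{R},M)$) for which $\operatorname{Hess}_a(\mathcal{L})$ is non-singular. Let $V\colon O^2\to\mathbb{R}$ be the function defined by $$V(j^2_{j^1_x\sigma}\mathcal{L})={}^\sharp\operatorname{Hess}_{j^1_x\sigma}(\mathcal{L})(d_{10}\mathcal{L},d_{10}\mathcal{L}).$$ For every $\Phi\in\operatorname{Aut}(p)$, inducing $\phi\in\operatorname{Diff}\mathbb{R}$, and all $\mathcal{L}\in C^\infty(J^1(\mathbb{R},M))$, the following formula holds (at $2$-jets in $O^2$, where $V$ is defined): $$V\left\{\left((\tilde\Phi^{-1})^{(1)}\right)^{(2)}\left(j^2_{\Phi^{(1)}(j^1_x\sigma)}\mathcal{L}\right)\right\}=(\phi')^{-1}\,V\left(j^2_{\Phi^{(1)}(j^1_x\sigma)}\mathcal{L}\right),\qquad \phi'=\frac{d\phi}{dx}.$$ Therefore, the function $V$ is invariant under the natural action on $O^2\subset J^2(q)$ of the normal subgroup $\operatorname{Aut}^v(p)\subset\operatorname{Aut}(p)$ of automorphisms of $p$ inducing the identity on the real line (the so-called vertical group). Moreover, if $O'^2$ is the dense open subset of $2$-jets $j^2_{j^1_x\sigma}\mathcal{L}\in O^2$ such that $\mathcal{L}(j^1_x\sigma)\neq0$,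 then the function $I\colon O'^2\to\mathbb{R}$ defined by $$I(j^2_{j^1_x\sigma}\mathcal{L})=\frac{V(j^2_{j^1_x\sigma}\mathcal{L})}{\mathcal{L}(j^1_x\sigma)}$$ is invariant under the full group $\operatorname{Aut}(p)$ of automorphisms of $p$.
   Context: $\operatorname{Aut}(p)$ is the group of diffeomorphisms $\Phi$ of $\mathbb{R}\times M$ for which there is $\phi\in\operatorname{Diff}\mathbb{R}$ (determined by $\Phi$) with $p\circ\Phi=\phi\circ p$, where $p(x,y)=x$. $J^1(\mathbb{R},M)\simeq\mathbb{R}\times TM$ is the bundle of $1$-jets of local sections of $p$, with coordinates $(x,y^\alpha,\dot y^\alpha)$ induced by fibred coordinates $(x,y^\alpha)$; the prolongation of $\Phi$ is $\Phi^{(1)}(j^1_x\sigma)=j^1_{\phi(x)}(\Phi\circ\sigma\circ\phi^{-1})$. The group $\operatorname{Aut}(p)$ acts on $J^1(\mathbb{R},M)\times\mathbb{R}$ by the automorphisms of $q$ $$\tilde\Phi^{(1)}(j^1_x\sigma,\lambda)=\left(\Phi^{(1)}(j^1_x\sigma),\alpha^{-1}\lambda\right),$$ where $\alpha\in\mathbb{R}^*$ is determined by $(\Phi^*dx)_x=\alpha\,(dx)_x$; $(\tilde\Phi^{-1})^{(1)}$ denotes the automorphism of $q$ associated in this way with $\Phi^{-1}$. A function $\mathcal{L}\in C^\infty(J^1(\mathbb{R},M))$ is identified with the section $s_{\mathcal{L}}(a)=(a,\mathcal{L}(a))$ of $q$. $J^r(q)$ is the bundle of $r$-jets of local sections of $q$,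 and the natural action of $\operatorname{Aut}(p)$ on it is by the jet prolongations $(\tilde\Phi^{(1)})^{(r)}(j^r_a s)=j^r_{\Phi^{(1)}(a)}\left(\tilde\Phi^{(1)}\circ s\circ(\Phi^{(1)})^{-1}\right)$. Let $p^{10}\colon J^1(\mathbb{R},M)\to\mathbb{R}\times M$ be the canonical projection and $V(p^{10})$ its vertical tangent bundle, spanned by the $\partial/\partial\dot y^\alpha$. The fibres of $p^{10}$ are affine spaces; $\operatorname{Hess}_a(\mathcal{L})$ is the Hessian at $a$ of the restriction of $\mathcal{L}$ to the fibre through $a$ with respect to the canonical flat affine connection, i.e. the symmetric bilinear form on $V_a(p^{10})$ with matrix $\left(\frac{\partial^2\mathcal{L}}{\partial\dot y^\alpha\partial\dot y^\beta}(a)\right)$. When it is non-singular, ${}^\sharp\operatorname{Hess}_a(\mathcal{L})$ denotes the induced (inverse) symmetric bilinear form on the dual space $V^*_a(p^{10})$, and $d_{10}\mathcal{L}=d\mathcal{L}|_{V(p^{10})}$.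
   Formalization: The printed factor (φ')⁻¹ is false for the action of Φ⁻¹ (try Φ(x,y)=(2x,y), L=ẏ²/2); the formal formula has the factor φ' there, and (φ')⁻¹ when Φ itself acts. M is taken of dimension at least 1 (a one-point M is excluded). *)

theory Defs
  imports "HOL-Analysis.Analysis" "HOL-Algebra.Coset"
begin

section \<open>Smooth maps between Euclidean spaces\<close>

text \<open>Iterated directional derivatives: \<open>nderiv [v\<^sub>1, \<dots>, v\<^sub>k] f x\<close> is
  the value of the \<open>k\<close>-th derivative of \<open>f\<close> at \<open>x\<close> on \<open>(v\<^sub>1, \<dots>, v\<^sub>k)\<close>.\<close>

primrec nderiv :: "'a::euclidean_space list \<Rightarrow> ('a \<Rightarrow> 'b::euclidean_space) \<Rightarrow> 'a \<Rightarrow> 'b" where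
  "nderiv [] f = f"
| "nderiv (v # vs) f = (\<lambda>x. frechet_derivative (nderiv vs f) (at x) v)"

text \<open>This is \<open>C\<^sup>\<infinity>\<close> (for open \<open>S\<close>): differentiability of the derivatives of
  order \<open>k + 1\<close> gives continuity of those of order \<open>k\<close>, and in finite dimension the derivative
  of order \<open>k\<close> is determined by, and depends continuously on, its values on basis vectors.\<close>

definition smooth_on :: "'a::euclidean_space set \<Rightarrow> ('a \<Rightarrow> 'b::euclidean_space) \<Rightarrow> bool" where
  "smooth_on S f \<longleftrightarrow> (\<forall>vs. \<forall>x\<in>S. nderiv vs f differentiable (at x))"

section \<open>Manifolds\<close>

text \<open>A chart is a domain together with a coordinate map that is only relevant on this domain.
  A manifold is given by an atlas, which need not be maximal.\<close>

type_synonym ('m, 'e) chart = "'m set \<times> ('m \<Rightarrow> 'e)"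
type_synonym ('m, 'e) atlas = "('m, 'e) chart set"

definition points :: "('m, 'e) atlas \<Rightarrow> 'm set" where
  "points A = (\<Union>(U, c)\<in>A. U)"

definition smooth_atlas :: "('m, 'e::euclidean_space) atlas \<Rightarrow> bool" where
  "smooth_atlas A \<longleftrightarrow>
     (\<forall>(U, c)\<in>A. inj_on c U) \<and>
     (\<forall>(U, c)\<in>A. \<forall>(V, d)\<in>A. open (c ` (U \<inter> V)) \<and> smooth_on (c ` (U \<inter> V)) (d \<circ> inv_into U c))"

text \<open>A set is open iff its trace on each coordinate domain is the preimage of an open set of
  coordinates. The same construction topologises jet spaces, whose coordinate maps are injective
  but do not have open images in their codomain.\<close>

definition chart_topology :: "'x set \<Rightarrow> ('x set \<times> ('x \<Rightarrow> 'y::topological_space)) set \<Rightarrow> 'x topology" where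
  "chart_topology X F =
     topology (\<lambda>W. W \<subseteq> X \<and> (\<forall>(D, c)\<in>F. \<exists>S. open S \<and> W \<inter> D = D \<inter> c -` S))"

lemma openin_chart_topology:
  "openin (chart_topology X F) W \<longleftrightarrow>
     W \<subseteq> X \<and> (\<forall>(D, c)\<in>F. \<exists>S. open S \<and> W \<inter> D = D \<inter> c -` S)"
proof -
  define P where "P W \<kappa> \<longleftrightarrow> (\<exists>S. open S \<and> W \<inter> fst \<kappa> = fst \<kappa> \<inter> snd \<kappa> -` S)"
    for W and \<kappa> :: "'a set \<times> ('a \<Rightarrow> 'b)"
  have P_iff: "(\<forall>(D, c)\<in>F. \<exists>S. open S \<and> W \<inter> D = D \<inter> c -` S) \<longleftrightarrow> (\<forall>\<kappa>\<in>F. P W \<kappa>)" for W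
    by (simp add: P_def case_prod_unfold)
  have P_Int: "P (W \<inter> W') \<kappa>" if W: "P W \<kappa>" and W': "P W' \<kappa>" for W W' \<kappa>
  proof -
    obtain S S' where S: "open S" "W \<inter> fst \<kappa> = fst \<kappa> \<inter> snd \<kappa> -` S"
      and S': "open S'" "W' \<inter> fst \<kappa> = fst \<kappa> \<inter> snd \<kappa> -` S'"
      using W W' unfolding P_def by metis
    have "W \<inter> W' \<inter> fst \<kappa> = (W \<inter> fst \<kappa>) \<inter> (W' \<inter> fst \<kappa>)" by blast
    also have "\<dots> = fst \<kappa> \<inter> snd \<kappa> -` (S \<inter> S')"
      unfolding S(2) S'(2) by blast
    finally show ?thesis unfolding P_def using open_Int[OF S(1) S'(1)] by metis
  qed
  have P_Un: "P (\<Union>K) \<kappa>" if K: "\<And>W. W \<in> K \<Longrightarrow> P W \<kappa>" for K \<kappa>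
  proof -
    obtain S where S: "\<And>W. W \<in> K \<Longrightarrow> open (S W)"
      "\<And>W. W \<in> K \<Longrightarrow> W \<inter> fst \<kappa> = fst \<kappa> \<inter> snd \<kappa> -` S W"
      using K unfolding P_def by metis
    have "\<Union>K \<inter> fst \<kappa> = (\<Union>W\<in>K. W \<inter> fst \<kappa>)" by blast
    also have "\<dots> = (\<Union>W\<in>K. fst \<kappa> \<inter> snd \<kappa> -` S W)" by (rule SUP_cong[OF refl S(2)])
    also have "\<dots> = fst \<kappa> \<inter> snd \<kappa> -` (\<Union>W\<in>K. S W)" by blast
    finally show ?thesis
      unfolding P_def by (intro exI[of _ "\<Union>W\<in>K. S W"] conjI open_UN ballI S(1))
  qed
  have "istopology (\<lambda>W. W \<subseteq> X \<and> (\<forall>\<kappa>\<in>F. P W \<kappa>))"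
  unfolding istopology_def
  proof (intro conjI allI impI)
    fix W W' assume "W \<subseteq> X \<and> (\<forall>\<kappa>\<in>F. P W \<kappa>)" "W' \<subseteq> X \<and> (\<forall>\<kappa>\<in>F. P W' \<kappa>)"
    then show "W \<inter> W' \<subseteq> X" "\<forall>\<kappa>\<in>F. P (W \<inter> W') \<kappa>" using P_Int by blast+
  next
    fix K assume K: "\<forall>W\<in>K. W \<subseteq> X \<and> (\<forall>\<kappa>\<in>F. P W \<kappa>)"
    show "\<Union>K \<subseteq> X" using K by blast
    show "\<forall>\<kappa>\<in>F. P (\<Union>K) \<kappa>"
    proof
      fix \<kappa> assume "\<kappa> \<in> F"
      then show "P (\<Union>K) \<kappa>" using K by (intro P_Un) blast
    qed
  qed
  then show ?thesis unfolding chart_topology_def P_iff by (rule fun_cong[OF topology_inverse'])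
qed

definition manifold_topology :: "('m, 'e::euclidean_space) atlas \<Rightarrow> 'm topology" where
  "manifold_topology A = chart_topology (points A) A"

text \<open>The manifold \<open>M\<close> is the whole of its type, so that diffeomorphisms of
  \<open>\<real> \<times> M\<close> are bijections of a type and compose to a group.\<close>

definition smooth_manifold :: "('m, 'e::euclidean_space) atlas \<Rightarrow> bool" where
  "smooth_manifold M \<longleftrightarrow> points M = UNIV \<and> smooth_atlas M \<and>
     Hausdorff_space (manifold_topology M) \<and> second_countable (manifold_topology M)"

definition prod_atlas :: "('m, 'e::euclidean_space) atlas \<Rightarrow> ('n, 'f::euclidean_space) atlas
    \<Rightarrow> ('m \<times> 'n, 'e \<times> 'f) atlas" where
  "prod_atlas A B = {(U \<times> V, map_prod c d) |U c V d. (U, c) \<in> A \<and> (V, d) \<in> B}"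

definition line_atlas :: "(real, real) atlas" where
  "line_atlas = {(UNIV, id)}"

text \<open>\<open>smooth_map A B N f\<close>: \<open>f\<close> is a smooth map to \<open>B\<close> from the open subset \<open>N\<close> of \<open>A\<close>.
  Openness of the coordinate domains amounts to continuity of \<open>f\<close>.\<close>

definition smooth_map :: "('m, 'e::euclidean_space) atlas \<Rightarrow> ('n, 'f::euclidean_space) atlas
    \<Rightarrow> 'm set \<Rightarrow> ('m \<Rightarrow> 'n) \<Rightarrow> bool" where
  "smooth_map A B N f \<longleftrightarrow> openin (manifold_topology A) N \<and> f ` N \<subseteq> points B \<and>
     (\<forall>(U, c)\<in>A. \<forall>(V, d)\<in>B.
        open (c ` (N \<inter> U \<inter> f -` V)) \<and>
        smooth_on (c ` (N \<inter> U \<inter> f -` V)) (d \<circ> f \<circ> inv_into U c))"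

definition diffeo :: "('m, 'e::euclidean_space) atlas \<Rightarrow> ('n, 'f::euclidean_space) atlas
    \<Rightarrow> ('m \<Rightarrow> 'n) \<Rightarrow> bool" where
  "diffeo A B f \<longleftrightarrow> bij_betw f (points A) (points B) \<and> smooth_map A B (points A) f \<and>
     smooth_map B A (points B) (inv_into (points A) f)"

section \<open>Jets of local sections\<close>

record ('e, 'u, 'b, 'v) fibration =
  total_atlas :: "('e, 'u) atlas"
  base_atlas :: "('b, 'v) atlas"
  proj :: "'e \<Rightarrow> 'b"

definition local_section ::
    "('e, 'u::euclidean_space, 'b, 'v::euclidean_space) fibration \<Rightarrow> 'b \<Rightarrow> ('b \<Rightarrow> 'e) \<Rightarrow> bool" where
  "local_section F b s \<longleftrightarrow>
     (\<exists>N. b \<in> N \<and> smooth_map (base_atlas F) (total_atlas F) N s \<and> (\<forall>x\<in>N. proj F (s x) = x))"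

text \<open>The coordinates of the \<open>r\<close>-jet at \<open>b\<close> of \<open>s\<close> with respect to a chart of the base and a
  chart of the total space: those of \<open>b\<close> and the derivatives of order \<open>\<le> r\<close> of the local
  expression of \<open>s\<close>.\<close>

definition section_coord :: "nat \<Rightarrow> ('b, 'v::euclidean_space) chart \<Rightarrow> ('e, 'u::euclidean_space) chart
    \<Rightarrow> 'b \<Rightarrow> ('b \<Rightarrow> 'e) \<Rightarrow> 'v \<times> ('v list \<Rightarrow> 'u)" where
  "section_coord r = (\<lambda>(U, c) (V, d) b s.
     (c b, \<lambda>vs. if length vs \<le> r then nderiv vs (d \<circ> s \<circ> inv_into U c) (c b) else 0))"

definition same_jet :: "('e, 'u::euclidean_space, 'b, 'v::euclidean_space) fibration
    \<Rightarrow> nat \<Rightarrow> 'b \<Rightarrow> ('b \<Rightarrow> 'e) \<Rightarrow> ('b \<Rightarrow> 'e) \<Rightarrow> bool" where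
  "same_jet F r b s t \<longleftrightarrow> s b = t b \<and>
     (\<forall>\<kappa>\<in>base_atlas F. \<forall>\<mu>\<in>total_atlas F.
        b \<in> fst \<kappa> \<longrightarrow> s b \<in> fst \<mu> \<longrightarrow> section_coord r \<kappa> \<mu> b s = section_coord r \<kappa> \<mu> b t)"

text \<open>A jet is its base point paired with the class of local sections that represent it.\<close>

type_synonym ('b, 'e) jet = "'b \<times> ('b \<Rightarrow> 'e) set"

definition jet :: "('e, 'u::euclidean_space, 'b, 'v::euclidean_space) fibration
    \<Rightarrow> nat \<Rightarrow> 'b \<Rightarrow> ('b \<Rightarrow> 'e) \<Rightarrow> ('b, 'e) jet" where
  "jet F r b s = (b, {t. local_section F b t \<and> same_jet F r b s t})"

definition jets :: "('e, 'u::euclidean_space, 'b, 'v::euclidean_space) fibration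
    \<Rightarrow> nat \<Rightarrow> ('b, 'e) jet set" where
  "jets F r = {jet F r b s |b s. local_section F b s}"

definition jet_rep :: "('b, 'e) jet \<Rightarrow> 'b \<Rightarrow> 'e" where
  "jet_rep j = (SOME s. s \<in> snd j)"

definition jet_target :: "('b, 'e) jet \<Rightarrow> 'e" where
  "jet_target j = jet_rep j (fst j)"

text \<open>The second components of the coordinates carry the product topology on functions; on
  multilinear maps between finite-dimensional spaces it is the usual topology.\<close>

definition jet_topology :: "('e, 'u::euclidean_space, 'b, 'v::euclidean_space) fibration
    \<Rightarrow> nat \<Rightarrow> ('b, 'e) jet topology" where
  "jet_topology F r = chart_topology (jets F r)
     {({j \<in> jets F r. fst j \<in> fst \<kappa> \<and> jet_target j \<in> fst \<mu>},
       \<lambda>j. section_coord r \<kappa> \<mu> (fst j) (jet_rep j)) |\<kappa> \<mu>.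
       \<kappa> \<in> base_atlas F \<and> \<mu> \<in> total_atlas F}"

text \<open>The prolongation \<open>j\<^sup>r\<^sub>b s \<mapsto> j\<^sup>r\<^bsub>f b\<^esub> (G \<circ> s \<circ> f\<^sup>-\<^sup>1)\<close> of an automorphism
  \<open>G\<close> of the total space over the diffeomorphism \<open>f\<close> of the base.\<close>

definition prolong :: "('e, 'u::euclidean_space, 'b, 'v::euclidean_space) fibration \<Rightarrow> nat
    \<Rightarrow> ('e \<Rightarrow> 'e) \<Rightarrow> ('b \<Rightarrow> 'b) \<Rightarrow> ('b, 'e) jet \<Rightarrow> ('b, 'e) jet" where
  "prolong F r G f j =
     jet F r (f (fst j)) (G \<circ> jet_rep j \<circ> inv_into (points (base_atlas F)) f)"

section \<open>The bundle \<open>J\<^sup>1(\<real>, M)\<close> and Lagrangians\<close>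

definition p_fib :: "('m, 'e::euclidean_space) atlas \<Rightarrow> (real \<times> 'm, real \<times> 'e, real, real) fibration" where
  "p_fib M = \<lparr>total_atlas = prod_atlas line_atlas M, base_atlas = line_atlas, proj = fst\<rparr>"

type_synonym 'm jet1 = "(real, real \<times> 'm) jet"

definition J1 :: "('m, 'e::euclidean_space) atlas \<Rightarrow> 'm jet1 set" where
  "J1 M = jets (p_fib M) 1"

text \<open>The charts \<open>(x, y, y')\<close> of \<open>J\<^sup>1(\<real>, M)\<close> induced by the fibred charts \<open>(x, y)\<close> of
  \<open>\<real> \<times> M\<close>.\<close>

definition J1_atlas :: "('m, 'e::euclidean_space) atlas \<Rightarrow> ('m jet1, real \<times> 'e \<times> 'e) atlas" where
  "J1_atlas M =
     {({j \<in> J1 M. snd (jet_target j) \<in> U},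
       \<lambda>j. (fst j, c (snd (jet_target j)),
            vector_derivative (\<lambda>t. c (snd (jet_rep j t))) (at (fst j)))) |U c. (U, c) \<in> M}"

definition q_fib :: "('m, 'e::euclidean_space) atlas
    \<Rightarrow> ('m jet1 \<times> real, (real \<times> 'e \<times> 'e) \<times> real, 'm jet1, real \<times> 'e \<times> 'e) fibration" where
  "q_fib M = \<lparr>total_atlas = prod_atlas (J1_atlas M) line_atlas, base_atlas = J1_atlas M, proj = fst\<rparr>"

type_synonym 'm jet2q = "('m jet1, 'm jet1 \<times> real) jet"

definition Lagrangians :: "('m, 'e::euclidean_space) atlas \<Rightarrow> ('m jet1 \<Rightarrow> real) set" where
  "Lagrangians M = {L. smooth_map (J1_atlas M) line_atlas (J1 M) L}"

definition jet2 :: "('m, 'e::euclidean_space) atlas \<Rightarrow> 'm jet1 \<Rightarrow> ('m jet1 \<Rightarrow> real) \<Rightarrow> 'm jet2q" where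
  "jet2 M a L = jet (q_fib M) 2 a (\<lambda>a. (a, L a))"

section \<open>The group \<open>Aut(p)\<close> and its actions\<close>

definition Aut :: "('m, 'e::euclidean_space) atlas \<Rightarrow> (real \<times> 'm \<Rightarrow> real \<times> 'm) set" where
  "Aut M = {\<Phi>. diffeo (prod_atlas line_atlas M) (prod_atlas line_atlas M) \<Phi> \<and>
     (\<exists>\<phi>. diffeo line_atlas line_atlas \<phi> \<and> fst \<circ> \<Phi> = \<phi> \<circ> fst)}"

definition base_map :: "(real \<times> 'm \<Rightarrow> real \<times> 'm) \<Rightarrow> real \<Rightarrow> real" where
  "base_map \<Phi> = (THE \<phi>. fst \<circ> \<Phi> = \<phi> \<circ> fst)"

definition Aut_group :: "('m, 'e::euclidean_space) atlas \<Rightarrow> (real \<times> 'm \<Rightarrow> real \<times> 'm) monoid" where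
  "Aut_group M = \<lparr>carrier = Aut M, mult = (\<circ>), one = id\<rparr>"

definition Aut_vert :: "('m, 'e::euclidean_space) atlas \<Rightarrow> (real \<times> 'm \<Rightarrow> real \<times> 'm) set" where
  "Aut_vert M = {\<Phi> \<in> Aut M. base_map \<Phi> = id}"

definition prolong1 :: "('m, 'e::euclidean_space) atlas \<Rightarrow> (real \<times> 'm \<Rightarrow> real \<times> 'm)
    \<Rightarrow> 'm jet1 \<Rightarrow> 'm jet1" where
  "prolong1 M \<Phi> = prolong (p_fib M) 1 \<Phi> (base_map \<Phi>)"

text \<open>The number \<open>\<alpha>\<close> with \<open>(\<phi>\<^sup>* dx)\<^sub>x = \<alpha> (dx)\<^sub>x\<close>, where \<open>\<phi>\<close> is induced by \<open>\<Phi>\<close>.\<close>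

definition dx_factor :: "(real \<times> 'm \<Rightarrow> real \<times> 'm) \<Rightarrow> real \<Rightarrow> real" where
  "dx_factor \<Phi> x = (THE \<alpha>. \<forall>h. frechet_derivative (base_map \<Phi>) (at x) h = \<alpha> * h)"

definition lift_q :: "('m, 'e::euclidean_space) atlas \<Rightarrow> (real \<times> 'm \<Rightarrow> real \<times> 'm)
    \<Rightarrow> 'm jet1 \<times> real \<Rightarrow> 'm jet1 \<times> real" where
  "lift_q M \<Phi> = (\<lambda>(a, l). (prolong1 M \<Phi> a, inverse (dx_factor \<Phi> (fst a)) * l))"

definition action :: "('m, 'e::euclidean_space) atlas \<Rightarrow> (real \<times> 'm \<Rightarrow> real \<times> 'm)
    \<Rightarrow> 'm jet2q \<Rightarrow> 'm jet2q" where
  "action M \<Phi> = prolong (q_fib M) 2 (lift_q M \<Phi>) (prolong1 M \<Phi>)"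

section \<open>The functions \<open>V\<close> and \<open>I\<close>\<close>

text \<open>A chart of \<open>J\<^sup>1(\<real>, M)\<close> identifies \<open>V\<^sub>a(p\<^sup>1\<^sup>0)\<close> with the model space of \<open>M\<close> by means of
  the frame \<open>\<partial>/\<partial>y'\<^sup>\<alpha>\<close>; \<open>d10\<close> and \<open>hess\<close> are the forms so obtained on the model space.\<close>

definition vert :: "'e::euclidean_space \<Rightarrow> real \<times> 'e \<times> 'e" where
  "vert w = (0, 0, w)"

definition d10 :: "('m jet1, real \<times> 'e \<times> 'e) chart \<Rightarrow> ('m jet1 \<Rightarrow> real) \<Rightarrow> 'm jet1
    \<Rightarrow> 'e::euclidean_space \<Rightarrow> real" where
  "d10 = (\<lambda>(D, c) L a v. nderiv [vert v] (L \<circ> inv_into D c) (c a))"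

definition hess :: "('m jet1, real \<times> 'e \<times> 'e) chart \<Rightarrow> ('m jet1 \<Rightarrow> real) \<Rightarrow> 'm jet1
    \<Rightarrow> 'e::euclidean_space \<Rightarrow> 'e \<Rightarrow> real" where
  "hess = (\<lambda>(D, c) L a u v. nderiv [vert u, vert v] (L \<circ> inv_into D c) (c a))"

definition nonsingular :: "('e::euclidean_space \<Rightarrow> 'e \<Rightarrow> real) \<Rightarrow> bool" where
  "nonsingular B \<longleftrightarrow> (\<forall>u. (\<forall>v. B u v = 0) \<longrightarrow> u = 0)"

text \<open>The form induced on the dual space by the isomorphism \<open>u \<mapsto> B u\<close>.\<close>

definition sharp :: "('e::euclidean_space \<Rightarrow> 'e \<Rightarrow> real) \<Rightarrow> ('e \<Rightarrow> real) \<Rightarrow> ('e \<Rightarrow> real) \<Rightarrow> real" where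
  "sharp B \<xi> \<eta> = B (THE u. B u = \<xi>) (THE u. B u = \<eta>)"

definition jet_fun :: "'m jet2q \<Rightarrow> 'm jet1 \<Rightarrow> real" where
  "jet_fun j = snd \<circ> jet_rep j"

definition O2 :: "('m, 'e::euclidean_space) atlas \<Rightarrow> 'm jet2q set" where
  "O2 M = {j \<in> jets (q_fib M) 2.
     \<forall>\<kappa>\<in>J1_atlas M. fst j \<in> fst \<kappa> \<longrightarrow> nonsingular (hess \<kappa> (jet_fun j) (fst j))}"

text \<open>The common value in all charts around the base point.\<close>

definition V_fun :: "('m, 'e::euclidean_space) atlas \<Rightarrow> 'm jet2q \<Rightarrow> real" where
  "V_fun M j = (THE z. \<forall>\<kappa>\<in>J1_atlas M. fst j \<in> fst \<kappa> \<longrightarrow>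
     z = sharp (hess \<kappa> (jet_fun j) (fst j)) (d10 \<kappa> (jet_fun j) (fst j)) (d10 \<kappa> (jet_fun j) (fst j)))"

definition O2' :: "('m, 'e::euclidean_space) atlas \<Rightarrow> 'm jet2q set" where
  "O2' M = {j \<in> O2 M. jet_fun j (fst j) \<noteq> 0}"

definition I_fun :: "('m, 'e::euclidean_space) atlas \<Rightarrow> 'm jet2q \<Rightarrow> real" where
  "I_fun M j = V_fun M j / jet_fun j (fst j)"

end

theory Submission
  imports Defs
begin

text \<open>In charts the prolongation of \<open>\<Phi>\<close> is
  \<open>(x, y, y') \<mapsto> (\<phi> x, F (x, y), (\<partial>F/\<partial>x + \<partial>F/\<partial>y y') / \<phi>' x)\<close>; on a fibre over \<open>(x, y)\<close> it is
  affine, with linear part \<open>A = (\<partial>F/\<partial>y) / \<phi>' x\<close>, and the lifted action multiplies the value of the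
  Lagrangian by the constant \<open>1 / \<phi>' x\<close> there. Hence the transformed forms satisfy
  \<open>H' (A u) (A v) = H u v / \<phi>' x\<close> and \<open>\<xi>' (A v) = \<xi> v / \<phi>' x\<close>. If \<open>H u = \<xi>\<close> then \<open>H' (A u) = \<xi>'\<close>,
  so \<open>V\<close> is multiplied by \<open>1 / \<phi>' x\<close>, exactly as the value of the Lagrangian is. Independence of
  the chart is the case where \<open>\<Phi>\<close> is the identity.\<close>

section \<open>Calculus of smooth maps\<close>

text \<open>Affineness on the fibres is what makes the Hessian transform like a tensor: a vertical
  line goes to a vertical line with velocity \<open>A u\<close>, so second vertical derivatives can
  be compared by differentiating twice along lines, and second derivatives of the coordinate change
  never enter. The factor 1/\<phi>' depends on x alone and is constant along these lines. A jet is a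
  class of sections and is used through a chosen representative, so whatever is read off from a jet
  has to be shown to depend on the class only. Representatives are smooth only near the base point,
  hence functions are compared on open sets around it. Openness and density of the domains are a
  separate matter: non-singularity is an open condition on finitely many jet coordinates, and adding
  \<epsilon> times a function whose vertical Hessian is the identity removes degeneracy for all but
  finitely many \<epsilon>. That function is positive, so the same perturbation also makes the value
  of the Lagrangian nonzero.\<close>

lemma differentiable_cong_open:
  assumes "f differentiable (at x)" "open S" "x \<in> S" "\<And>y. y \<in> S \<Longrightarrow> f y = g y"
  shows "g differentiable (at x)"
proof -
  obtain f' where "(f has_derivative f') (at x)"
    using assms(1) unfolding differentiable_def by blast
  then have "(g has_derivative f') (at x)"
    by (rule has_derivative_transform_within_open[OF _ assms(2,3)]) (rule assms(4))
  then show ?thesis unfolding differentiable_def by blast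
qed

text \<open>Counting the order permits induction: the derivative of a product or a composite is
  built from the same kind of expression, one order lower. Order \<open>n\<close> means that
  derivatives up to order \<open>n\<close> are still differentiable, so order 0 is differentiability
  and not continuity.\<close>

definition nsmooth_on :: "nat \<Rightarrow> 'a::euclidean_space set \<Rightarrow> ('a \<Rightarrow> 'b::euclidean_space) \<Rightarrow> bool" where
  "nsmooth_on n S f \<longleftrightarrow> (\<forall>vs. length vs \<le> n \<longrightarrow> (\<forall>x\<in>S. nderiv vs f differentiable (at x)))"

lemma smooth_on_iff_nsmooth_on: "smooth_on S f \<longleftrightarrow> (\<forall>n. nsmooth_on n S f)"
  unfolding smooth_on_def nsmooth_on_def by blast

text \<open>The head of the list is differentiated last. Peeling off the end instead exposes the
  derivative of \<open>f\<close> itself, which suits an induction on the order with \<open>f\<close>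
  arbitrary.\<close>

lemma nderiv_snoc: "nderiv (vs @ [v]) f = nderiv vs (\<lambda>x. frechet_derivative f (at x) v)"
  by (induction vs) auto

lemma nsmooth_on_0: "nsmooth_on 0 S f \<longleftrightarrow> (\<forall>x\<in>S. f differentiable (at x))"
  unfolding nsmooth_on_def by auto

lemma nsmooth_on_Suc:
  "nsmooth_on (Suc n) S f \<longleftrightarrow>
     (\<forall>x\<in>S. f differentiable (at x)) \<and> (\<forall>v. nsmooth_on n S (\<lambda>x. frechet_derivative f (at x) v))"
  (is "?L \<longleftrightarrow> ?R")
proof
  assume L: ?L
  have "nderiv [] f differentiable (at x)" if "x \<in> S" for x
    using L that unfolding nsmooth_on_def by (metis le0 list.size(3))
  moreover have "nderiv (vs @ [v]) f differentiable (at x)" if "x \<in> S" "length vs \<le> n" for x v vs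
    using L that unfolding nsmooth_on_def by (metis Suc_le_mono length_append_singleton)
  ultimately show ?R unfolding nsmooth_on_def nderiv_snoc by simp
next
  assume R: ?R
  show ?L unfolding nsmooth_on_def
  proof (intro allI impI ballI)
    fix vs :: "'a list" and x assume "length vs \<le> Suc n" "x \<in> S"
    then show "nderiv vs f differentiable (at x)"
      using R by (cases vs rule: rev_cases) (auto simp: nderiv_snoc nsmooth_on_def)
  qed
qed

lemma nsmooth_on_SucD: "nsmooth_on (Suc n) S f \<Longrightarrow> nsmooth_on n S f"
  unfolding nsmooth_on_def by auto

lemma smooth_on_iff_derivative:
  "smooth_on S f \<longleftrightarrow>
     (\<forall>x\<in>S. f differentiable (at x)) \<and> (\<forall>v. smooth_on S (\<lambda>x. frechet_derivative f (at x) v))"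
proof -
  have "(\<forall>n. nsmooth_on n S f) \<longleftrightarrow> (\<forall>n. nsmooth_on (Suc n) S f)"
    using nsmooth_on_SucD by blast
  then show ?thesis unfolding smooth_on_iff_nsmooth_on nsmooth_on_Suc by auto
qed

lemma smooth_on_differentiable: "smooth_on S f \<Longrightarrow> x \<in> S \<Longrightarrow> f differentiable (at x)"
  using smooth_on_iff_derivative by blast

lemma smooth_on_derivative: "smooth_on S f \<Longrightarrow> smooth_on S (\<lambda>x. frechet_derivative f (at x) v)"
  using smooth_on_iff_derivative by blast

lemma smooth_on_has_derivative:
  "smooth_on S f \<Longrightarrow> x \<in> S \<Longrightarrow> (f has_derivative frechet_derivative f (at x)) (at x)"
  using smooth_on_differentiable frechet_derivative_works by blast

lemma smooth_on_continuous_on: "smooth_on S f \<Longrightarrow> continuous_on S f"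
  by (meson continuous_at_imp_continuous_on differentiable_imp_continuous_within smooth_on_differentiable)

lemma smooth_on_subset: "smooth_on S f \<Longrightarrow> T \<subseteq> S \<Longrightarrow> smooth_on T f"
  unfolding smooth_on_def by blast

lemma smooth_on_nderiv: "smooth_on S f \<Longrightarrow> smooth_on S (nderiv vs f)"
  by (induction vs) (auto intro: smooth_on_derivative)

lemma nderiv_cong:
  assumes "open S" "\<And>x. x \<in> S \<Longrightarrow> f x = g x" "smooth_on S f" "x \<in> S"
  shows "nderiv vs f x = nderiv vs g x"
  using assms(4)
proof (induction vs arbitrary: x)
  case Nil
  then show ?case by (simp add: assms(2))
next
  case (Cons v vs)
  have "frechet_derivative (nderiv vs f) (at x) = frechet_derivative (nderiv vs g) (at x)"
    using assms(1) Cons by (intro frechet_derivative_transform_within_open[where X = S])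
      (auto intro: smooth_on_differentiable smooth_on_nderiv[OF assms(3)])
  then show ?case by simp
qed

lemma smooth_on_cong:
  assumes "open S" "\<And>x. x \<in> S \<Longrightarrow> f x = g x" "smooth_on S f"
  shows "smooth_on S g"
  unfolding smooth_on_def
proof (intro allI ballI)
  fix vs x assume x: "x \<in> S"
  show "nderiv vs g differentiable (at x)"
  proof (rule differentiable_cong_open[OF _ assms(1) x])
    show "nderiv vs f differentiable (at x)"
      using assms(3) x unfolding smooth_on_def by blast
  qed (rule nderiv_cong[OF assms])
qed

lemma smooth_on_local:
  assumes "\<And>x. x \<in> S \<Longrightarrow> \<exists>T. x \<in> T \<and> smooth_on T f"
  shows "smooth_on S f"
  using assms unfolding smooth_on_def by blast

text \<open>The inductions on the order replace a derivative by its explicit formula while only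
  finitely many derivatives are under control, so the exchange has to be possible at finite
  order.\<close>

lemma nsmooth_on_cong:
  assumes "open S" "\<And>x. x \<in> S \<Longrightarrow> f x = g x"
  shows "nsmooth_on n S f \<Longrightarrow> nsmooth_on n S g"
  using assms(2)
proof (induction n arbitrary: f g)
  case 0
  then show ?case unfolding nsmooth_on_0
    by (blast intro: differentiable_cong_open[OF _ assms(1), of f])
next
  case (Suc n)
  have d: "f differentiable (at x)" if "x \<in> S" for x
    using Suc.prems(1) that unfolding nsmooth_on_Suc by blast
  have D: "frechet_derivative f (at x) = frechet_derivative g (at x)" if "x \<in> S" for x
    using frechet_derivative_transform_within_open[OF d[OF that] assms(1) that] Suc.prems(2) by blast
  show ?case unfolding nsmooth_on_Suc
  proof (intro conjI ballI allI)
    fix x assume "x \<in> S"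
    then show "g differentiable (at x)"
      using d Suc.prems(2) by (blast intro: differentiable_cong_open[OF _ assms(1), of f])
  next
    fix v
    have "nsmooth_on n S (\<lambda>x. frechet_derivative f (at x) v)"
      using Suc.prems(1) unfolding nsmooth_on_Suc by blast
    then show "nsmooth_on n S (\<lambda>x. frechet_derivative g (at x) v)"
      by (rule Suc.IH) (simp add: D)
  qed
qed

section \<open>Closure of smoothness under sums, products and linear maps\<close>

lemma nsmooth_on_const: "nsmooth_on n S (\<lambda>x. k)"
  by (induction n arbitrary: k) (auto simp: nsmooth_on_0 nsmooth_on_Suc)

lemma smooth_on_const: "smooth_on S (\<lambda>x. k)"
  by (simp add: smooth_on_iff_nsmooth_on nsmooth_on_const)

lemma smooth_on_bounded_linear: "bounded_linear h \<Longrightarrow> smooth_on S h"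
  by (subst smooth_on_iff_derivative)
    (auto simp: bounded_linear_imp_differentiable smooth_on_const
      frechet_derivative_at[OF bounded_linear_imp_has_derivative, symmetric])

lemma smooth_on_ident: "smooth_on S (\<lambda>x. x)"
  by (rule smooth_on_bounded_linear[OF bounded_linear_ident])

lemma nsmooth_on_add:
  assumes "open S"
  shows "nsmooth_on n S f \<Longrightarrow> nsmooth_on n S g \<Longrightarrow> nsmooth_on n S (\<lambda>x. f x + g x)"
proof (induction n arbitrary: f g)
  case (Suc n)
  then have d: "f differentiable (at x)" "g differentiable (at x)" if "x \<in> S" for x
    using that unfolding nsmooth_on_Suc by auto
  have D: "frechet_derivative (\<lambda>x. f x + g x) (at x) =
      (\<lambda>v. frechet_derivative f (at x) v + frechet_derivative g (at x) v)" if "x \<in> S" for x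
    using d[OF that] by (intro frechet_derivative_at[symmetric] has_derivative_add)
      (auto simp: frechet_derivative_works[symmetric])
  show ?case unfolding nsmooth_on_Suc
  proof (intro conjI ballI allI)
    fix v
    have "nsmooth_on n S (\<lambda>x. frechet_derivative f (at x) v + frechet_derivative g (at x) v)"
      using Suc unfolding nsmooth_on_Suc by auto
    then show "nsmooth_on n S (\<lambda>x. frechet_derivative (\<lambda>x. f x + g x) (at x) v)"
      by (rule nsmooth_on_cong[OF assms, rotated]) (simp add: D)
  qed (use d in auto)
qed (auto simp: nsmooth_on_0)

lemma smooth_on_add:
  "open S \<Longrightarrow> smooth_on S f \<Longrightarrow> smooth_on S g \<Longrightarrow> smooth_on S (\<lambda>x. f x + g x)"
  by (simp add: smooth_on_iff_nsmooth_on nsmooth_on_add)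

lemma nsmooth_on_sum:
  assumes "open S" "\<And>i. i \<in> I \<Longrightarrow> nsmooth_on n S (f i)"
  shows "nsmooth_on n S (\<lambda>x. \<Sum>i\<in>I. f i x)"
  using assms(2)
  by (induction I rule: infinite_finite_induct) (auto intro: nsmooth_on_add[OF assms(1)] nsmooth_on_const)

lemma smooth_on_sum:
  assumes "open S" "\<And>i. i \<in> I \<Longrightarrow> smooth_on S (f i)"
  shows "smooth_on S (\<lambda>x. \<Sum>i\<in>I. f i x)"
  using assms by (simp add: smooth_on_iff_nsmooth_on nsmooth_on_sum)

text \<open>Both terms of the Leibniz rule are again of the form \<open>P (f x) (g x)\<close>, with
  one factor differentiated and the other demoted by one order. Scaling, inner product and
  multiplication are all instances.\<close>

lemma nsmooth_on_bilinear:
  fixes f :: "'a::euclidean_space \<Rightarrow> 'b::euclidean_space" and g :: "'a \<Rightarrow> 'c::euclidean_space"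
    and P :: "'b \<Rightarrow> 'c \<Rightarrow> 'd::euclidean_space"
  assumes "open S" and P: "bounded_bilinear P"
  shows "nsmooth_on n S f \<Longrightarrow> nsmooth_on n S g \<Longrightarrow> nsmooth_on n S (\<lambda>x. P (f x) (g x))"
proof (induction n arbitrary: f g)
  case 0
  then show ?case unfolding nsmooth_on_0 differentiable_def
    using bounded_bilinear.FDERIV[OF P] by blast
next
  case (Suc n)
  then have d: "f differentiable (at x)" "g differentiable (at x)" if "x \<in> S" for x
    using that unfolding nsmooth_on_Suc by auto
  have D: "frechet_derivative (\<lambda>x. P (f x) (g x)) (at x) =
      (\<lambda>v. P (f x) (frechet_derivative g (at x) v) + P (frechet_derivative f (at x) v) (g x))"
    if "x \<in> S" for x
    using d[OF that] by (intro frechet_derivative_at[symmetric] bounded_bilinear.FDERIV[OF P])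
      (auto simp: frechet_derivative_works[symmetric])
  show ?case unfolding nsmooth_on_Suc
  proof (intro conjI ballI allI)
    fix v
    have "nsmooth_on n S
        (\<lambda>x. P (f x) (frechet_derivative g (at x) v) + P (frechet_derivative f (at x) v) (g x))"
      using Suc.prems nsmooth_on_SucD[OF Suc.prems(1)] nsmooth_on_SucD[OF Suc.prems(2)]
      unfolding nsmooth_on_Suc by (auto intro!: nsmooth_on_add[OF assms(1)] Suc.IH)
    then show "nsmooth_on n S (\<lambda>x. frechet_derivative (\<lambda>x. P (f x) (g x)) (at x) v)"
      by (rule nsmooth_on_cong[OF assms(1), rotated]) (simp add: D)
  qed (use d bounded_bilinear.FDERIV[OF P] in \<open>unfold differentiable_def, blast\<close>)
qed

lemma smooth_on_bilinear:
  fixes P :: "'b::euclidean_space \<Rightarrow> 'c::euclidean_space \<Rightarrow> 'd::euclidean_space"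
  assumes "bounded_bilinear P" "open S" "smooth_on S f" "smooth_on S g"
  shows "smooth_on S (\<lambda>x. P (f x) (g x))"
  using assms by (simp add: smooth_on_iff_nsmooth_on nsmooth_on_bilinear)

lemmas smooth_on_scaleR = smooth_on_bilinear[OF bounded_bilinear_scaleR]
lemmas smooth_on_inner = smooth_on_bilinear[OF bounded_bilinear_inner]

text \<open>Smoothness speaks of derivatives in fixed directions. A derivative applied to a varying
  vector is reduced to these, with the components of the vector as scalar coefficients.\<close>

lemma frechet_derivative_Basis_expansion:
  assumes "f differentiable (at x)"
  shows "frechet_derivative f (at x) v = (\<Sum>b\<in>Basis. (v \<bullet> b) *\<^sub>R frechet_derivative f (at x) b)"
proof -
  interpret linear "frechet_derivative f (at x)"
    using assms by (rule linear_frechet_derivative)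
  have "frechet_derivative f (at x) v = frechet_derivative f (at x) (\<Sum>b\<in>Basis. (v \<bullet> b) *\<^sub>R b)"
    by (simp add: euclidean_representation)
  then show ?thesis by (simp only: sum scale)
qed

text \<open>Only \<open>g\<close> varies in the induction: by the chain rule, basis derivatives of
  \<open>g\<close> are composed with the same \<open>f\<close>, which is merely demoted by one
  order.\<close>

lemma nsmooth_on_compose:
  fixes f :: "'a::euclidean_space \<Rightarrow> 'b::euclidean_space" and g :: "'b \<Rightarrow> 'c::euclidean_space"
  assumes "open S" "open T" "f ` S \<subseteq> T"
  shows "nsmooth_on n S f \<Longrightarrow> nsmooth_on n T g \<Longrightarrow> nsmooth_on n S (\<lambda>x. g (f x))"
proof (induction n arbitrary: g)
  case 0
  then show ?case using assms(3) unfolding nsmooth_on_0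
    by (blast intro: differentiable_compose[where f = g])
next
  case (Suc n)
  then have d: "f differentiable (at x)" "g differentiable (at (f x))" if "x \<in> S" for x
    using that assms(3) unfolding nsmooth_on_Suc by auto
  have D: "frechet_derivative (\<lambda>x. g (f x)) (at x) v =
      (\<Sum>b\<in>Basis. (frechet_derivative f (at x) v \<bullet> b) *\<^sub>R frechet_derivative g (at (f x)) b)"
    if "x \<in> S" for x v
  proof -
    have "frechet_derivative (\<lambda>x. g (f x)) (at x) v =
        frechet_derivative g (at (f x)) (frechet_derivative f (at x) v)"
      using frechet_derivative_compose[OF d[OF that]] by (simp add: o_def)
    then show ?thesis using frechet_derivative_Basis_expansion[OF d(2)[OF that]] by (rule trans)
  qed
  show ?case unfolding nsmooth_on_Suc
  proof (intro conjI ballI allI)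
    fix v
    have "nsmooth_on n S (\<lambda>x. \<Sum>b\<in>Basis. (frechet_derivative f (at x) v \<bullet> b) *\<^sub>R
        frechet_derivative g (at (f x)) b)"
      using Suc.prems unfolding nsmooth_on_Suc
      by (intro nsmooth_on_sum[OF assms(1)] nsmooth_on_bilinear[OF assms(1) bounded_bilinear_scaleR]
          nsmooth_on_bilinear[OF assms(1) bounded_bilinear_inner] nsmooth_on_const
          Suc.IH[OF nsmooth_on_SucD[OF Suc.prems(1)], of "\<lambda>y. frechet_derivative g (at y) _"]) auto
    then show "nsmooth_on n S (\<lambda>x. frechet_derivative (\<lambda>x. g (f x)) (at x) v)"
      by (rule nsmooth_on_cong[OF assms(1), rotated]) (simp add: D)
  next
    fix x assume "x \<in> S"
    then show "(\<lambda>x. g (f x)) differentiable at x"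
      by (intro differentiable_compose[of g f x] d)
  qed
qed

lemma smooth_on_compose:
  fixes f :: "'a::euclidean_space \<Rightarrow> 'b::euclidean_space" and g :: "'b \<Rightarrow> 'c::euclidean_space"
  assumes "open S" "open T" "f ` S \<subseteq> T" "smooth_on S f" "smooth_on T g"
  shows "smooth_on S (\<lambda>x. g (f x))"
  using assms by (auto simp: smooth_on_iff_nsmooth_on intro: nsmooth_on_compose)

lemma smooth_on_linear_compose:
  fixes h :: "'b::euclidean_space \<Rightarrow> 'c::euclidean_space"
  assumes "bounded_linear h" "open S" "smooth_on S f"
  shows "smooth_on S (\<lambda>x. h (f x))"
  by (rule smooth_on_compose[OF assms(2) open_UNIV subset_UNIV assms(3)
        smooth_on_bounded_linear[OF assms(1)]])

lemma bounded_linear_Pair_zero: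
  "bounded_linear (\<lambda>x::'a::euclidean_space. (x, 0::'b::euclidean_space))"
  "bounded_linear (\<lambda>y::'b::euclidean_space. (0::'a::euclidean_space, y))"
  by (simp_all add: bounded_linear_Pair bounded_linear_ident)

lemma smooth_on_Pair:
  fixes f :: "'a::euclidean_space \<Rightarrow> 'b::euclidean_space" and g :: "'a \<Rightarrow> 'c::euclidean_space"
  assumes "open S" "smooth_on S f" "smooth_on S g"
  shows "smooth_on S (\<lambda>x. (f x, g x))"
proof -
  have "smooth_on S (\<lambda>x. (f x, 0::'c) + (0::'b, g x))"
    by (rule smooth_on_add[OF assms(1)
          smooth_on_linear_compose[OF bounded_linear_Pair_zero(1) assms(1,2)]
          smooth_on_linear_compose[OF bounded_linear_Pair_zero(2) assms(1,3)]])
  then show ?thesis by simp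
qed

lemma smooth_on_fst: "open S \<Longrightarrow> smooth_on S f \<Longrightarrow> smooth_on S (\<lambda>x. fst (f x))"
  by (rule smooth_on_linear_compose[OF bounded_linear_fst])

lemma smooth_on_snd: "open S \<Longrightarrow> smooth_on S f \<Longrightarrow> smooth_on S (\<lambda>x. snd (f x))"
  by (rule smooth_on_linear_compose[OF bounded_linear_snd])

text \<open>Both the point of differentiation and the vector move, as they do in the velocity
  component of a prolonged map.\<close>

lemma smooth_on_derivative_apply:
  assumes "open S" "smooth_on S f" "open T" "smooth_on T g" "smooth_on T h" "g ` T \<subseteq> S"
  shows "smooth_on T (\<lambda>x. frechet_derivative f (at (g x)) (h x))"
proof -
  have "smooth_on T (\<lambda>x. \<Sum>b\<in>Basis. (h x \<bullet> b) *\<^sub>R frechet_derivative f (at (g x)) b)"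
    using assms
    by (intro smooth_on_sum smooth_on_scaleR smooth_on_inner smooth_on_const
        smooth_on_compose[of T S g "\<lambda>y. frechet_derivative f (at y) _"] smooth_on_derivative) auto
  then show ?thesis
  proof (rule smooth_on_cong[OF assms(3), rotated])
    fix x assume "x \<in> T"
    then have "f differentiable (at (g x))"
      using assms(2,6) smooth_on_differentiable by blast
    then show "(\<Sum>b\<in>Basis. (h x \<bullet> b) *\<^sub>R frechet_derivative f (at (g x)) b) =
        frechet_derivative f (at (g x)) (h x)"
      by (rule frechet_derivative_Basis_expansion[symmetric])
  qed
qed

section \<open>Linearity of iterated derivatives in the function and in the directions\<close>

lemma nderiv_linear_compose:
  fixes h :: "'b::euclidean_space \<Rightarrow> 'c::euclidean_space"
  assumes "bounded_linear h" "open S" "smooth_on S f" "x \<in> S"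
  shows "nderiv vs (\<lambda>x. h (f x)) x = h (nderiv vs f x)"
  using assms(4)
proof (induction vs arbitrary: x)
  case (Cons v vs)
  have "((\<lambda>x. h (nderiv vs f x)) has_derivative (\<lambda>v. h (frechet_derivative (nderiv vs f) (at x) v))) (at x)"
    using Cons.prems
    by (intro bounded_linear.has_derivative[OF assms(1)]
        smooth_on_has_derivative[OF smooth_on_nderiv[OF assms(3)]])
  then have "(nderiv vs (\<lambda>x. h (f x)) has_derivative
      (\<lambda>v. h (frechet_derivative (nderiv vs f) (at x) v))) (at x)"
    by (rule has_derivative_transform_within_open[OF _ assms(2) Cons.prems]) (simp add: Cons.IH)
  then show ?case by (simp add: frechet_derivative_at[symmetric])
qed auto

lemma nderiv_add:
  assumes "open S" "smooth_on S f" "smooth_on S g" "x \<in> S"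
  shows "nderiv vs (\<lambda>x. f x + g x) x = nderiv vs f x + nderiv vs g x"
  using assms(4)
proof (induction vs arbitrary: x)
  case (Cons v vs)
  have "((\<lambda>x. nderiv vs f x + nderiv vs g x) has_derivative
      (\<lambda>v. frechet_derivative (nderiv vs f) (at x) v + frechet_derivative (nderiv vs g) (at x) v)) (at x)"
    using Cons.prems
    by (intro has_derivative_add smooth_on_has_derivative[OF smooth_on_nderiv[OF assms(2)]]
        smooth_on_has_derivative[OF smooth_on_nderiv[OF assms(3)]])
  then have "(nderiv vs (\<lambda>x. f x + g x) has_derivative
      (\<lambda>v. frechet_derivative (nderiv vs f) (at x) v + frechet_derivative (nderiv vs g) (at x) v)) (at x)"
    by (rule has_derivative_transform_within_open[OF _ assms(1) Cons.prems]) (simp add: Cons.IH)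
  then show ?case by (simp add: frechet_derivative_at[symmetric])
qed auto

lemma nderiv_scaleR:
  "open S \<Longrightarrow> smooth_on S f \<Longrightarrow> x \<in> S \<Longrightarrow> nderiv vs (\<lambda>x. k *\<^sub>R f x) x = k *\<^sub>R nderiv vs f x"
  by (rule nderiv_linear_compose[OF bounded_linear_scaleR_right])

text \<open>Recasts the outermost derivative as a velocity along a line, the form in which vertical
  derivatives in two charts are compared.\<close>

lemma nderiv_Cons_line:
  assumes "smooth_on S f" "x \<in> S"
  shows "((\<lambda>t. nderiv vs f (x + t *\<^sub>R v)) has_vector_derivative nderiv (v # vs) f x) (at 0)"
proof -
  have "((\<lambda>t. x + t *\<^sub>R v) has_derivative (\<lambda>t. t *\<^sub>R v)) (at 0)"
    by (auto intro!: derivative_eq_intros)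
  moreover have "(nderiv vs f has_derivative frechet_derivative (nderiv vs f) (at x)) (at (x + 0 *\<^sub>R v))"
    using smooth_on_has_derivative[OF smooth_on_nderiv[OF assms(1)] assms(2)] by simp
  ultimately have "((\<lambda>t. nderiv vs f (x + t *\<^sub>R v)) has_derivative
      (\<lambda>t. frechet_derivative (nderiv vs f) (at x) (t *\<^sub>R v))) (at 0)"
    by (rule has_derivative_compose)
  moreover have "linear (frechet_derivative (nderiv vs f) (at x))"
    using assms by (intro linear_frechet_derivative smooth_on_differentiable[OF smooth_on_nderiv])
  ultimately show ?thesis
    by (simp add: has_vector_derivative_def linear_scale)
qed

lemma nderiv_Cons_linear:
  assumes "smooth_on S f" "x \<in> S"
  shows "linear (\<lambda>v. nderiv (v # vs) f x)"
  using linear_frechet_derivative[OF smooth_on_differentiable[OF smooth_on_nderiv[OF assms(1)] assms(2)]]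
  by simp

text \<open>This is linearity in the direction that is differentiated first. There it holds at every
  point of \<open>S\<close>, and the resulting identity between functions is differentiated once
  more.\<close>

lemma nderiv_pair_linear:
  assumes "open S" "smooth_on S f" "x \<in> S"
  shows "linear (\<lambda>v. nderiv [u, v] f x)"
proof (rule linearI)
  note D = smooth_on_derivative[OF assms(2)]
  have lin: "linear (frechet_derivative f (at y))" if "y \<in> S" for y
    using that assms(2) by (intro linear_frechet_derivative smooth_on_differentiable)
  fix v w k
  have "nderiv [u] (\<lambda>y. frechet_derivative f (at y) (v + w)) x =
      nderiv [u] (\<lambda>y. frechet_derivative f (at y) v + frechet_derivative f (at y) w) x"
    using assms lin by (intro nderiv_cong[OF assms(1) _ D assms(3)]) (simp add: linear_add)
  then show "nderiv [u, v + w] f x = nderiv [u, v] f x + nderiv [u, w] f x"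
    using nderiv_add[OF assms(1) D D assms(3), of "[u]" v w] by simp
  have "nderiv [u] (\<lambda>y. frechet_derivative f (at y) (k *\<^sub>R v)) x =
      nderiv [u] (\<lambda>y. k *\<^sub>R frechet_derivative f (at y) v) x"
    using assms lin by (intro nderiv_cong[OF assms(1) _ D assms(3)]) (simp add: linear_scale)
  then show "nderiv [u, k *\<^sub>R v] f x = k *\<^sub>R nderiv [u, v] f x"
    using nderiv_scaleR[OF assms(1) D assms(3), of "[u]" k v] by simp
qed

section \<open>Smooth maps between manifolds\<close>

lemma smooth_atlas_inj: "smooth_atlas A \<Longrightarrow> (U, c) \<in> A \<Longrightarrow> inj_on c U"
  unfolding smooth_atlas_def by blast

lemma smooth_atlas_open_Int:
  "smooth_atlas A \<Longrightarrow> (U, c) \<in> A \<Longrightarrow> (V, d) \<in> A \<Longrightarrow> open (c ` (U \<inter> V))"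
  unfolding smooth_atlas_def by blast

lemma smooth_atlas_open: "smooth_atlas A \<Longrightarrow> (U, c) \<in> A \<Longrightarrow> open (c ` U)"
  using smooth_atlas_open_Int by (metis Int_absorb)

lemma smooth_atlas_transition:
  "smooth_atlas A \<Longrightarrow> (U, c) \<in> A \<Longrightarrow> (V, d) \<in> A \<Longrightarrow>
     smooth_on (c ` (U \<inter> V)) (\<lambda>z. d (inv_into U c z))"
  unfolding smooth_atlas_def by (fastforce simp: o_def)

lemma topspace_chart_topology:
  assumes "\<And>D c. (D, c) \<in> F \<Longrightarrow> D \<subseteq> X"
  shows "topspace (chart_topology X F) = X"
proof -
  have "\<exists>S. open S \<and> X \<inter> D = D \<inter> c -` S" if "(D, c) \<in> F" for D c
    using assms[OF that] by (intro exI[of _ UNIV]) auto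
  then have "openin (chart_topology X F) X"
    unfolding openin_chart_topology by blast
  moreover have "openin (chart_topology X F) W \<Longrightarrow> W \<subseteq> X" for W
    unfolding openin_chart_topology by blast
  ultimately show ?thesis unfolding topspace_def by blast
qed

lemma topspace_manifold_topology: "topspace (manifold_topology A) = points A"
  unfolding manifold_topology_def by (rule topspace_chart_topology) (auto simp: points_def)

lemma openin_manifold_topology:
  assumes "smooth_atlas A"
  shows "openin (manifold_topology A) W \<longleftrightarrow>
    W \<subseteq> points A \<and> (\<forall>(U, c)\<in>A. open (c ` (W \<inter> U)))"
proof -
  have "(\<exists>S. open S \<and> W \<inter> U = U \<inter> c -` S) \<longleftrightarrow> open (c ` (W \<inter> U))" if "(U, c) \<in> A" for U c
  proof
    assume "\<exists>S. open S \<and> W \<inter> U = U \<inter> c -` S"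
    then obtain S where S: "open S" "W \<inter> U = U \<inter> c -` S" by blast
    then have "c ` (W \<inter> U) = c ` U \<inter> S" by auto
    then show "open (c ` (W \<inter> U))"
      using S(1) smooth_atlas_open[OF assms that] by (simp add: open_Int)
  next
    assume "open (c ` (W \<inter> U))"
    moreover have "W \<inter> U = U \<inter> c -` (c ` (W \<inter> U))"
      using smooth_atlas_inj[OF assms that] by (auto dest: inj_onD)
    ultimately show "\<exists>S. open S \<and> W \<inter> U = U \<inter> c -` S" by blast
  qed
  then show ?thesis unfolding manifold_topology_def openin_chart_topology
    by (intro arg_cong2[where f = conj] refl ball_cong) auto
qed

lemma openin_manifoldD:
  "smooth_atlas A \<Longrightarrow> openin (manifold_topology A) W \<Longrightarrow> (U, c) \<in> A \<Longrightarrow> open (c ` (W \<inter> U))"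
  using openin_manifold_topology by blast

lemma openin_points: "openin (manifold_topology A) (points A)"
  using openin_topspace[of "manifold_topology A"] unfolding topspace_manifold_topology .

lemma openin_chart_domain:
  assumes "smooth_atlas A" "(U, c) \<in> A"
  shows "openin (manifold_topology A) U"
  unfolding openin_manifold_topology[OF assms(1)]
  using assms smooth_atlas_open_Int by (fastforce simp: points_def Int_commute)

lemma obtain_chart:
  assumes "x \<in> points A"
  obtains U c where "(U, c) \<in> A" "x \<in> U"
  using assms unfolding points_def by blast

lemma smooth_mapD:
  assumes "smooth_map A B N f"
  shows "openin (manifold_topology A) N" "f ` N \<subseteq> points B"
    "(U, c) \<in> A \<Longrightarrow> (V, d) \<in> B \<Longrightarrow> open (c ` (N \<inter> U \<inter> f -` V))"
    "(U, c) \<in> A \<Longrightarrow> (V, d) \<in> B \<Longrightarrow>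
      smooth_on (c ` (N \<inter> U \<inter> f -` V)) (\<lambda>z. d (f (inv_into U c z)))"
  using assms unfolding smooth_map_def by (fastforce simp: o_def)+

lemma openin_vimage_smooth_map:
  assumes A: "smooth_atlas A" and B: "smooth_atlas B"
    and f: "smooth_map A B N f" and W: "openin (manifold_topology B) W"
  shows "openin (manifold_topology A) (N \<inter> f -` W)"
  unfolding openin_manifold_topology[OF A]
proof (intro conjI)
  show "N \<inter> f -` W \<subseteq> points A"
    using openin_subset[OF smooth_mapD(1)[OF f]] unfolding topspace_manifold_topology by blast
  show "\<forall>(U, c)\<in>A. open (c ` (N \<inter> f -` W \<inter> U))"
  proof (safe)
    fix U c assume U: "(U, c) \<in> A"
    note inj = smooth_atlas_inj[OF A U]
    \<comment> \<open>\<open>P V d\<close> is the part of the preimage that is seen through the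
      target chart \<open>d\<close>. The local expression is continuous there, and these parts cover
      the preimage.\<close>
    define P where "P V d = c ` (N \<inter> U \<inter> f -` V) \<inter> (\<lambda>z. d (f (inv_into U c z))) -` (d ` (W \<inter> V))"
      for V and d :: "'c \<Rightarrow> 'd"
    have "open (P V d)" if V: "(V, d) \<in> B" for V d
      unfolding P_def using smooth_mapD(3,4)[OF f U V] openin_manifoldD[OF B W V]
      by (intro continuous_open_preimage smooth_on_continuous_on)
    moreover have "c ` (N \<inter> f -` W \<inter> U) = (\<Union>(V, d)\<in>B. P V d)"
    proof (intro equalityI subsetI)
      fix z assume "z \<in> c ` (N \<inter> f -` W \<inter> U)"
      then obtain x where x: "x \<in> N" "f x \<in> W" "x \<in> U" "z = c x" by blast
      then have "f x \<in> points B" using smooth_mapD(2)[OF f] by blast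
      then obtain V d where V: "(V, d) \<in> B" "f x \<in> V" by (rule obtain_chart)
      then have "z \<in> P V d" using x inj by (auto simp: P_def)
      then show "z \<in> (\<Union>(V, d)\<in>B. P V d)" using V by blast
    next
      fix z assume "z \<in> (\<Union>(V, d)\<in>B. P V d)"
      then obtain V d where V: "(V, d) \<in> B" "z \<in> P V d" by blast
      then obtain x where x: "x \<in> N" "x \<in> U" "f x \<in> V" "z = c x" by (auto simp: P_def)
      then have "d (f x) \<in> d ` (W \<inter> V)" using V(2) inj by (auto simp: P_def)
      then have "f x \<in> W" using smooth_atlas_inj[OF B V(1)] x(3) by (auto dest: inj_onD)
      then show "z \<in> c ` (N \<inter> f -` W \<inter> U)" using x by blast
    qed
    ultimately show "open (c ` (N \<inter> f -` W \<inter> U))" by auto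
  qed
qed

text \<open>One pair of charts around each point suffices: any other pair differs from it by
  transition functions, applied before and after the local expression.\<close>

lemma smooth_mapI:
  assumes A: "smooth_atlas A" and B: "smooth_atlas B" and N: "openin (manifold_topology A) N"
    and loc: "\<And>x. x \<in> N \<Longrightarrow> \<exists>U c V d W. (U, c) \<in> A \<and> x \<in> U \<and> (V, d) \<in> B \<and> open W \<and>
      c x \<in> W \<and> W \<subseteq> c ` (N \<inter> U \<inter> f -` V) \<and> smooth_on W (\<lambda>z. d (f (inv_into U c z)))"
  shows "smooth_map A B N f"
proof -
  have key: "\<exists>T. open T \<and> c' x \<in> T \<and> T \<subseteq> c' ` (N \<inter> U' \<inter> f -` V') \<and>
      smooth_on T (\<lambda>z. d' (f (inv_into U' c' z)))"
    if U': "(U', c') \<in> A" and V': "(V', d') \<in> B" and x: "x \<in> N" "x \<in> U'" "f x \<in> V'"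
    for U' c' V' d' x
  proof -
    obtain U c V d W where U: "(U, c) \<in> A" "x \<in> U" and V: "(V, d) \<in> B"
      and W: "open W" "c x \<in> W" "W \<subseteq> c ` (N \<inter> U \<inter> f -` V)"
      and sm: "smooth_on W (\<lambda>z. d (f (inv_into U c z)))"
      using loc[OF x(1)] by blast
    note ic = smooth_atlas_inj[OF A U(1)] and ic' = smooth_atlas_inj[OF A U']
      and id = smooth_atlas_inj[OF B V(1)]
    \<comment> \<open>\<open>R\<close> is the part of \<open>W\<close> that is sent into the overlap
      of the two target charts; \<open>T\<close> is this part seen in the other source
      chart.\<close>
    define R where "R = W \<inter> (\<lambda>z. d (f (inv_into U c z))) -` (d ` (V \<inter> V'))"
    have "open R" unfolding R_def
      by (rule continuous_open_preimage[OF smooth_on_continuous_on[OF sm] W(1)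
            smooth_atlas_open_Int[OF B V(1) V']])
    define T where "T = c' ` (U' \<inter> U) \<inter> (\<lambda>z. c (inv_into U' c' z)) -` R"
    have "open T" unfolding T_def
      by (rule continuous_open_preimage[OF smooth_on_continuous_on[OF smooth_atlas_transition[OF A U' U(1)]]
            smooth_atlas_open_Int[OF A U' U(1)] \<open>open R\<close>])
    have fx: "f x \<in> V" using W(2,3) U(2) ic by (auto dest: inj_onD)
    have T: "\<exists>y. y \<in> N \<and> y \<in> U \<and> y \<in> U' \<and> f y \<in> V \<and> f y \<in> V' \<and> z = c' y \<and> c y \<in> R" if z: "z \<in> T" for z
    proof -
      obtain y where y: "y \<in> U'" "y \<in> U" "z = c' y" using z unfolding T_def by blast
      then have "c y \<in> R" using z ic' by (auto simp: T_def)
      then have "c y \<in> W" "d (f y) \<in> d ` (V \<inter> V')" using y(2) ic by (auto simp: R_def)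
      moreover have "y \<in> N \<and> f y \<in> V" using \<open>c y \<in> W\<close> W(3) y(2) ic by (auto dest: inj_onD)
      moreover have "f y \<in> V'" using calculation id by (auto dest: inj_onD)
      ultimately show ?thesis using y \<open>c y \<in> R\<close> by blast
    qed
    have "smooth_on T (\<lambda>z. c (inv_into U' c' z))"
      by (rule smooth_on_subset[OF smooth_atlas_transition[OF A U' U(1)]]) (auto simp: T_def)
    moreover have "smooth_on R (\<lambda>z. d (f (inv_into U c z)))"
      by (rule smooth_on_subset[OF sm]) (auto simp: R_def)
    ultimately have 1: "smooth_on T (\<lambda>z. d (f (inv_into U c (c (inv_into U' c' z)))))"
      by (intro smooth_on_compose[OF \<open>open T\<close> \<open>open R\<close>, of "\<lambda>z. c (inv_into U' c' z)"
            "\<lambda>z. d (f (inv_into U c z))"]) (auto simp: T_def)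
    have sub: "(\<lambda>z. d (f (inv_into U c (c (inv_into U' c' z))))) ` T \<subseteq> d ` (V \<inter> V')"
      using T ic ic' by fastforce
    have 2: "smooth_on T (\<lambda>z. d' (inv_into V d (d (f (inv_into U c (c (inv_into U' c' z)))))))"
      by (rule smooth_on_compose[OF \<open>open T\<close> smooth_atlas_open_Int[OF B V(1) V'] sub 1
            smooth_atlas_transition[OF B V(1) V']])
    have "smooth_on T (\<lambda>z. d' (f (inv_into U' c' z)))"
    proof (rule smooth_on_cong[OF \<open>open T\<close> _ 2])
      fix z assume "z \<in> T"
      then obtain y where "y \<in> U" "y \<in> U'" "f y \<in> V" "z = c' y" using T by blast
      then show "d' (inv_into V d (d (f (inv_into U c (c (inv_into U' c' z)))))) =
          d' (f (inv_into U' c' z))" using ic ic' id by simp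
    qed
    moreover have "c' x \<in> T"
      using x U(2) W(2) fx ic ic' by (auto simp: T_def R_def)
    moreover have "T \<subseteq> c' ` (N \<inter> U' \<inter> f -` V')" using T by blast
    ultimately show ?thesis using \<open>open T\<close> by blast
  qed
  have "f ` N \<subseteq> points B"
  proof safe
    fix x assume x: "x \<in> N"
    obtain U c V d W where U: "(U, c) \<in> A" "x \<in> U" and V: "(V, d) \<in> B"
      and W: "c x \<in> W" "W \<subseteq> c ` (N \<inter> U \<inter> f -` V)"
      using loc[OF x] by blast
    then have "f x \<in> V" using smooth_atlas_inj[OF A U(1)] by (auto dest: inj_onD)
    then show "f x \<in> points B" using V unfolding points_def by blast
  qed
  moreover have "open (c ` (N \<inter> U \<inter> f -` V)) \<and>
        smooth_on (c ` (N \<inter> U \<inter> f -` V)) (\<lambda>z. d (f (inv_into U c z)))"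
    if "(U, c) \<in> A" "(V, d) \<in> B" for U c V d
  proof
    show "open (c ` (N \<inter> U \<inter> f -` V))"
      unfolding open_subopen[of "c ` (N \<inter> U \<inter> f -` V)"] using key[OF that] by blast
    show "smooth_on (c ` (N \<inter> U \<inter> f -` V)) (\<lambda>z. d (f (inv_into U c z)))"
      by (rule smooth_on_local) (use key[OF that] in blast)
  qed
  ultimately show ?thesis using N unfolding smooth_map_def by (auto simp: o_def)
qed

lemma smooth_map_subset:
  assumes A: "smooth_atlas A" and B: "smooth_atlas B"
    and f: "smooth_map A B N f" and N': "openin (manifold_topology A) N'" "N' \<subseteq> N"
  shows "smooth_map A B N' f"
proof (rule smooth_mapI[OF A B N'(1)])
  fix x assume x: "x \<in> N'"
  have "x \<in> points A" "f x \<in> points B"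
    using openin_subset[OF N'(1)] smooth_mapD(2)[OF f] x N'(2)
    unfolding topspace_manifold_topology by auto
  then obtain U c V d where U: "(U, c) \<in> A" "x \<in> U" and V: "(V, d) \<in> B" "f x \<in> V"
    by (metis obtain_chart)
  have "c ` (N' \<inter> U \<inter> f -` V) = c ` (N \<inter> U \<inter> f -` V) \<inter> c ` (N' \<inter> U)"
    using smooth_atlas_inj[OF A U(1)] N'(2) by (auto dest: inj_onD)
  then have "open (c ` (N' \<inter> U \<inter> f -` V))"
    using smooth_mapD(3)[OF f U(1) V(1)] openin_manifoldD[OF A N'(1) U(1)] by (simp add: open_Int)
  moreover have "smooth_on (c ` (N' \<inter> U \<inter> f -` V)) (\<lambda>z. d (f (inv_into U c z)))"
    by (rule smooth_on_subset[OF smooth_mapD(4)[OF f U(1) V(1)]]) (use N'(2) in blast)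
  moreover have "c x \<in> c ` (N' \<inter> U \<inter> f -` V)" using x U(2) V(2) by blast
  ultimately show "\<exists>U c V d W. (U, c) \<in> A \<and> x \<in> U \<and> (V, d) \<in> B \<and> open W \<and>
      c x \<in> W \<and> W \<subseteq> c ` (N' \<inter> U \<inter> f -` V) \<and> smooth_on W (\<lambda>z. d (f (inv_into U c z)))"
    using U V by blast
qed

lemma smooth_map_cong:
  assumes "smooth_map A B N f" "\<And>x. x \<in> N \<Longrightarrow> f x = g x" and A: "smooth_atlas A" and B: "smooth_atlas B"
  shows "smooth_map A B N g"
proof (rule smooth_mapI[OF A B smooth_mapD(1)[OF assms(1)]])
  fix x assume x: "x \<in> N"
  have "x \<in> points A" "f x \<in> points B"
    using openin_subset[OF smooth_mapD(1)[OF assms(1)]] smooth_mapD(2)[OF assms(1)] x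
    unfolding topspace_manifold_topology by auto
  then obtain U c V d where U: "(U, c) \<in> A" "x \<in> U" and V: "(V, d) \<in> B" "f x \<in> V"
    by (metis obtain_chart)
  have eq: "N \<inter> U \<inter> f -` V = N \<inter> U \<inter> g -` V" using assms(2) by auto
  note o = smooth_mapD(3)[OF assms(1) U(1) V(1)]
  have "smooth_on (c ` (N \<inter> U \<inter> f -` V)) (\<lambda>z. d (g (inv_into U c z)))"
    by (rule smooth_on_cong[OF o _ smooth_mapD(4)[OF assms(1) U(1) V(1)]])
      (use assms(2) smooth_atlas_inj[OF A U(1)] in auto)
  moreover have "c x \<in> c ` (N \<inter> U \<inter> f -` V)" using x U(2) V(2) by blast
  ultimately show "\<exists>U c V d W. (U, c) \<in> A \<and> x \<in> U \<and> (V, d) \<in> B \<and> open W \<and>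
      c x \<in> W \<and> W \<subseteq> c ` (N \<inter> U \<inter> g -` V) \<and> smooth_on W (\<lambda>z. d (g (inv_into U c z)))"
    using U V o unfolding eq by blast
qed

lemma smooth_map_compose:
  assumes A: "smooth_atlas A" and B: "smooth_atlas B" and C: "smooth_atlas C"
    and f: "smooth_map A B N f" and g: "smooth_map B C N' g"
  shows "smooth_map A C (N \<inter> f -` N') (\<lambda>x. g (f x))"
proof (rule smooth_mapI[OF A C openin_vimage_smooth_map[OF A B f smooth_mapD(1)[OF g]]])
  fix x assume "x \<in> N \<inter> f -` N'"
  then have x: "x \<in> N" "f x \<in> N'" by auto
  have "x \<in> points A" "f x \<in> points B" "g (f x) \<in> points C"
    using openin_subset[OF smooth_mapD(1)[OF f]] smooth_mapD(2)[OF f] smooth_mapD(2)[OF g] x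
    unfolding topspace_manifold_topology by auto
  then obtain U c V d E e where U: "(U, c) \<in> A" "x \<in> U" and V: "(V, d) \<in> B" "f x \<in> V"
    and E: "(E, e) \<in> C" "g (f x) \<in> E"
    by (metis obtain_chart)
  note ic = smooth_atlas_inj[OF A U(1)] and id = smooth_atlas_inj[OF B V(1)]
  define R where "R = d ` (N' \<inter> V \<inter> g -` E)"
  define W where "W = c ` (N \<inter> U \<inter> f -` V) \<inter> (\<lambda>z. d (f (inv_into U c z))) -` R"
  have R: "open R" and "smooth_on R (\<lambda>z. e (g (inv_into V d z)))"
    unfolding R_def using smooth_mapD(3,4)[OF g V(1) E(1)] by auto
  have W: "open W" unfolding W_def
    by (rule continuous_open_preimage[OF smooth_on_continuous_on[OF smooth_mapD(4)[OF f U(1) V(1)]]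
          smooth_mapD(3)[OF f U(1) V(1)] R])
  have WE: "\<exists>y. y \<in> N \<and> y \<in> U \<and> f y \<in> V \<and> f y \<in> N' \<and> g (f y) \<in> E \<and> z = c y" if z: "z \<in> W" for z
  proof -
    obtain y where y: "y \<in> N" "y \<in> U" "f y \<in> V" "z = c y" using z unfolding W_def by blast
    then have "d (f y) \<in> R" using z ic by (auto simp: W_def)
    then show ?thesis using y id unfolding R_def by (auto dest: inj_onD)
  qed
  have sf: "smooth_on W (\<lambda>z. d (f (inv_into U c z)))"
    by (rule smooth_on_subset[OF smooth_mapD(4)[OF f U(1) V(1)]]) (auto simp: W_def)
  have "smooth_on W (\<lambda>z. e (g (inv_into V d (d (f (inv_into U c z))))))"
    by (rule smooth_on_compose[OF W R _ sf \<open>smooth_on R _\<close>]) (auto simp: W_def)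
  then have "smooth_on W (\<lambda>z. e (g (f (inv_into U c z))))"
  proof (rule smooth_on_cong[OF W, rotated])
    fix z assume "z \<in> W"
    then show "e (g (inv_into V d (d (f (inv_into U c z))))) = e (g (f (inv_into U c z)))"
      using WE ic id by fastforce
  qed
  moreover have "c x \<in> W" using x U V E ic by (auto simp: W_def R_def)
  moreover have "W \<subseteq> c ` (N \<inter> f -` N' \<inter> U \<inter> (\<lambda>x. g (f x)) -` E)" using WE by blast
  ultimately show "\<exists>U c V d W. (U, c) \<in> A \<and> x \<in> U \<and> (V, d) \<in> C \<and> open W \<and> c x \<in> W \<and>
      W \<subseteq> c ` (N \<inter> f -` N' \<inter> U \<inter> (\<lambda>x. g (f x)) -` V) \<and>
      smooth_on W (\<lambda>z. d (g (f (inv_into U c z))))"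
    using U E W by blast
qed

lemma smooth_map_ident:
  assumes A: "smooth_atlas A"
  shows "smooth_map A A (points A) (\<lambda>x. x)"
proof (rule smooth_mapI[OF A A openin_points])
  fix x assume "x \<in> points A"
  then obtain U c where U: "(U, c) \<in> A" "x \<in> U" by (rule obtain_chart)
  then have "U \<subseteq> points A" by (auto simp: points_def)
  then have eq: "points A \<inter> U \<inter> (\<lambda>x. x) -` U = U" by blast
  have "smooth_on (c ` U) (\<lambda>z. c (inv_into U c z))"
    by (rule smooth_on_cong[OF smooth_atlas_open[OF A U(1)] _ smooth_on_ident]) (simp add: f_inv_into_f)
  then show "\<exists>U c V d W. (U, c) \<in> A \<and> x \<in> U \<and> (V, d) \<in> A \<and> open W \<and> c x \<in> W \<and>
      W \<subseteq> c ` (points A \<inter> U \<inter> (\<lambda>x. x) -` V) \<and> smooth_on W (\<lambda>z. d (inv_into U c z))"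
    using U smooth_atlas_open[OF A U(1)] eq by (metis image_eqI subset_refl)
qed

section \<open>Product manifolds\<close>

lemma inv_into_map_prod:
  assumes "inj_on c U" "inj_on d V" "z \<in> c ` U" "w \<in> d ` V"
  shows "inv_into (U \<times> V) (map_prod c d) (z, w) = (inv_into U c z, inv_into V d w)"
proof (rule inv_into_f_eq)
  show "inj_on (map_prod c d) (U \<times> V)" using assms(1,2) by (rule map_prod_inj_on)
qed (use assms in \<open>auto simp: f_inv_into_f inv_into_into\<close>)

lemma prod_atlasI: "(U, c) \<in> A \<Longrightarrow> (V, d) \<in> B \<Longrightarrow> (U \<times> V, map_prod c d) \<in> prod_atlas A B"
  unfolding prod_atlas_def by blast

lemma prod_atlasE:
  assumes "(W, e) \<in> prod_atlas A B"
  obtains U c V d where "(U, c) \<in> A" "(V, d) \<in> B" "W = U \<times> V" "e = map_prod c d"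
  using assms unfolding prod_atlas_def by blast

lemma points_prod_atlas: "points (prod_atlas A B) = points A \<times> points B"
  unfolding points_def prod_atlas_def by fast

lemma smooth_atlas_prod:
  assumes A: "smooth_atlas A" and B: "smooth_atlas B"
  shows "smooth_atlas (prod_atlas A B)"
  unfolding smooth_atlas_def
proof (intro conjI ballI; clarify)
  fix W e assume "(W, e) \<in> prod_atlas A B"
  then show "inj_on e W"
    by (rule prod_atlasE) (simp add: map_prod_inj_on smooth_atlas_inj[OF A] smooth_atlas_inj[OF B])
next
  fix W e W' e' assume "(W, e) \<in> prod_atlas A B" and "(W', e') \<in> prod_atlas A B"
  then obtain U c V d U' c' V' d' where U: "(U, c) \<in> A" and V: "(V, d) \<in> B" and W: "W = U \<times> V" "e = map_prod c d"
    and U': "(U', c') \<in> A" and V': "(V', d') \<in> B" and W': "W' = U' \<times> V'" "e' = map_prod c' d'"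
    by (auto elim!: prod_atlasE)
  note oU = smooth_atlas_open_Int[OF A U U'] and oV = smooth_atlas_open_Int[OF B V V']
  have im: "e ` (W \<inter> W') = c ` (U \<inter> U') \<times> d ` (V \<inter> V')"
    unfolding W W' Times_Int_Times by force
  have o: "open (c ` (U \<inter> U') \<times> d ` (V \<inter> V'))" using oU oV by (rule open_Times)
  have "smooth_on (c ` (U \<inter> U') \<times> d ` (V \<inter> V')) (\<lambda>z. (c' (inv_into U c (fst z)), d' (inv_into V d (snd z))))"
  proof (rule smooth_on_Pair[OF o])
    show "smooth_on (c ` (U \<inter> U') \<times> d ` (V \<inter> V')) (\<lambda>z. c' (inv_into U c (fst z)))"
      by (rule smooth_on_compose[OF o oU _ smooth_on_fst[OF o smooth_on_ident] smooth_atlas_transition[OF A U U']]) auto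
    show "smooth_on (c ` (U \<inter> U') \<times> d ` (V \<inter> V')) (\<lambda>z. d' (inv_into V d (snd z)))"
      by (rule smooth_on_compose[OF o oV _ smooth_on_snd[OF o smooth_on_ident] smooth_atlas_transition[OF B V V']]) auto
  qed
  then have "smooth_on (c ` (U \<inter> U') \<times> d ` (V \<inter> V')) (e' \<circ> inv_into W e)"
  proof (rule smooth_on_cong[OF o, rotated])
    fix z assume "z \<in> c ` (U \<inter> U') \<times> d ` (V \<inter> V')"
    then have z: "fst z \<in> c ` U" "snd z \<in> d ` V" by auto
    have "inv_into W e z = (inv_into U c (fst z), inv_into V d (snd z))"
      unfolding W using inv_into_map_prod[OF smooth_atlas_inj[OF A U] smooth_atlas_inj[OF B V] z] by simp
    then show "(c' (inv_into U c (fst z)), d' (inv_into V d (snd z))) = (e' \<circ> inv_into W e) z"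
      by (simp add: W')
  qed
  then show "open (e ` (W \<inter> W')) \<and> smooth_on (e ` (W \<inter> W')) (e' \<circ> inv_into W e)"
    unfolding im using o by blast
qed

lemma smooth_map_snd_compose:
  assumes A: "smooth_atlas A" and B: "smooth_atlas B" and C: "smooth_atlas C"
    and f: "smooth_map A (prod_atlas B C) N f"
  shows "smooth_map A C N (\<lambda>x. snd (f x))"
proof (rule smooth_mapI[OF A C smooth_mapD(1)[OF f]])
  fix x assume x: "x \<in> N"
  have "x \<in> points A" "fst (f x) \<in> points B" "snd (f x) \<in> points C"
    using openin_subset[OF smooth_mapD(1)[OF f]] smooth_mapD(2)[OF f] x
    unfolding topspace_manifold_topology points_prod_atlas by auto
  then obtain U c V d E e where U: "(U, c) \<in> A" "x \<in> U" and V: "(V, d) \<in> B" "fst (f x) \<in> V"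
    and E: "(E, e) \<in> C" "snd (f x) \<in> E"
    by (metis obtain_chart)
  note VE = prod_atlasI[OF V(1) E(1)]
  let ?W = "c ` (N \<inter> U \<inter> f -` (V \<times> E))"
  have "smooth_on ?W (\<lambda>z. snd (map_prod d e (f (inv_into U c z))))"
    by (rule smooth_on_snd[OF smooth_mapD(3,4)[OF f U(1) VE]])
  moreover have "c x \<in> ?W" using x U V E by (cases "f x") auto
  moreover have "?W \<subseteq> c ` (N \<inter> U \<inter> (\<lambda>x. snd (f x)) -` E)" by auto
  ultimately show "\<exists>U c V d W. (U, c) \<in> A \<and> x \<in> U \<and> (V, d) \<in> C \<and> open W \<and> c x \<in> W \<and>
      W \<subseteq> c ` (N \<inter> U \<inter> (\<lambda>x. snd (f x)) -` V) \<and> smooth_on W (\<lambda>z. d (snd (f (inv_into U c z))))"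
    using U E smooth_mapD(3)[OF f U(1) VE] unfolding snd_map_prod by blast
qed

lemma smooth_map_Pair:
  assumes A: "smooth_atlas A" and B: "smooth_atlas B" and C: "smooth_atlas C"
    and f: "smooth_map A B N f" and g: "smooth_map A C N g"
  shows "smooth_map A (prod_atlas B C) N (\<lambda>x. (f x, g x))"
proof (rule smooth_mapI[OF A smooth_atlas_prod[OF B C] smooth_mapD(1)[OF f]])
  fix x assume x: "x \<in> N"
  have "x \<in> points A" "f x \<in> points B" "g x \<in> points C"
    using openin_subset[OF smooth_mapD(1)[OF f]] smooth_mapD(2)[OF f] smooth_mapD(2)[OF g] x
    unfolding topspace_manifold_topology by auto
  then obtain U c V d E e where U: "(U, c) \<in> A" "x \<in> U" and V: "(V, d) \<in> B" "f x \<in> V"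
    and E: "(E, e) \<in> C" "g x \<in> E"
    by (metis obtain_chart)
  define W where "W = c ` (N \<inter> U \<inter> f -` V) \<inter> c ` (N \<inter> U \<inter> g -` E)"
  have W: "open W" unfolding W_def
    using smooth_mapD(3)[OF f U(1) V(1)] smooth_mapD(3)[OF g U(1) E(1)] by (rule open_Int)
  have "smooth_on W (\<lambda>z. d (f (inv_into U c z)))" "smooth_on W (\<lambda>z. e (g (inv_into U c z)))"
    using smooth_mapD(4)[OF f U(1) V(1)] smooth_mapD(4)[OF g U(1) E(1)]
    by (auto simp: W_def elim: smooth_on_subset)
  then have "smooth_on W (\<lambda>z. map_prod d e (f (inv_into U c z), g (inv_into U c z)))"
    using smooth_on_Pair[OF W] by simp
  moreover have "c x \<in> W" using x U V E by (auto simp: W_def)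
  moreover have "W \<subseteq> c ` (N \<inter> U \<inter> (\<lambda>x. (f x, g x)) -` (V \<times> E))"
    using smooth_atlas_inj[OF A U(1)] by (auto simp: W_def dest: inj_onD)
  ultimately show "\<exists>U c V d W. (U, c) \<in> A \<and> x \<in> U \<and> (V, d) \<in> prod_atlas B C \<and> open W \<and> c x \<in> W \<and>
      W \<subseteq> c ` (N \<inter> U \<inter> (\<lambda>x. (f x, g x)) -` V) \<and>
      smooth_on W (\<lambda>z. d (f (inv_into U c z), g (inv_into U c z)))"
    using U prod_atlasI[OF V(1) E(1)] W by blast
qed

section \<open>The real line as a manifold, and real-valued functions\<close>

lemma smooth_atlas_line: "smooth_atlas line_atlas"
  using smooth_on_ident[of UNIV] by (simp add: smooth_atlas_def line_atlas_def id_def[symmetric])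

lemma points_line [simp]: "points line_atlas = UNIV"
  by (simp add: points_def line_atlas_def)

lemma openin_line: "openin (manifold_topology line_atlas) N \<longleftrightarrow> open N"
  unfolding openin_manifold_topology[OF smooth_atlas_line] points_line by (simp add: line_atlas_def)

lemma smooth_map_line_line: "smooth_map line_atlas line_atlas N f \<longleftrightarrow> open N \<and> smooth_on N f"
  unfolding smooth_map_def openin_line points_line by (auto simp: line_atlas_def o_def)

lemma smooth_map_to_lineD:
  assumes "smooth_map A line_atlas N f" "(U, c) \<in> A"
  shows "open (c ` (N \<inter> U))" "smooth_on (c ` (N \<inter> U)) (\<lambda>z. f (inv_into U c z))"
  using smooth_mapD(3,4)[OF assms, of UNIV id] by (auto simp: line_atlas_def)

lemma smooth_map_to_lineI:
  assumes A: "smooth_atlas A" and N: "openin (manifold_topology A) N"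
    and f: "\<And>x. x \<in> N \<Longrightarrow> \<exists>U c. (U, c) \<in> A \<and> x \<in> U \<and> smooth_on (c ` (N \<inter> U)) (\<lambda>z. f (inv_into U c z))"
  shows "smooth_map A line_atlas N f"
proof (rule smooth_mapI[OF A smooth_atlas_line N])
  fix x assume x: "x \<in> N"
  then obtain U c where U: "(U, c) \<in> A" "x \<in> U" "smooth_on (c ` (N \<inter> U)) (\<lambda>z. f (inv_into U c z))"
    using f by blast
  then show "\<exists>U c V d W. (U, c) \<in> A \<and> x \<in> U \<and> (V, d) \<in> line_atlas \<and> open W \<and> c x \<in> W \<and>
      W \<subseteq> c ` (N \<inter> U \<inter> f -` V) \<and> smooth_on W (\<lambda>z. d (f (inv_into U c z)))"
    using openin_manifoldD[OF A N U(1)] x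
    by (intro exI[of _ U] exI[of _ c] exI[of _ UNIV] exI[of _ id] exI[of _ "c ` (N \<inter> U)"])
      (auto simp: line_atlas_def)
qed

lemma smooth_map_mult:
  assumes A: "smooth_atlas A" and f: "smooth_map A line_atlas N f" and g: "smooth_map A line_atlas N g"
  shows "smooth_map A line_atlas N (\<lambda>x. f x * g x)"
proof (rule smooth_map_to_lineI[OF A smooth_mapD(1)[OF f]])
  fix x assume "x \<in> N"
  then have "x \<in> points A"
    using openin_subset[OF smooth_mapD(1)[OF f]] unfolding topspace_manifold_topology by blast
  then obtain U c where U: "(U, c) \<in> A" "x \<in> U" by (rule obtain_chart)
  then show "\<exists>U c. (U, c) \<in> A \<and> x \<in> U \<and> smooth_on (c ` (N \<inter> U)) (\<lambda>z. f (inv_into U c z) * g (inv_into U c z))"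
    using smooth_on_bilinear[OF bounded_bilinear_mult smooth_map_to_lineD(1)[OF f]
        smooth_map_to_lineD(2)[OF f] smooth_map_to_lineD(2)[OF g]] by blast
qed

section \<open>Inverses and composites of diffeomorphisms\<close>

lemma diffeo_inv:
  assumes "diffeo A A f" "points A = UNIV"
  shows "diffeo A A (inv_into UNIV f)"
proof -
  have "bij f" using assms by (simp add: diffeo_def)
  then show ?thesis using assms by (simp add: diffeo_def bij_imp_bij_inv inv_inv_eq)
qed

lemma diffeo_compose:
  assumes A: "smooth_atlas A" and U: "points A = UNIV" and f: "diffeo A A f" and g: "diffeo A A g"
  shows "diffeo A A (g \<circ> f)"
proof -
  have "bij f" "bij g" using f g U by (simp_all add: diffeo_def)
  then show ?thesis
    using f g U smooth_map_compose[OF A A A, of UNIV f UNIV g]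
      smooth_map_compose[OF A A A, of UNIV "inv_into UNIV g" UNIV "inv_into UNIV f"]
      bij_comp[OF \<open>bij f\<close> \<open>bij g\<close>] o_inv_distrib[OF \<open>bij g\<close> \<open>bij f\<close>]
    by (simp add: diffeo_def comp_def)
qed

section \<open>Jets\<close>

lemma same_jet_refl: "same_jet F r b s s"
  by (simp add: same_jet_def)

lemma same_jet_sym: "same_jet F r b s t \<Longrightarrow> same_jet F r b t s"
  by (simp add: same_jet_def)

lemma same_jet_trans: "same_jet F r b s t \<Longrightarrow> same_jet F r b t u \<Longrightarrow> same_jet F r b s u"
  by (simp add: same_jet_def)

lemma jet_eqI: "same_jet F r b s t \<Longrightarrow> jet F r b s = jet F r b t"
  unfolding jet_def by (auto intro: same_jet_trans same_jet_sym)

lemma fst_jet [simp]: "fst (jet F r b s) = b"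
  by (simp add: jet_def)

text \<open>The class of a local section contains that section, so the choice behind
  \<open>jet_rep\<close> is made from a non-empty set.\<close>

lemma jet_rep_jet:
  assumes "local_section F b s"
  shows "local_section F b (jet_rep (jet F r b s))" "same_jet F r b s (jet_rep (jet F r b s))"
proof -
  have "s \<in> snd (jet F r b s)" using assms by (simp add: jet_def same_jet_refl)
  then have "jet_rep (jet F r b s) \<in> snd (jet F r b s)" unfolding jet_rep_def by (rule someI[of "\<lambda>t. t \<in> _"])
  then show "local_section F b (jet_rep (jet F r b s))" "same_jet F r b s (jet_rep (jet F r b s))"
    by (simp_all add: jet_def)
qed

lemma jets_rep:
  assumes "j \<in> jets F r"
  shows "local_section F (fst j) (jet_rep j)" "jet F r (fst j) (jet_rep j) = j"
proof -
  obtain b s where j: "local_section F b s" "j = jet F r b s" using assms unfolding jets_def by blast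
  show "local_section F (fst j) (jet_rep j)" using jet_rep_jet(1)[OF j(1)] j(2) by simp
  show "jet F r (fst j) (jet_rep j) = j"
    using jet_eqI[OF jet_rep_jet(2)[OF j(1)]] j(2) by simp
qed

lemma jet_in_jets: "local_section F b s \<Longrightarrow> jet F r b s \<in> jets F r"
  unfolding jets_def by blast

lemma jet_target_jet: "local_section F b s \<Longrightarrow> jet_target (jet F r b s) = s b"
  using jet_rep_jet(2) by (fastforce simp: jet_target_def same_jet_def)

lemma deriv_eq_frechet_derivative:
  fixes f :: "real \<Rightarrow> real"
  assumes "f differentiable (at x)"
  shows "deriv f x = frechet_derivative f (at x) 1"
proof -
  have "(f has_vector_derivative vector_derivative f (at x)) (at x)"
    using assms by (simp add: vector_derivative_works)
  then show ?thesis
    using frechet_derivative_eq_vector_derivative[OF assms]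
    by (simp add: DERIV_imp_deriv has_real_derivative_iff_has_vector_derivative)
qed

section \<open>Automorphisms\<close>

text \<open>Since \<open>fst\<close> is onto, \<phi> is determined by its composite with
  \<open>fst\<close>; this makes the description in \<open>base_map\<close> definite.\<close>

lemma base_map_eqI:
  assumes "fst \<circ> \<Phi> = \<phi> \<circ> fst"
  shows "base_map \<Phi> = \<phi>"
  unfolding base_map_def
proof (rule the_equality)
  fix \<psi> assume "fst \<circ> \<Phi> = \<psi> \<circ> fst"
  then show "\<psi> = \<phi>" using assms by (metis fst_conv comp_apply ext)
qed (rule assms)

locale smooth_mfd =
  fixes M :: "('m, 'e::euclidean_space) atlas"
  assumes atlas: "smooth_atlas M" and points_M: "points M = UNIV"
begin

abbreviation "TM \<equiv> prod_atlas line_atlas M"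

lemma atlas_TM: "smooth_atlas TM"
  by (rule smooth_atlas_prod[OF smooth_atlas_line atlas])

lemma points_TM: "points TM = UNIV"
  by (simp add: points_prod_atlas points_M)

lemma chart_at: obtains U c where "(U, c) \<in> M" "y \<in> U"
  using points_M obtain_chart[of y M] by blast

lemma line_chart: "(UNIV, id) \<in> line_atlas"
  by (simp add: line_atlas_def)

lemma TM_chart: "(U, c) \<in> M \<Longrightarrow> (UNIV \<times> U, map_prod id c) \<in> TM"
  by (rule prod_atlasI[OF line_chart])

lemma AutD:
  assumes "\<Phi> \<in> Aut M"
  shows "diffeo TM TM \<Phi>" "diffeo line_atlas line_atlas (base_map \<Phi>)" "fst (\<Phi> z) = base_map \<Phi> (fst z)"
    "bij \<Phi>" "smooth_map TM TM UNIV \<Phi>" "bij (base_map \<Phi>)"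
    "smooth_on UNIV (base_map \<Phi>)" "smooth_on UNIV (inv_into UNIV (base_map \<Phi>))"
    "base_map \<Phi> (inv_into UNIV (base_map \<Phi>) x) = x" "inv_into UNIV (base_map \<Phi>) (base_map \<Phi> x) = x"
proof -
  obtain \<phi> where \<phi>: "diffeo line_atlas line_atlas \<phi>" "fst \<circ> \<Phi> = \<phi> \<circ> fst" and \<Phi>: "diffeo TM TM \<Phi>"
    using assms unfolding Aut_def by blast
  have b: "base_map \<Phi> = \<phi>" by (rule base_map_eqI[OF \<phi>(2)])
  show "diffeo TM TM \<Phi>" by fact
  then show "bij \<Phi>" "smooth_map TM TM UNIV \<Phi>" by (simp_all add: diffeo_def points_TM)
  show d: "diffeo line_atlas line_atlas (base_map \<Phi>)" using \<phi>(1) b by simp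
  then show bb: "bij (base_map \<Phi>)" and "smooth_on UNIV (base_map \<Phi>)"
    "smooth_on UNIV (inv_into UNIV (base_map \<Phi>))"
    by (simp_all add: diffeo_def smooth_map_line_line)
  show "fst (\<Phi> z) = base_map \<Phi> (fst z)" using \<phi>(2) b by (metis comp_apply)
  show "base_map \<Phi> (inv_into UNIV (base_map \<Phi>) x) = x" "inv_into UNIV (base_map \<Phi>) (base_map \<Phi> x) = x"
    using bb by (simp_all add: bij_is_surj surj_f_inv_f bij_is_inj)
qed

lemma AutI:
  "diffeo TM TM \<Phi> \<Longrightarrow> diffeo line_atlas line_atlas \<phi> \<Longrightarrow> fst \<circ> \<Phi> = \<phi> \<circ> fst \<Longrightarrow> \<Phi> \<in> Aut M"
  unfolding Aut_def by blast

lemma fst_inv_Aut: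
  assumes "\<Phi> \<in> Aut M"
  shows "fst \<circ> inv_into UNIV \<Phi> = inv_into UNIV (base_map \<Phi>) \<circ> fst"
proof
  fix z
  have "base_map \<Phi> (fst (inv_into UNIV \<Phi> z)) = fst z"
    using AutD(3)[OF assms, of "inv_into UNIV \<Phi> z"] AutD(4)[OF assms]
    by (simp add: bij_is_surj surj_f_inv_f)
  then show "(fst \<circ> inv_into UNIV \<Phi>) z = (inv_into UNIV (base_map \<Phi>) \<circ> fst) z"
    using AutD(10)[OF assms] by (metis comp_apply)
qed

lemma Aut_inv: "\<Phi> \<in> Aut M \<Longrightarrow> inv_into UNIV \<Phi> \<in> Aut M"
  by (rule AutI[OF diffeo_inv[OF AutD(1) points_TM] diffeo_inv[OF AutD(2) points_line] fst_inv_Aut])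

lemma base_map_inv: "\<Phi> \<in> Aut M \<Longrightarrow> base_map (inv_into UNIV \<Phi>) = inv_into UNIV (base_map \<Phi>)"
  by (rule base_map_eqI[OF fst_inv_Aut])

lemma Aut_compose:
  assumes "\<Phi> \<in> Aut M" "\<Psi> \<in> Aut M"
  shows "\<Phi> \<circ> \<Psi> \<in> Aut M" "base_map (\<Phi> \<circ> \<Psi>) = base_map \<Phi> \<circ> base_map \<Psi>"
proof -
  have f: "fst \<circ> (\<Phi> \<circ> \<Psi>) = (base_map \<Phi> \<circ> base_map \<Psi>) \<circ> fst"
    by (rule ext) (simp only: comp_apply AutD(3)[OF assms(1)] AutD(3)[OF assms(2)])
  show "\<Phi> \<circ> \<Psi> \<in> Aut M"
    by (rule AutI[OF diffeo_compose[OF atlas_TM points_TM AutD(1)[OF assms(2)] AutD(1)[OF assms(1)]]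
          diffeo_compose[OF smooth_atlas_line points_line AutD(2)[OF assms(2)] AutD(2)[OF assms(1)]] f])
  show "base_map (\<Phi> \<circ> \<Psi>) = base_map \<Phi> \<circ> base_map \<Psi>" by (rule base_map_eqI[OF f])
qed

lemma diffeo_id: "smooth_atlas A \<Longrightarrow> points A = UNIV \<Longrightarrow> diffeo A A id"
  using smooth_map_ident[of A] by (simp add: diffeo_def id_def[symmetric])

lemma Aut_id: "id \<in> Aut M" and base_map_id: "base_map (id :: real \<times> 'm \<Rightarrow> _) = id"
proof -
  show "id \<in> Aut M"
    by (rule AutI[OF diffeo_id[OF atlas_TM points_TM] diffeo_id[OF smooth_atlas_line points_line]]) simp
  show "base_map (id :: real \<times> 'm \<Rightarrow> _) = id" by (rule base_map_eqI) simp
qed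

section \<open>Sections of \<open>p\<close> and their velocities\<close>

abbreviation "psection \<equiv> local_section (p_fib M)"
abbreviation "pjet \<equiv> jet (p_fib M) 1"

text \<open>The fibre coordinate y' of the 1-jet of \<open>s\<close> at \<open>x\<close>, with the
  formula that \<open>J1_atlas\<close> uses for its third component.\<close>

definition vel :: "('m \<Rightarrow> 'e) \<Rightarrow> (real \<Rightarrow> real \<times> 'm) \<Rightarrow> real \<Rightarrow> 'e" where
  "vel c s x = vector_derivative (\<lambda>t. c (snd (s t))) (at x)"

lemma p_fib_simps [simp]:
  "total_atlas (p_fib M) = TM" "base_atlas (p_fib M) = line_atlas" "proj (p_fib M) = fst"
  by (simp_all add: p_fib_def)

lemma psectionD:
  assumes "psection x s" "(U, c) \<in> M" "snd (s x) \<in> U"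
  obtains N where "open N" "x \<in> N" "\<And>t. t \<in> N \<Longrightarrow> fst (s t) = t" "\<And>t. t \<in> N \<Longrightarrow> snd (s t) \<in> U"
    "smooth_on N (\<lambda>t. c (snd (s t)))"
proof -
  obtain N where N: "x \<in> N" "smooth_map line_atlas TM N s" "\<And>t. t \<in> N \<Longrightarrow> fst (s t) = t"
    using assms(1) unfolding local_section_def by auto
  have sm: "smooth_map line_atlas M N (\<lambda>t. snd (s t))"
    by (rule smooth_map_snd_compose[OF smooth_atlas_line smooth_atlas_line atlas N(2)])
  show ?thesis
  proof (rule that[of "N \<inter> (\<lambda>t. snd (s t)) -` U"])
    show "open (N \<inter> (\<lambda>t. snd (s t)) -` U)" "smooth_on (N \<inter> (\<lambda>t. snd (s t)) -` U) (\<lambda>t. c (snd (s t)))"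
      using smooth_mapD(3,4)[OF sm line_chart assms(2)] by simp_all
  qed (use N assms in auto)
qed

lemma psectionI:
  assumes N: "open N" "x \<in> N" and s: "\<And>t. t \<in> N \<Longrightarrow> fst (s t) = t" "\<And>t. t \<in> N \<Longrightarrow> snd (s t) \<in> U"
    and U: "(U, c) \<in> M" and sm: "smooth_on N (\<lambda>t. c (snd (s t)))"
  shows "psection x s"
proof -
  have N': "openin (manifold_topology line_atlas) N" using N(1) by (simp add: openin_line)
  have "smooth_map line_atlas line_atlas N (\<lambda>t. fst (s t))"
    using smooth_on_cong[OF N(1) _ smooth_on_ident, of "\<lambda>t. fst (s t)"] s(1) N(1)
    by (simp add: smooth_map_line_line)
  moreover have "smooth_map line_atlas M N (\<lambda>t. snd (s t))"
  proof (rule smooth_mapI[OF smooth_atlas_line atlas N'])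
    fix t assume t: "t \<in> N"
    have "N \<subseteq> id ` (N \<inter> UNIV \<inter> (\<lambda>t. snd (s t)) -` U)" using s(2) by auto
    moreover have "smooth_on N (\<lambda>z. c (snd (s (inv_into UNIV id z))))" using sm by simp
    ultimately show "\<exists>U c V d W. (U, c) \<in> line_atlas \<and> t \<in> U \<and> (V, d) \<in> M \<and> open W \<and> c t \<in> W \<and>
        W \<subseteq> c ` (N \<inter> U \<inter> (\<lambda>t. snd (s t)) -` V) \<and> smooth_on W (\<lambda>z. d (snd (s (inv_into U c z))))"
      using t N(1) U line_chart by (metis UNIV_I id_apply)
  qed
  ultimately have "smooth_map line_atlas TM N (\<lambda>t. (fst (s t), snd (s t)))"
    by (rule smooth_map_Pair[OF smooth_atlas_line smooth_atlas_line atlas])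
  then show ?thesis unfolding local_section_def using N(2) s(1) by auto
qed

lemma psection_fst:
  assumes "psection x s" shows "fst (s x) = x"
  using assms unfolding local_section_def by auto

lemma psection_vel:
  assumes "psection x s" "(U, c) \<in> M" "snd (s x) \<in> U"
  shows "((\<lambda>t. (t, c (snd (s t)))) has_vector_derivative (1, vel c s x)) (at x)"
    "((\<lambda>t. map_prod id c (s t)) has_vector_derivative (1, vel c s x)) (at x)"
proof -
  obtain N where N: "open N" "x \<in> N" "\<And>t. t \<in> N \<Longrightarrow> fst (s t) = t" "smooth_on N (\<lambda>t. c (snd (s t)))"
    using psectionD[OF assms] by metis
  have "((\<lambda>t. c (snd (s t))) has_vector_derivative vel c s x) (at x)"
    unfolding vel_def using smooth_on_differentiable[OF N(4,2)] by (simp add: vector_derivative_works)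
  then show D: "((\<lambda>t. (t, c (snd (s t)))) has_vector_derivative (1, vel c s x)) (at x)"
    by (intro has_vector_derivative_Pair) (auto intro!: derivative_eq_intros)
  show "((\<lambda>t. map_prod id c (s t)) has_vector_derivative (1, vel c s x)) (at x)"
    by (rule has_vector_derivative_transform_within_open[OF D N(1,2)])
      (simp add: map_prod_def split_beta N(3))
qed

lemma psection_nderiv:
  assumes "psection x s" "(U, c) \<in> M" "snd (s x) \<in> U"
  shows "nderiv [h] (\<lambda>t. map_prod id c (s t)) x = h *\<^sub>R (1, vel c s x)"
proof -
  have "((\<lambda>t. map_prod id c (s t)) has_derivative (\<lambda>h. h *\<^sub>R (1, vel c s x))) (at x)"
    using psection_vel(2)[OF assms] by (simp add: has_vector_derivative_def)
  then show ?thesis by (simp add: frechet_derivative_at[symmetric])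
qed

lemma same_pjetD:
  assumes "same_jet (p_fib M) 1 x s t" "psection x s" "psection x t" "(U, c) \<in> M" "snd (s x) \<in> U"
  shows "s x = t x" "vel c s x = vel c t x"
proof -
  show eq: "s x = t x" using assms(1) by (simp add: same_jet_def)
  have "section_coord 1 (UNIV, id) (UNIV \<times> U, map_prod id c) x s =
      section_coord 1 (UNIV, id) (UNIV \<times> U, map_prod id c) x t"
    using assms(1,5) line_chart TM_chart[OF assms(4)]
    unfolding same_jet_def p_fib_simps by (metis UNIV_I fst_conv mem_Times_iff)
  \<comment> \<open>The family of coordinates is evaluated at the unit direction of the line, where
    it yields \<open>(1, vel c s x)\<close>.\<close>
  from fun_cong[OF arg_cong[OF this, of snd], of "[1]"]
  have "nderiv [1] (\<lambda>t. map_prod id c (s t)) x = nderiv [1] (\<lambda>u. map_prod id c (t u)) x"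
    by (simp add: section_coord_def comp_def)
  then show "vel c s x = vel c t x"
    using psection_nderiv[OF assms(2,4,5), of 1] psection_nderiv[OF assms(3,4), of 1] assms(5) eq by simp
qed

lemma same_pjetI:
  assumes "psection x s" "psection x t" "s x = t x"
    and vel: "\<And>U c. (U, c) \<in> M \<Longrightarrow> snd (s x) \<in> U \<Longrightarrow> vel c s x = vel c t x"
  shows "same_jet (p_fib M) 1 x s t"
  unfolding same_jet_def p_fib_simps
proof (intro conjI ballI impI assms(3))
  fix \<kappa> \<mu> assume "\<kappa> \<in> line_atlas" "\<mu> \<in> TM" and x: "s x \<in> fst \<mu>"
  then obtain U c where \<kappa>: "\<kappa> = (UNIV, id)" and \<mu>: "\<mu> = (UNIV \<times> U, map_prod id c)" and U: "(U, c) \<in> M"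
    by (cases \<mu>) (auto simp: line_atlas_def elim!: prod_atlasE)
  have sx: "snd (s x) \<in> U" using x \<mu> by auto
  have "nderiv vs (\<lambda>t. map_prod id c (s t)) x = nderiv vs (\<lambda>u. map_prod id c (t u)) x"
    if vs: "length vs \<le> 1" for vs
  proof (cases vs)
    case Nil
    then show ?thesis using assms(3) by simp
  next
    case (Cons h ws)
    then have "vs = [h]" using vs by simp
    then show ?thesis
      using psection_nderiv[OF assms(1) U sx] psection_nderiv[OF assms(2) U] vel[OF U sx] sx assms(3) by simp
  qed
  then show "section_coord 1 \<kappa> \<mu> x s = section_coord 1 \<kappa> \<mu> x t"
    unfolding \<kappa> \<mu> section_coord_def by (auto simp: comp_def)
qed

section \<open>Prolongation to \<open>J\<^sup>1(\<real>, M)\<close>\<close>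

definition loc_dom :: "(real \<times> 'm \<Rightarrow> real \<times> 'm) \<Rightarrow> 'm set \<Rightarrow> ('m \<Rightarrow> 'e) \<Rightarrow> 'm set \<Rightarrow> (real \<times> 'e) set" where
  "loc_dom \<Phi> U c V = {z. snd z \<in> c ` U \<and> snd (\<Phi> (fst z, inv_into U c (snd z))) \<in> V}"

text \<open>The F of the overview. It represents the component of \<Phi> in the manifold only on
  \<open>loc_dom\<close>, where both charts apply.\<close>

definition loc_fun :: "(real \<times> 'm \<Rightarrow> real \<times> 'm) \<Rightarrow> 'm set \<Rightarrow> ('m \<Rightarrow> 'e) \<Rightarrow> ('m \<Rightarrow> 'e) \<Rightarrow> real \<times> 'e \<Rightarrow> 'e" where
  "loc_fun \<Phi> U c d = (\<lambda>z. d (snd (\<Phi> (fst z, inv_into U c (snd z)))))"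

lemma loc_fun_smooth:
  assumes \<Phi>: "\<Phi> \<in> Aut M" and U: "(U, c) \<in> M" and V: "(V, d) \<in> M"
  shows "open (loc_dom \<Phi> U c V)" "smooth_on (loc_dom \<Phi> U c V) (loc_fun \<Phi> U c d)"
proof -
  note sm = smooth_map_snd_compose[OF atlas_TM smooth_atlas_line atlas AutD(5)[OF \<Phi>]]
  note ic = smooth_atlas_inj[OF atlas U]
  have inv: "inv_into (UNIV \<times> U) (map_prod id c) (x, z) = (x, inv_into U c z)" if "z \<in> c ` U" for x :: real and z
    using inv_into_map_prod[OF inj_on_id ic _ that, of x UNIV] by simp
  have eq: "map_prod id c ` (UNIV \<inter> (UNIV \<times> U) \<inter> (\<lambda>z. snd (\<Phi> z)) -` V) = loc_dom \<Phi> U c V"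
  proof (intro equalityI subsetI)
    fix z assume z: "z \<in> loc_dom \<Phi> U c V"
    then have "map_prod id c (fst z, inv_into U c (snd z)) = z" "inv_into U c (snd z) \<in> U"
      by (simp_all add: loc_dom_def f_inv_into_f inv_into_into)
    then show "z \<in> map_prod id c ` (UNIV \<inter> (UNIV \<times> U) \<inter> (\<lambda>z. snd (\<Phi> z)) -` V)"
      using z by (intro image_eqI[of z "map_prod id c" "(fst z, inv_into U c (snd z))"]) (auto simp: loc_dom_def)
  qed (use ic in \<open>auto simp: loc_dom_def\<close>)
  show o: "open (loc_dom \<Phi> U c V)"
    using smooth_mapD(3)[OF sm TM_chart[OF U] V] unfolding eq .
  show "smooth_on (loc_dom \<Phi> U c V) (loc_fun \<Phi> U c d)"
    using smooth_mapD(4)[OF sm TM_chart[OF U] V] unfolding eq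
    by (rule smooth_on_cong[OF o, rotated]) (use inv in \<open>auto simp: loc_dom_def loc_fun_def\<close>)
qed

definition push :: "(real \<times> 'm \<Rightarrow> real \<times> 'm) \<Rightarrow> (real \<Rightarrow> real \<times> 'm) \<Rightarrow> real \<Rightarrow> real \<times> 'm" where
  "push \<Phi> s = \<Phi> \<circ> s \<circ> inv_into UNIV (base_map \<Phi>)"

text \<open>In charts the pushed section is the composite of F, the curve \<gamma> t = (t, y t) and
  the inverse \<psi> of the base map; the chain rule for this composite gives its velocity. The
  division by \<phi>' x appears as the factor \<psi>' (\<phi> x).\<close>

lemma push_section:
  assumes \<Phi>: "\<Phi> \<in> Aut M" and s: "psection x s" and U: "(U, c) \<in> M" "snd (s x) \<in> U"
    and V: "(V, d) \<in> M" "snd (\<Phi> (s x)) \<in> V"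
  shows "psection (base_map \<Phi> x) (push \<Phi> s)" "push \<Phi> s (base_map \<Phi> x) = \<Phi> (s x)"
    "vel d (push \<Phi> s) (base_map \<Phi> x) = deriv (inv_into UNIV (base_map \<Phi>)) (base_map \<Phi> x) *\<^sub>R
      frechet_derivative (loc_fun \<Phi> U c d) (at (x, c (snd (s x)))) (1, vel c s x)"
proof -
  let ?\<psi> = "inv_into UNIV (base_map \<Phi>)" and ?y = "base_map \<Phi> x" and ?F = "loc_fun \<Phi> U c d"
  let ?\<gamma> = "\<lambda>t. (t, c (snd (s t)))"
  note [simp] = AutD(9,10)[OF \<Phi>]
  note ic = smooth_atlas_inj[OF atlas U(1)]
  obtain N where N: "open N" "x \<in> N" "\<And>t. t \<in> N \<Longrightarrow> fst (s t) = t" "\<And>t. t \<in> N \<Longrightarrow> snd (s t) \<in> U"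
    "smooth_on N (\<lambda>t. c (snd (s t)))"
    using psectionD[OF s U] by metis
  have s\<gamma>: "(t, inv_into U c (c (snd (s t)))) = s t" if "t \<in> N" for t
    using ic N(3,4)[OF that] by (metis inv_into_f_f prod.collapse)
  note F = loc_fun_smooth[OF \<Phi> U(1) V(1)]
  have \<gamma>: "smooth_on N ?\<gamma>" by (rule smooth_on_Pair[OF N(1) smooth_on_ident N(5)])
  \<comment> \<open>\<open>N1\<close> restricts the parameter so that the curve stays where F
    represents \<Phi>. \<open>N2\<close> is the image of \<open>N1\<close> under the base map,
    written as a preimage under the continuous inverse.\<close>
  define N1 where "N1 = N \<inter> ?\<gamma> -` loc_dom \<Phi> U c V"
  have N1: "open N1" unfolding N1_def
    by (rule continuous_open_preimage[OF smooth_on_continuous_on[OF \<gamma>] N(1) F(1)])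
  have x1: "x \<in> N1" using N U V s\<gamma>[OF N(2)] by (simp add: N1_def loc_dom_def)
  have F\<gamma>: "smooth_on N1 (\<lambda>t. ?F (?\<gamma> t))"
    by (rule smooth_on_compose[OF N1 F(1) _ smooth_on_subset[OF \<gamma>] F(2)]) (auto simp: N1_def)
  define N2 where "N2 = UNIV \<inter> ?\<psi> -` N1"
  have N2: "open N2" unfolding N2_def
    by (rule continuous_open_preimage[OF smooth_on_continuous_on[OF AutD(8)[OF \<Phi>]] open_UNIV N1])
  have eq: "d (snd (push \<Phi> s t)) = ?F (?\<gamma> (?\<psi> t))" "snd (push \<Phi> s t) \<in> V" if "t \<in> N2" for t
  proof -
    have "?\<psi> t \<in> N1" using that by (simp add: N2_def)
    then have "?\<psi> t \<in> N" "?\<gamma> (?\<psi> t) \<in> loc_dom \<Phi> U c V" unfolding N1_def by auto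
    then show "d (snd (push \<Phi> s t)) = ?F (?\<gamma> (?\<psi> t))" "snd (push \<Phi> s t) \<in> V"
      using s\<gamma> by (simp_all add: loc_fun_def push_def loc_dom_def)
  qed
  have "smooth_on N2 (\<lambda>t. ?F (?\<gamma> (?\<psi> t)))"
    by (rule smooth_on_compose[OF N2 N1 _ smooth_on_subset[OF AutD(8)[OF \<Phi>]] F\<gamma>]) (auto simp: N2_def)
  then have sm: "smooth_on N2 (\<lambda>t. d (snd (push \<Phi> s t)))"
    by (rule smooth_on_cong[OF N2, rotated]) (simp add: eq)
  have y2: "?y \<in> N2" using x1 by (simp add: N2_def)
  show "psection ?y (push \<Phi> s)"
  proof (rule psectionI[OF N2 y2 _ eq(2) V(1) sm])
    fix t assume "t \<in> N2"
    then have "?\<psi> t \<in> N" by (simp add: N2_def N1_def)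
    then show "fst (push \<Phi> s t) = t" using N(3) AutD(3)[OF \<Phi>] by (simp add: push_def)
  qed
  show "push \<Phi> s ?y = \<Phi> (s x)" by (simp add: push_def)
  have "(?\<psi> has_vector_derivative deriv ?\<psi> ?y) (at ?y)"
    using smooth_on_differentiable[OF AutD(8)[OF \<Phi>], of ?y]
    by (simp add: deriv_eq_frechet_derivative frechet_derivative_eq_vector_derivative vector_derivative_works)
  moreover have "(?\<gamma> has_vector_derivative (1, vel c s x)) (at (?\<psi> ?y))"
    using psection_vel(1)[OF s U] by simp
  ultimately have "(?\<gamma> \<circ> ?\<psi> has_vector_derivative deriv ?\<psi> ?y *\<^sub>R (1, vel c s x)) (at ?y)"
    by (rule vector_diff_chain_at)
  then have D: "((\<lambda>t. ?\<gamma> (?\<psi> t)) has_derivative (\<lambda>h. h *\<^sub>R deriv ?\<psi> ?y *\<^sub>R (1, vel c s x))) (at ?y)"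
    by (simp only: has_vector_derivative_def comp_def)
  have in_dom: "(x, c (snd (s x))) \<in> loc_dom \<Phi> U c V" using x1 by (simp add: N1_def)
  interpret DF: linear "frechet_derivative ?F (at (x, c (snd (s x))))"
    by (rule linear_frechet_derivative[OF smooth_on_differentiable[OF F(2) in_dom]])
  have "(?F has_derivative frechet_derivative ?F (at (x, c (snd (s x))))) (at (?\<gamma> (?\<psi> ?y)))"
    using smooth_on_has_derivative[OF F(2) in_dom] by simp
  from has_derivative_compose[OF D this]
  have "((\<lambda>t. ?F (?\<gamma> (?\<psi> t))) has_vector_derivative
      deriv ?\<psi> ?y *\<^sub>R frechet_derivative ?F (at (x, c (snd (s x)))) (1, vel c s x)) (at ?y)"
    by (simp only: has_vector_derivative_def DF.scale)
  then have "((\<lambda>t. d (snd (push \<Phi> s t))) has_vector_derivative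
      deriv ?\<psi> ?y *\<^sub>R frechet_derivative ?F (at (x, c (snd (s x)))) (1, vel c s x)) (at ?y)"
    by (rule has_vector_derivative_transform_within_open[OF _ N2 y2]) (simp add: eq)
  then show "vel d (push \<Phi> s) ?y = deriv ?\<psi> ?y *\<^sub>R
      frechet_derivative ?F (at (x, c (snd (s x)))) (1, vel c s x)"
    unfolding vel_def by (rule vector_derivative_at)
qed

lemma psection_push: "\<Phi> \<in> Aut M \<Longrightarrow> psection x s \<Longrightarrow> psection (base_map \<Phi> x) (push \<Phi> s)"
  by (metis push_section(1) chart_at)

lemma push_at: "\<Phi> \<in> Aut M \<Longrightarrow> push \<Phi> s (base_map \<Phi> x) = \<Phi> (s x)"
  by (simp add: push_def AutD(10))

text \<open>Value and velocity of the pushed section depend on the section only through its own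
  value and velocity at \<open>x\<close>, so \<open>push\<close> descends to 1-jets.\<close>

lemma push_same_jet:
  assumes \<Phi>: "\<Phi> \<in> Aut M" and s: "psection x s" and t: "psection x t" and st: "same_jet (p_fib M) 1 x s t"
  shows "same_jet (p_fib M) 1 (base_map \<Phi> x) (push \<Phi> s) (push \<Phi> t)"
proof (rule same_pjetI[OF psection_push[OF \<Phi> s] psection_push[OF \<Phi> t]])
  have eq: "s x = t x" using st by (simp add: same_jet_def)
  then show "push \<Phi> s (base_map \<Phi> x) = push \<Phi> t (base_map \<Phi> x)" by (simp add: push_at[OF \<Phi>])
  fix V d assume V: "(V, d) \<in> M" "snd (push \<Phi> s (base_map \<Phi> x)) \<in> V"
  obtain U c where U: "(U, c) \<in> M" "snd (s x) \<in> U" by (rule chart_at)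
  show "vel d (push \<Phi> s) (base_map \<Phi> x) = vel d (push \<Phi> t) (base_map \<Phi> x)"
    using push_section(3)[OF \<Phi> s U V(1)] push_section(3)[OF \<Phi> t U(1) _ V(1)] V(2) U(2)
      same_pjetD[OF st s t U] eq by (simp add: push_at[OF \<Phi>])
qed

lemma J1_rep: "j \<in> J1 M \<Longrightarrow> psection (fst j) (jet_rep j)" "j \<in> J1 M \<Longrightarrow> pjet (fst j) (jet_rep j) = j"
  unfolding J1_def using jets_rep by blast+

lemma pjet_in_J1: "psection x s \<Longrightarrow> pjet x s \<in> J1 M"
  unfolding J1_def by (rule jet_in_jets)

lemma prolong1_eq: "prolong1 M \<Phi> j = pjet (base_map \<Phi> (fst j)) (push \<Phi> (jet_rep j))"
  by (simp add: prolong1_def prolong_def push_def)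

text \<open>The prolongation is defined by pushing the chosen representative; by the descent to jets
  any section of the class may be pushed instead.\<close>

lemma prolong1_pjet:
  assumes "\<Phi> \<in> Aut M" "psection x s"
  shows "prolong1 M \<Phi> (pjet x s) = pjet (base_map \<Phi> x) (push \<Phi> s)"
  unfolding prolong1_eq fst_jet
  by (rule jet_eqI[OF push_same_jet[OF assms(1) jet_rep_jet(1)[OF assms(2)] assms(2)
          same_jet_sym[OF jet_rep_jet(2)[OF assms(2)]]]])

lemma prolong1_in_J1: "\<Phi> \<in> Aut M \<Longrightarrow> j \<in> J1 M \<Longrightarrow> prolong1 M \<Phi> j \<in> J1 M"
  unfolding prolong1_eq by (intro pjet_in_J1 psection_push J1_rep)

lemma fst_prolong1 [simp]: "fst (prolong1 M \<Phi> j) = base_map \<Phi> (fst j)"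
  by (simp add: prolong1_eq)

lemma jet_target_prolong1:
  "\<Phi> \<in> Aut M \<Longrightarrow> j \<in> J1 M \<Longrightarrow> jet_target (prolong1 M \<Phi> j) = \<Phi> (jet_target j)"
  unfolding prolong1_eq
  by (simp add: jet_target_jet psection_push J1_rep push_at) (simp add: jet_target_def)

lemma prolong1_id: "j \<in> J1 M \<Longrightarrow> prolong1 M id j = j"
  using J1_rep(2) by (simp add: prolong1_eq base_map_id push_def inv_id)

lemma prolong1_inv:
  assumes "\<Phi> \<in> Aut M" "j \<in> J1 M"
  shows "prolong1 M (inv_into UNIV \<Phi>) (prolong1 M \<Phi> j) = j"
proof -
  note j = J1_rep[OF assms(2)]
  have "push (inv_into UNIV \<Phi>) (push \<Phi> (jet_rep j)) = jet_rep j"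
    using AutD(4,6)[OF assms(1)]
    by (simp add: push_def base_map_inv[OF assms(1)] fun_eq_iff bij_is_inj inv_inv_eq)
  then show ?thesis
    unfolding prolong1_eq[of \<Phi>] prolong1_pjet[OF Aut_inv[OF assms(1)] psection_push[OF assms(1) j(1)]]
    using AutD(10)[OF assms(1)] j(2) by (simp add: base_map_inv[OF assms(1)])
qed

lemma inv_inv_Aut: "\<Phi> \<in> Aut M \<Longrightarrow> inv_into UNIV (inv_into UNIV \<Phi>) = \<Phi>"
  by (rule inv_inv_eq[OF AutD(4)])

lemma prolong1_inv':
  assumes "\<Phi> \<in> Aut M" "j \<in> J1 M"
  shows "prolong1 M \<Phi> (prolong1 M (inv_into UNIV \<Phi>) j) = j"
  using prolong1_inv[OF Aut_inv[OF assms(1)] assms(2)] by (simp add: inv_inv_Aut[OF assms(1)])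

text \<open>The action on sections of q composes with an inverse taken on \<open>J1 M\<close>.
  Recognised as the prolongation of the inverse automorphism, that inverse is smooth.\<close>

lemma inv_into_prolong1:
  assumes "\<Phi> \<in> Aut M" "j \<in> J1 M"
  shows "inv_into (J1 M) (prolong1 M \<Phi>) j = prolong1 M (inv_into UNIV \<Phi>) j"
proof (rule inv_into_f_eq)
  show "inj_on (prolong1 M \<Phi>) (J1 M)"
    using prolong1_inv[OF assms(1)] by (rule inj_on_inverseI)
qed (use assms in \<open>simp_all add: prolong1_in_J1 Aut_inv prolong1_inv'\<close>)

section \<open>The charts of \<open>J\<^sup>1(\<real>, M)\<close>\<close>

definition jdom :: "'m set \<Rightarrow> 'm jet1 set" where
  "jdom U = {j \<in> J1 M. snd (jet_target j) \<in> U}"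

definition jcoord :: "('m \<Rightarrow> 'e) \<Rightarrow> 'm jet1 \<Rightarrow> real \<times> 'e \<times> 'e" where
  "jcoord c j = (fst j, c (snd (jet_target j)), vel c (jet_rep j) (fst j))"

lemma J1_atlas_eq: "J1_atlas M = {(jdom U, jcoord c) |U c. (U, c) \<in> M}"
  unfolding J1_atlas_def jdom_def jcoord_def[abs_def] vel_def by simp

lemma J1_chart: "(U, c) \<in> M \<Longrightarrow> (jdom U, jcoord c) \<in> J1_atlas M"
  unfolding J1_atlas_eq by blast

lemma J1_atlasE:
  assumes "(D, e) \<in> J1_atlas M"
  obtains U c where "(U, c) \<in> M" "D = jdom U" "e = jcoord c"
  using assms unfolding J1_atlas_eq by blast

lemma points_J1: "points (J1_atlas M) = J1 M"
proof (intro equalityI subsetI)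
  fix j assume "j \<in> J1 M"
  moreover obtain U c where "(U, c) \<in> M" "snd (jet_target j) \<in> U" by (rule chart_at)
  ultimately have "j \<in> jdom U" "(jdom U, jcoord c) \<in> J1_atlas M"
    using J1_chart by (simp_all add: jdom_def)
  then show "j \<in> points (J1_atlas M)" unfolding points_def by blast
next
  fix j assume "j \<in> points (J1_atlas M)"
  then obtain D e where "(D, e) \<in> J1_atlas M" "j \<in> D" by (rule obtain_chart)
  then show "j \<in> J1 M" by (metis (lifting) J1_atlasE jdom_def mem_Collect_eq)
qed

lemma jdom_J1: "j \<in> jdom U \<Longrightarrow> j \<in> J1 M"
  by (simp add: jdom_def)

lemma jdomD: "j \<in> jdom U \<Longrightarrow> snd (jet_rep j (fst j)) \<in> U"
  by (simp add: jdom_def jet_target_def)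

lemma jcoord_pjet:
  assumes "psection x s" "(U, c) \<in> M" "snd (s x) \<in> U"
  shows "pjet x s \<in> jdom U" "jcoord c (pjet x s) = (x, c (snd (s x)), vel c s x)"
  using assms pjet_in_J1 same_pjetD[OF jet_rep_jet(2) assms(1) jet_rep_jet(1)]
  by (simp_all add: jdom_def jcoord_def jet_target_jet)

lemma fst_jet_target: "j \<in> J1 M \<Longrightarrow> fst (jet_target j) = fst j"
  using psection_fst[OF J1_rep(1)] by (simp add: jet_target_def)

lemma jcoord_prolong1:
  assumes \<Phi>: "\<Phi> \<in> Aut M" and U: "(U, c) \<in> M" and V: "(V, d) \<in> M" and j: "j \<in> jdom U"
    and pj: "prolong1 M \<Phi> j \<in> jdom V"
  shows "jcoord d (prolong1 M \<Phi> j) =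
    (base_map \<Phi> (fst j), loc_fun \<Phi> U c d (fst j, c (snd (jet_target j))),
     deriv (inv_into UNIV (base_map \<Phi>)) (base_map \<Phi> (fst j)) *\<^sub>R
       frechet_derivative (loc_fun \<Phi> U c d) (at (fst j, c (snd (jet_target j))))
         (1, vel c (jet_rep j) (fst j)))"
proof -
  have jJ: "j \<in> J1 M" by (rule jdom_J1[OF j])
  have t: "snd (jet_target j) \<in> U" using j by (simp add: jdom_def)
  then have jt: "snd (jet_rep j (fst j)) \<in> U" by (simp add: jet_target_def)
  have "snd (\<Phi> (jet_target j)) \<in> V" using pj jet_target_prolong1[OF \<Phi> jJ] by (simp add: jdom_def)
  then have v: "snd (\<Phi> (jet_rep j (fst j))) \<in> V" by (simp add: jet_target_def)
  have v': "snd (push \<Phi> (jet_rep j) (base_map \<Phi> (fst j))) \<in> V" using v by (simp add: push_at[OF \<Phi>])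
  have "(fst j, inv_into U c (c (snd (jet_target j)))) = jet_target j"
    using fst_jet_target[OF jJ] smooth_atlas_inj[OF atlas U] t by (metis inv_into_f_f prod.collapse)
  then have "loc_fun \<Phi> U c d (fst j, c (snd (jet_target j))) = d (snd (\<Phi> (jet_target j)))"
    by (simp add: loc_fun_def)
  then show ?thesis
    unfolding prolong1_eq jcoord_pjet(2)[OF psection_push[OF \<Phi> J1_rep(1)[OF jJ]] V v']
    using push_section(3)[OF \<Phi> J1_rep(1)[OF jJ] U jt V v] by (simp add: push_at[OF \<Phi>] jet_target_def)
qed

text \<open>Jets are compared in all charts while equal coordinates are given in one. The velocity
  formula for the identity automorphism carries the equality of velocities from chart
  \<open>c\<close> to every other chart.\<close>

lemma inj_on_jcoord:
  assumes "(U, c) \<in> M"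
  shows "inj_on (jcoord c) (jdom U)"
proof (rule inj_onI)
  fix i j assume i: "i \<in> jdom U" and j: "j \<in> jdom U" and eq: "jcoord c i = jcoord c j"
  note iJ = jdom_J1[OF i] and jJ = jdom_J1[OF j]
  have "snd (jet_target i) = snd (jet_target j)"
    using eq i j smooth_atlas_inj[OF atlas assms] by (auto simp: jcoord_def jdom_def dest: inj_onD)
  moreover have f: "fst i = fst j" using eq by (simp add: jcoord_def)
  ultimately have t: "jet_target i = jet_target j"
    using fst_jet_target[OF iJ] fst_jet_target[OF jJ] by (simp add: prod_eq_iff)
  have sj: "psection (fst i) (jet_rep j)" using J1_rep(1)[OF jJ] f by simp
  note si = J1_rep(1)[OF iJ]
  have v: "vel c (jet_rep i) (fst i) = vel c (jet_rep j) (fst i)"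
    using eq f by (simp add: jcoord_def)
  have e: "jet_rep i (fst i) = jet_rep j (fst i)" using t f by (simp add: jet_target_def)
  have "same_jet (p_fib M) 1 (fst i) (jet_rep i) (jet_rep j)"
  proof (rule same_pjetI[OF si sj e])
    fix V d assume V: "(V, d) \<in> M" "snd (jet_rep i (fst i)) \<in> V"
    have p: "push id s = s" for s by (simp add: push_def base_map_id inv_id)
    show "vel d (jet_rep i) (fst i) = vel d (jet_rep j) (fst i)"
      using push_section(3)[OF Aut_id si assms jdomD[OF i] V(1)]
        push_section(3)[OF Aut_id sj assms _ V(1)] V(2) e v jdomD[OF i]
      by (simp add: p base_map_id)
  qed
  then show "i = j" using jet_eqI J1_rep(2)[OF iJ] J1_rep(2)[OF jJ] f by metis
qed

lemma jcoord_image: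
  assumes U: "(U, c) \<in> M"
  shows "jcoord c ` jdom U = UNIV \<times> c ` U \<times> UNIV"
proof (intro equalityI subsetI)
  fix w :: "real \<times> 'e \<times> 'e" assume "w \<in> UNIV \<times> c ` U \<times> UNIV"
  then obtain x z v where w: "w = (x, z, v)" "z \<in> c ` U" by (cases w) auto
  \<comment> \<open>The curve that is affine in the chart, at \<open>z\<close> at time
    \<open>x\<close> and with velocity \<open>v\<close>; it realises the prescribed coordinates. It
    is a section inside \<open>U\<close> only for the times in \<open>N\<close>.\<close>
  define s where "s = (\<lambda>t. (t, inv_into U c (z + (t - x) *\<^sub>R v)))"
  define N where "N = UNIV \<inter> (\<lambda>t. z + (t - x) *\<^sub>R v) -` (c ` U)"
  have "continuous_on UNIV (\<lambda>t. z + (t - x) *\<^sub>R v)" by (intro continuous_intros)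
  then have N: "open N" unfolding N_def
    by (rule continuous_open_preimage[OF _ open_UNIV smooth_atlas_open[OF atlas U]])
  have cs: "c (snd (s t)) = z + (t - x) *\<^sub>R v" "snd (s t) \<in> U" if "t \<in> N" for t
    using that by (simp_all add: s_def N_def f_inv_into_f inv_into_into)
  have "smooth_on N (\<lambda>t::real. (z - x *\<^sub>R v) + t *\<^sub>R v)"
    by (intro smooth_on_add[OF N] smooth_on_const smooth_on_scaleR[OF N] smooth_on_ident)
  then have sm: "smooth_on N (\<lambda>t. c (snd (s t)))"
    by (rule smooth_on_cong[OF N, rotated]) (simp add: cs algebra_simps)
  have x: "x \<in> N" using w by (simp add: N_def)
  have s: "psection x s"
    by (rule psectionI[OF N x _ cs(2) U sm]) (simp_all add: s_def)
  have "((\<lambda>t. z + (t - x) *\<^sub>R v) has_vector_derivative v) (at x)"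
    by (auto intro!: derivative_eq_intros)
  then have "((\<lambda>t. c (snd (s t))) has_vector_derivative v) (at x)"
    by (rule has_vector_derivative_transform_within_open[OF _ N x]) (simp add: cs)
  then have "vel c s x = v" unfolding vel_def by (rule vector_derivative_at)
  then have "jcoord c (pjet x s) = w" "pjet x s \<in> jdom U"
    using jcoord_pjet[OF s U cs(2)[OF x]] cs(1)[OF x] w by simp_all
  then show "w \<in> jcoord c ` jdom U" by blast
qed (auto simp: jcoord_def jdom_def)

text \<open>Division by \<phi>' x is written as multiplication by the derivative of the inverse at
  \<phi> x, and in terms of \<open>frechet_derivative\<close>, so that smoothness of the factor
  comes directly from that of the inverse.\<close>

definition loc_prolong :: "(real \<times> 'm \<Rightarrow> real \<times> 'm) \<Rightarrow> 'm set \<Rightarrow> ('m \<Rightarrow> 'e) \<Rightarrow> ('m \<Rightarrow> 'e)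
    \<Rightarrow> real \<times> 'e \<times> 'e \<Rightarrow> real \<times> 'e \<times> 'e" where
  "loc_prolong \<Phi> U c d w = (base_map \<Phi> (fst w), loc_fun \<Phi> U c d (fst w, fst (snd w)),
     frechet_derivative (inv_into UNIV (base_map \<Phi>)) (at (base_map \<Phi> (fst w))) 1 *\<^sub>R
       frechet_derivative (loc_fun \<Phi> U c d) (at (fst w, fst (snd w))) (1, snd (snd w)))"

text \<open>A full cylinder over \<open>loc_dom\<close> in the velocity direction, so vertical
  translations never leave it.\<close>

definition loc_prolong_dom :: "(real \<times> 'm \<Rightarrow> real \<times> 'm) \<Rightarrow> 'm set \<Rightarrow> ('m \<Rightarrow> 'e) \<Rightarrow> 'm set
    \<Rightarrow> (real \<times> 'e \<times> 'e) set" where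
  "loc_prolong_dom \<Phi> U c V = {w. (fst w, fst (snd w)) \<in> loc_dom \<Phi> U c V}"

lemma loc_prolong:
  assumes \<Phi>: "\<Phi> \<in> Aut M" and U: "(U, c) \<in> M" and V: "(V, d) \<in> M" and j: "j \<in> jdom U"
    and pj: "prolong1 M \<Phi> j \<in> jdom V"
  shows "jcoord d (prolong1 M \<Phi> j) = loc_prolong \<Phi> U c d (jcoord c j)"
  unfolding jcoord_prolong1[OF assms] loc_prolong_def
  using deriv_eq_frechet_derivative[OF smooth_on_differentiable[OF AutD(8)[OF \<Phi>]]] by (simp add: jcoord_def)

lemma prolong1_in_jdom:
  assumes \<Phi>: "\<Phi> \<in> Aut M" and U: "(U, c) \<in> M" and j: "j \<in> jdom U"
  shows "prolong1 M \<Phi> j \<in> jdom V \<longleftrightarrow> jcoord c j \<in> loc_prolong_dom \<Phi> U c V"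
proof -
  have jJ: "j \<in> J1 M" by (rule jdom_J1[OF j])
  have t: "snd (jet_target j) \<in> U" using j by (simp add: jdom_def)
  have "(fst j, inv_into U c (c (snd (jet_target j)))) = jet_target j"
    using fst_jet_target[OF jJ] smooth_atlas_inj[OF atlas U] t by (metis inv_into_f_f prod.collapse)
  then show ?thesis
    using t prolong1_in_J1[OF \<Phi> jJ]
    by (simp add: jdom_def loc_prolong_dom_def loc_dom_def jcoord_def jet_target_prolong1[OF \<Phi> jJ])
qed

lemma loc_prolong_smooth:
  assumes \<Phi>: "\<Phi> \<in> Aut M" and U: "(U, c) \<in> M" and V: "(V, d) \<in> M"
  shows "open (loc_prolong_dom \<Phi> U c V)" "smooth_on (loc_prolong_dom \<Phi> U c V) (loc_prolong \<Phi> U c d)"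
proof -
  let ?D = "loc_prolong_dom \<Phi> U c V" and ?\<pi> = "\<lambda>w::real \<times> 'e \<times> 'e. (fst w, fst (snd w))"
  note F = loc_fun_smooth[OF \<Phi> U V]
  have "?D = UNIV \<inter> ?\<pi> -` loc_dom \<Phi> U c V" by (auto simp: loc_prolong_dom_def)
  moreover have "continuous_on UNIV ?\<pi>" by (intro continuous_intros)
  ultimately show o: "open ?D" using continuous_open_preimage[OF _ open_UNIV F(1)] by metis
  have s1: "smooth_on ?D fst" by (rule smooth_on_fst[OF o smooth_on_ident])
  have s2: "smooth_on ?D snd" by (rule smooth_on_snd[OF o smooth_on_ident])
  have s3: "smooth_on ?D (\<lambda>w. snd (snd w))" by (rule smooth_on_snd[OF o s2])
  have \<pi>: "smooth_on ?D ?\<pi>" by (rule smooth_on_Pair[OF o s1 smooth_on_fst[OF o s2]])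
  have im: "?\<pi> ` ?D \<subseteq> loc_dom \<Phi> U c V" by (auto simp: loc_prolong_dom_def)
  have b: "smooth_on ?D (\<lambda>w. base_map \<Phi> (fst w))"
    by (rule smooth_on_compose[OF o open_UNIV subset_UNIV s1 AutD(7)[OF \<Phi>]])
  have f: "smooth_on ?D (\<lambda>w. loc_fun \<Phi> U c d (?\<pi> w))"
    by (rule smooth_on_compose[OF o F(1) im \<pi> F(2)])
  have k: "smooth_on ?D (\<lambda>w. frechet_derivative (inv_into UNIV (base_map \<Phi>)) (at (base_map \<Phi> (fst w))) 1)"
    by (rule smooth_on_derivative_apply[OF open_UNIV AutD(8)[OF \<Phi>] o b smooth_on_const subset_UNIV])
  have v: "smooth_on ?D (\<lambda>w. frechet_derivative (loc_fun \<Phi> U c d) (at (?\<pi> w)) (1, snd (snd w)))"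
    by (rule smooth_on_derivative_apply[OF F o \<pi> smooth_on_Pair[OF o smooth_on_const s3] im])
  show "smooth_on ?D (loc_prolong \<Phi> U c d)"
    unfolding loc_prolong_def[abs_def]
    by (rule smooth_on_Pair[OF o b smooth_on_Pair[OF o f smooth_on_scaleR[OF o k v]]])
qed

lemma prolong1_chart:
  assumes \<Phi>: "\<Phi> \<in> Aut M" and U: "(U, c) \<in> M" and V: "(V, d) \<in> M"
  shows "jcoord c ` (J1 M \<inter> jdom U \<inter> prolong1 M \<Phi> -` jdom V) = loc_prolong_dom \<Phi> U c V"
    "smooth_on (loc_prolong_dom \<Phi> U c V) (\<lambda>w. jcoord d (prolong1 M \<Phi> (inv_into (jdom U) (jcoord c) w)))"
proof -
  show im: "jcoord c ` (J1 M \<inter> jdom U \<inter> prolong1 M \<Phi> -` jdom V) = loc_prolong_dom \<Phi> U c V"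
  proof (intro equalityI subsetI)
    fix w assume w: "w \<in> loc_prolong_dom \<Phi> U c V"
    then have "w \<in> UNIV \<times> c ` U \<times> UNIV" by (auto simp: loc_prolong_dom_def loc_dom_def mem_Times_iff)
    then obtain j where j: "j \<in> jdom U" "w = jcoord c j" unfolding jcoord_image[OF U, symmetric] by blast
    then show "w \<in> jcoord c ` (J1 M \<inter> jdom U \<inter> prolong1 M \<Phi> -` jdom V)"
      using w prolong1_in_jdom[OF \<Phi> U j(1)] jdom_J1 by blast
  qed (use prolong1_in_jdom[OF \<Phi> U] in blast)
  show "smooth_on (loc_prolong_dom \<Phi> U c V) (\<lambda>w. jcoord d (prolong1 M \<Phi> (inv_into (jdom U) (jcoord c) w)))"
  proof (rule smooth_on_cong[OF loc_prolong_smooth(1)[OF assms] _ loc_prolong_smooth(2)[OF assms]])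
    fix w assume "w \<in> loc_prolong_dom \<Phi> U c V"
    then obtain j where "j \<in> jdom U" "prolong1 M \<Phi> j \<in> jdom V" "w = jcoord c j" using im by blast
    then show "loc_prolong \<Phi> U c d w = jcoord d (prolong1 M \<Phi> (inv_into (jdom U) (jcoord c) w))"
      using loc_prolong[OF \<Phi> U V] inj_on_jcoord[OF U] by simp
  qed
qed

text \<open>The transition functions are the local expressions of the prolongation of the identity.\<close>

lemma atlas_J1: "smooth_atlas (J1_atlas M)"
  unfolding smooth_atlas_def
proof (intro conjI ballI; clarify)
  fix D e assume "(D, e) \<in> J1_atlas M"
  then show "inj_on e D" by (rule J1_atlasE) (simp add: inj_on_jcoord)
next
  fix D e D' e' assume "(D, e) \<in> J1_atlas M" "(D', e') \<in> J1_atlas M"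
  then obtain U c V d where U: "(U, c) \<in> M" "D = jdom U" "e = jcoord c"
    and V: "(V, d) \<in> M" "D' = jdom V" "e' = jcoord d"
    by (metis J1_atlasE)
  have "D \<inter> D' = J1 M \<inter> jdom U \<inter> prolong1 M id -` jdom V"
    using U V by (auto simp: prolong1_id dest: jdom_J1)
  then have im: "e ` (D \<inter> D') = loc_prolong_dom id U c V"
    using prolong1_chart(1)[OF Aut_id U(1) V(1)] U(3) by simp
  have "smooth_on (e ` (D \<inter> D')) (e' \<circ> inv_into D e)"
    unfolding im
  proof (rule smooth_on_cong[OF loc_prolong_smooth(1)[OF Aut_id U(1) V(1)] _
        prolong1_chart(2)[OF Aut_id U(1) V(1)]])
    fix w assume "w \<in> loc_prolong_dom id U c V"
    then have "inv_into D e w \<in> D" using im inv_into_into[of w e D] by blast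
    then show "jcoord d (prolong1 M id (inv_into (jdom U) (jcoord c) w)) = (e' \<circ> inv_into D e) w"
      using U V prolong1_id jdom_J1 by simp
  qed
  then show "open (e ` (D \<inter> D')) \<and> smooth_on (e ` (D \<inter> D')) (e' \<circ> inv_into D e)"
    unfolding im using loc_prolong_smooth(1)[OF Aut_id U(1) V(1)] by blast
qed

lemma smooth_map_prolong1:
  assumes \<Phi>: "\<Phi> \<in> Aut M"
  shows "smooth_map (J1_atlas M) (J1_atlas M) (J1 M) (prolong1 M \<Phi>)"
  unfolding smooth_map_def
proof (intro conjI)
  show "openin (manifold_topology (J1_atlas M)) (J1 M)"
    using openin_points[of "J1_atlas M"] by (simp add: points_J1)
  show "prolong1 M \<Phi> ` J1 M \<subseteq> points (J1_atlas M)" using prolong1_in_J1[OF \<Phi>] by (auto simp: points_J1)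
  show "\<forall>(U, c)\<in>J1_atlas M. \<forall>(V, d)\<in>J1_atlas M. open (c ` (J1 M \<inter> U \<inter> prolong1 M \<Phi> -` V)) \<and>
      smooth_on (c ` (J1 M \<inter> U \<inter> prolong1 M \<Phi> -` V)) (d \<circ> prolong1 M \<Phi> \<circ> inv_into U c)"
  proof clarify
    fix D e D' e' assume "(D, e) \<in> J1_atlas M" "(D', e') \<in> J1_atlas M"
    then obtain U c V d where "(U, c) \<in> M" "D = jdom U" "e = jcoord c"
      and "(V, d) \<in> M" "D' = jdom V" "e' = jcoord d"
      by (metis J1_atlasE)
    then show "open (e ` (J1 M \<inter> D \<inter> prolong1 M \<Phi> -` D')) \<and>
        smooth_on (e ` (J1 M \<inter> D \<inter> prolong1 M \<Phi> -` D')) (e' \<circ> prolong1 M \<Phi> \<circ> inv_into D e)"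
      using prolong1_chart[OF \<Phi>] loc_prolong_smooth(1)[OF \<Phi>] by (simp add: comp_def)
  qed
qed

end

section \<open>The form induced on the dual space\<close>

text \<open>The sum is the Riesz vector of \<xi> for the inner product of the model space.\<close>

lemma linear_form_inner:
  fixes \<xi> :: "'e::euclidean_space \<Rightarrow> real"
  assumes "linear \<xi>"
  shows "(\<Sum>b\<in>Basis. \<xi> b *\<^sub>R b) \<bullet> v = \<xi> v"
proof -
  have "\<xi> v = \<xi> (\<Sum>b\<in>Basis. (v \<bullet> b) *\<^sub>R b)" by (simp only: euclidean_representation)
  also have "\<dots> = (\<Sum>b\<in>Basis. (v \<bullet> b) * \<xi> b)"
    by (simp only: linear_sum[OF assms] linear_scale[OF assms] real_scaleR_def)
  finally show ?thesis by (simp add: inner_sum_left inner_commute[of v] mult.commute)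
qed

lemma bilinear_form_inner:
  fixes B :: "'e::euclidean_space \<Rightarrow> 'e \<Rightarrow> real"
  assumes l: "\<And>v. linear (\<lambda>u. B u v)" and r: "\<And>u. linear (B u)"
  obtains R where "linear R" "\<And>u v. R u \<bullet> v = B u v"
proof
  show "linear (\<lambda>u. \<Sum>b\<in>Basis. B u b *\<^sub>R b)"
    using linear_add[OF l] linear_scale[OF l]
    by (intro linearI) (simp_all add: scaleR_add_left sum.distrib scaleR_sum_right)
qed (rule linear_form_inner[OF r])

text \<open>Represent \<open>B\<close> by an endomorphism: non-singularity says that it is
  injective, and in finite dimension it is then onto. This makes the descriptions in
  \<open>sharp\<close> definite.\<close>

lemma nonsingular_representation:
  fixes B :: "'e::euclidean_space \<Rightarrow> 'e \<Rightarrow> real"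
  assumes l: "\<And>v. linear (\<lambda>u. B u v)" and r: "\<And>u. linear (B u)" and ns: "nonsingular B" and \<xi>: "linear \<xi>"
  shows "\<exists>!u. B u = \<xi>"
proof -
  obtain R where R: "linear R" "\<And>u v. R u \<bullet> v = B u v" using bilinear_form_inner[of B, OF l r] by metis
  have "inj R" unfolding linear_injective_0[OF R(1)]
    using ns R(2) unfolding nonsingular_def by (metis inner_zero_left)
  then have "surj R" by (rule linear_inj_imp_surj[OF R(1)])
  then obtain u where u: "R u = (\<Sum>b\<in>Basis. \<xi> b *\<^sub>R b)" by (metis surjD)
  have "B u = \<xi>" using R(2)[of u] linear_form_inner[OF \<xi>] unfolding u by auto
  moreover have "u' = u" if "B u' = \<xi>" for u'
  proof -
    have "R u' \<bullet> v = R u \<bullet> v" for v using R(2) that \<open>B u = \<xi>\<close> by simp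
    then have "R u' = R u" by (metis vector_eq_ldot inner_commute)
    then show ?thesis using \<open>inj R\<close> by (simp add: inj_eq)
  qed
  ultimately show ?thesis by blast
qed

text \<open>The factor \<open>k\<close> multiplies both sides of the equation that defines the dual
  vector, so the solution \<open>u\<close> becomes \<open>A u\<close> without rescaling. Hence
  \<open>k\<close> enters the value of the induced form once, through \<open>B'\<close> at
  \<open>A u\<close>.\<close>

lemma sharp_transform:
  fixes B B' :: "'e::euclidean_space \<Rightarrow> 'e \<Rightarrow> real"
  assumes l: "\<And>v. linear (\<lambda>u. B u v)" and r: "\<And>u. linear (B u)"
    and l': "\<And>v. linear (\<lambda>u. B' u v)" and r': "\<And>u. linear (B' u)"
    and ns: "nonsingular B" and \<xi>: "linear \<xi>" "linear \<xi>'"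
    and A: "surj A" "\<And>u. A u = 0 \<Longrightarrow> u = 0" "A 0 = 0" and k: "k \<noteq> 0"
    and B': "\<And>u v. B' (A u) (A v) = k * B u v" and \<xi>': "\<And>u. \<xi>' (A u) = k * \<xi> u"
  shows "nonsingular B'" "sharp B' \<xi>' \<xi>' = k * sharp B \<xi> \<xi>"
proof -
  show ns': "nonsingular B'"
    unfolding nonsingular_def
  proof (intro allI impI)
    fix w assume w: "\<forall>v. B' w v = 0"
    obtain u where u: "w = A u" using A(1) by (metis surjD)
    have "B u v = 0" for v using w B'[of u v] k unfolding u by simp
    then show "w = 0" using ns A(3) unfolding nonsingular_def u by metis
  qed
  note ex = nonsingular_representation[OF l r ns \<xi>(1)] and ex' = nonsingular_representation[OF l' r' ns' \<xi>(2)]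
  define u where "u = (THE u. B u = \<xi>)"
  have u: "B u = \<xi>" unfolding u_def by (rule theI'[OF ex])
  have "B' (A u) = \<xi>'"
  proof
    fix w
    obtain v where "w = A v" using A(1) by (metis surjD)
    then show "B' (A u) w = \<xi>' w" using B'[of u v] \<xi>'[of v] u by simp
  qed
  then have "(THE u. B' u = \<xi>') = A u" by (rule the1_equality[OF ex'])
  then show "sharp B' \<xi>' \<xi>' = k * sharp B \<xi> \<xi>"
    unfolding sharp_def u_def[symmetric] using B' by simp
qed

context smooth_mfd
begin

section \<open>Sections of \<open>q\<close>\<close>

abbreviation "JA \<equiv> J1_atlas M"
abbreviation "TQ \<equiv> prod_atlas JA line_atlas"
abbreviation "qsection \<equiv> local_section (q_fib M)"
abbreviation "open_J1 \<equiv> openin (manifold_topology JA)"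
abbreviation "smooth_J1 \<equiv> smooth_map JA line_atlas"

lemma q_fib_simps [simp]:
  "total_atlas (q_fib M) = TQ" "base_atlas (q_fib M) = JA" "proj (q_fib M) = fst"
  by (simp_all add: q_fib_def)

lemma open_J1_subset: "open_J1 N \<Longrightarrow> N \<subseteq> J1 M"
  using openin_subset[of "manifold_topology JA" N] by (simp add: topspace_manifold_topology points_J1)

lemma qsectionD:
  assumes "qsection a s"
  obtains N where "a \<in> N" "open_J1 N" "\<And>b. b \<in> N \<Longrightarrow> fst (s b) = b" "smooth_map JA TQ N s"
    "smooth_J1 N (\<lambda>b. snd (s b))"
proof -
  obtain N where N: "a \<in> N" "smooth_map JA TQ N s" "\<And>b. b \<in> N \<Longrightarrow> fst (s b) = b"
    using assms unfolding local_section_def by auto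
  show ?thesis
    by (rule that[OF N(1) smooth_mapD(1)[OF N(2)] N(3) N(2)
          smooth_map_snd_compose[OF atlas_J1 atlas_J1 smooth_atlas_line N(2)]])
qed

lemma qsectionI:
  assumes N: "a \<in> N" and fst: "\<And>b. b \<in> N \<Longrightarrow> fst (s b) = b" and sm: "smooth_J1 N (\<lambda>b. snd (s b))"
  shows "qsection a s"
proof -
  note o = smooth_mapD(1)[OF sm]
  have "smooth_map JA JA N (\<lambda>b. b)"
    using smooth_map_subset[OF atlas_J1 atlas_J1 smooth_map_ident[OF atlas_J1] o] open_J1_subset[OF o]
    by (simp add: points_J1)
  then have "smooth_map JA JA N (\<lambda>b. fst (s b))"
    by (rule smooth_map_cong[OF _ _ atlas_J1 atlas_J1]) (simp add: fst)
  then have "smooth_map JA TQ N (\<lambda>b. (fst (s b), snd (s b)))"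
    using sm by (rule smooth_map_Pair[OF atlas_J1 atlas_J1 smooth_atlas_line])
  then show ?thesis unfolding local_section_def using N fst by auto
qed

lemma TQ_chartE:
  assumes "(W, f) \<in> TQ"
  obtains D e where "(D, e) \<in> JA" "W = D \<times> UNIV" "f = map_prod e id"
  using assms by (elim prod_atlasE) (simp add: line_atlas_def)

lemma TQ_chart: "(D, e) \<in> JA \<Longrightarrow> (D \<times> UNIV, map_prod e id) \<in> TQ"
  by (rule prod_atlasI[OF _ line_chart])

text \<open>Charts of the total space of q leave the real fibre coordinate alone. The last component
  of the jet coordinates therefore consists of the derivatives of the function itself, whichever
  chart \<open>(W, f)\<close> is used.\<close>

lemma snd_section_coord:
  assumes s: "qsection a s" and D: "(D, e) \<in> JA" "a \<in> D" and W: "(W, f) \<in> TQ" "s a \<in> W"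
    and vs: "length vs \<le> 2"
  shows "snd (snd (section_coord 2 (D, e) (W, f) a s) vs) = nderiv vs (\<lambda>z. snd (s (inv_into D e z))) (e a)"
proof -
  obtain N where N: "a \<in> N" "smooth_map JA TQ N s" using qsectionD[OF s] by metis
  have "snd (f p) = snd p" for p using W(1) by (rule TQ_chartE) simp
  moreover have "nderiv vs (\<lambda>z. snd (f (s (inv_into D e z)))) (e a) =
      snd (nderiv vs (\<lambda>z. f (s (inv_into D e z))) (e a))"
    by (rule nderiv_linear_compose[OF bounded_linear_snd smooth_mapD(3,4)[OF N(2) D(1) W(1)]])
      (use N(1) D(2) W(2) in blast)
  ultimately show ?thesis using vs by (simp add: section_coord_def comp_def)
qed

lemma same_qjetD:
  assumes st: "same_jet (q_fib M) 2 a s t" and s: "qsection a s" and t: "qsection a t"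
    and D: "(D, e) \<in> JA" "a \<in> D" and vs: "length vs \<le> 2"
  shows "nderiv vs (\<lambda>z. snd (s (inv_into D e z))) (e a) = nderiv vs (\<lambda>z. snd (t (inv_into D e z))) (e a)"
proof -
  note T = TQ_chart[OF D(1)]
  have fst: "fst (s a) = a" "fst (t a) = a" using s t by (metis qsectionD)+
  then have sD: "s a \<in> D \<times> UNIV" "t a \<in> D \<times> UNIV" using D(2) by (simp_all add: mem_Times_iff)
  have "section_coord 2 (D, e) (D \<times> UNIV, map_prod e id) a s =
      section_coord 2 (D, e) (D \<times> UNIV, map_prod e id) a t"
    using st D T sD unfolding same_jet_def q_fib_simps by (metis fst_conv)
  then show ?thesis
    using snd_section_coord[OF s D T sD(1) vs] snd_section_coord[OF t D T sD(2) vs] by simp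
qed

text \<open>Value, vertical differential and Hessian use derivatives of order at most two, which a
  2-jet fixes. Thus a known section of the class may replace the chosen representative in
  \<open>V_fun\<close>, \<open>O2\<close> and \<open>I_fun\<close>.\<close>

lemma qjet_fun:
  assumes s: "qsection a s"
  shows "jet_fun (jet (q_fib M) 2 a s) a = snd (s a)"
    "\<kappa> \<in> JA \<Longrightarrow> a \<in> fst \<kappa> \<Longrightarrow> d10 \<kappa> (jet_fun (jet (q_fib M) 2 a s)) a = d10 \<kappa> (\<lambda>b. snd (s b)) a"
    "\<kappa> \<in> JA \<Longrightarrow> a \<in> fst \<kappa> \<Longrightarrow> hess \<kappa> (jet_fun (jet (q_fib M) 2 a s)) a = hess \<kappa> (\<lambda>b. snd (s b)) a"
proof -
  let ?t = "jet_rep (jet (q_fib M) 2 a s)"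
  note t = jet_rep_jet[OF s, of 2]
  show "jet_fun (jet (q_fib M) 2 a s) a = snd (s a)"
    using t(2) by (simp add: jet_fun_def same_jet_def)
  assume \<kappa>: "\<kappa> \<in> JA" "a \<in> fst \<kappa>"
  obtain D e where D: "\<kappa> = (D, e)" "(D, e) \<in> JA" "a \<in> D" using \<kappa> by (cases \<kappa>) auto
  note eq = same_qjetD[OF t(2) s t(1) D(2,3), symmetric]
  show "d10 \<kappa> (jet_fun (jet (q_fib M) 2 a s)) a = d10 \<kappa> (\<lambda>b. snd (s b)) a"
    using eq[of "[_]"] unfolding d10_def jet_fun_def D(1) comp_def by auto
  show "hess \<kappa> (jet_fun (jet (q_fib M) 2 a s)) a = hess \<kappa> (\<lambda>b. snd (s b)) a"
    using eq[of "[_, _]"] unfolding hess_def jet_fun_def D(1) comp_def by auto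
qed

lemma d10_hess_linear:
  assumes L: "smooth_J1 N L" and a: "a \<in> N" and \<kappa>: "\<kappa> \<in> JA" "a \<in> fst \<kappa>"
  shows "linear (d10 \<kappa> L a)" "linear (hess \<kappa> L a u)" "linear (\<lambda>u. hess \<kappa> L a u v)"
proof -
  obtain D e where D: "\<kappa> = (D, e)" "(D, e) \<in> JA" "a \<in> D" using \<kappa> by (cases \<kappa>) auto
  note sm = smooth_map_to_lineD[OF L D(2)]
  have ea: "e a \<in> e ` (N \<inter> D)" using a D(3) by blast
  have vert: "linear (vert :: 'e \<Rightarrow> _)" by (rule linearI) (simp_all add: vert_def)
  show "linear (d10 \<kappa> L a)"
    using linear_compose[OF vert nderiv_Cons_linear[OF sm(2) ea, of "[]"]]
    by (simp only: d10_def D(1) comp_def split)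
  show "linear (hess \<kappa> L a u)"
    using linear_compose[OF vert nderiv_pair_linear[OF sm ea, of "vert u"]]
    by (simp only: hess_def D(1) comp_def split)
  show "linear (\<lambda>u. hess \<kappa> L a u v)"
    using linear_compose[OF vert nderiv_Cons_linear[OF sm(2) ea, of "[vert v]"]]
    by (simp only: hess_def D(1) comp_def split)
qed

section \<open>Transformation of the vertical differential and of the Hessian\<close>

text \<open>On fibres of \<open>J\<^sup>1(\<real>, M) \<rightarrow> \<real> \<times> M\<close> the prolongation is affine, with the linear part below.\<close>

definition fibre_map :: "(real \<times> 'm \<Rightarrow> real \<times> 'm) \<Rightarrow> 'm set \<Rightarrow> ('m \<Rightarrow> 'e) \<Rightarrow> ('m \<Rightarrow> 'e)
    \<Rightarrow> real \<times> 'e \<Rightarrow> 'e \<Rightarrow> 'e" where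
  "fibre_map \<Phi> U c d p u =
     frechet_derivative (inv_into UNIV (base_map \<Phi>)) (at (base_map \<Phi> (fst p))) 1 *\<^sub>R
       frechet_derivative (loc_fun \<Phi> U c d) (at p) (0, u)"

text \<open>The velocity enters only through the vector (1, y'), and (1, y' + u) = (1, y') + (0, u);
  linearity of the derivative of F then gives an exact affine dependence.\<close>

lemma loc_prolong_vert:
  assumes \<Phi>: "\<Phi> \<in> Aut M" and U: "(U, c) \<in> M" and V: "(V, d) \<in> M"
    and w: "w \<in> loc_prolong_dom \<Phi> U c V"
  shows "loc_prolong \<Phi> U c d (w + vert u) =
      loc_prolong \<Phi> U c d w + vert (fibre_map \<Phi> U c d (fst w, fst (snd w)) u)"
    "linear (fibre_map \<Phi> U c d (fst w, fst (snd w)))"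
proof -
  have "(fst w, fst (snd w)) \<in> loc_dom \<Phi> U c V" using w by (simp add: loc_prolong_dom_def)
  then interpret D: linear "frechet_derivative (loc_fun \<Phi> U c d) (at (fst w, fst (snd w)))"
    by (intro linear_frechet_derivative smooth_on_differentiable[OF loc_fun_smooth(2)[OF \<Phi> U V]])
  show "loc_prolong \<Phi> U c d (w + vert u) =
      loc_prolong \<Phi> U c d w + vert (fibre_map \<Phi> U c d (fst w, fst (snd w)) u)"
    using D.add[of "(1, snd (snd w))" "(0, u)"]
    by (simp add: loc_prolong_def vert_def fibre_map_def scaleR_add_right)
  show "linear (fibre_map \<Phi> U c d (fst w, fst (snd w)))"
  proof (rule linearI)
    fix u v r
    show "fibre_map \<Phi> U c d (fst w, fst (snd w)) (u + v) =
        fibre_map \<Phi> U c d (fst w, fst (snd w)) u + fibre_map \<Phi> U c d (fst w, fst (snd w)) v"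
      using D.add[of "(0, u)" "(0, v)"] by (simp add: fibre_map_def scaleR_add_right)
    show "fibre_map \<Phi> U c d (fst w, fst (snd w)) (r *\<^sub>R u) = r *\<^sub>R fibre_map \<Phi> U c d (fst w, fst (snd w)) u"
      using D.scale[of r "(0, u)"] by (simp add: fibre_map_def)
  qed
qed

lemma loc_prolong_chart_inverse:
  assumes \<Phi>: "\<Phi> \<in> Aut M" and U: "(U, c) \<in> M" and V: "(V, d) \<in> M"
    and w: "w \<in> loc_prolong_dom \<Phi> U c V"
  obtains b where "b \<in> jdom U" "prolong1 M \<Phi> b \<in> jdom V" "w = jcoord c b"
    "loc_prolong \<Phi> U c d w = jcoord d (prolong1 M \<Phi> b)"
proof -
  obtain b where b: "w = jcoord c b" "b \<in> jdom U" "prolong1 M \<Phi> b \<in> jdom V"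
    using w unfolding prolong1_chart(1)[OF \<Phi> U V, symmetric] by auto
  show thesis
    by (rule that[OF b(2,3,1)]) (simp add: b(1) loc_prolong[OF \<Phi> U V b(2,3)])
qed

text \<open>A kernel vector would translate \<open>w\<close> vertically to a second point with the
  same image, against injectivity of the prolongation, which has an inverse on jets. Surjectivity
  follows by equality of dimensions.\<close>

lemma fibre_map_bij:
  assumes \<Phi>: "\<Phi> \<in> Aut M" and U: "(U, c) \<in> M" and V: "(V, d) \<in> M"
    and w: "w \<in> loc_prolong_dom \<Phi> U c V"
  shows "surj (fibre_map \<Phi> U c d (fst w, fst (snd w)))"
    "fibre_map \<Phi> U c d (fst w, fst (snd w)) u = 0 \<Longrightarrow> u = 0"
proof -
  have inj: "w' = w" if w': "w' \<in> loc_prolong_dom \<Phi> U c V" "loc_prolong \<Phi> U c d w' = loc_prolong \<Phi> U c d w" for w'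
  proof -
    obtain b where b: "b \<in> jdom U" "prolong1 M \<Phi> b \<in> jdom V" "w = jcoord c b"
      "loc_prolong \<Phi> U c d w = jcoord d (prolong1 M \<Phi> b)"
      by (rule loc_prolong_chart_inverse[OF \<Phi> U V w])
    obtain b' where b': "b' \<in> jdom U" "prolong1 M \<Phi> b' \<in> jdom V" "w' = jcoord c b'"
      "loc_prolong \<Phi> U c d w' = jcoord d (prolong1 M \<Phi> b')"
      by (rule loc_prolong_chart_inverse[OF \<Phi> U V w'(1)])
    have "prolong1 M \<Phi> b = prolong1 M \<Phi> b'"
      using inj_on_jcoord[OF V] w'(2) b b' by (auto dest: inj_onD)
    then have "b = b'"
      using prolong1_inv[OF \<Phi> jdom_J1[OF b(1)]] prolong1_inv[OF \<Phi> jdom_J1[OF b'(1)]] by metis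
    then show ?thesis by (simp only: b(3) b'(3))
  qed
  have z: "u = 0" if "fibre_map \<Phi> U c d (fst w, fst (snd w)) u = 0" for u
  proof -
    have "w + vert u \<in> loc_prolong_dom \<Phi> U c V" using w by (simp add: loc_prolong_dom_def vert_def)
    moreover have "loc_prolong \<Phi> U c d (w + vert u) = loc_prolong \<Phi> U c d w"
      using loc_prolong_vert(1)[OF assms, of u] that by (simp add: vert_def zero_prod_def[symmetric])
    ultimately have "w + vert u = w" by (rule inj)
    then show "u = 0" by (simp add: vert_def zero_prod_def)
  qed
  then show "fibre_map \<Phi> U c d (fst w, fst (snd w)) u = 0 \<Longrightarrow> u = 0" .
  note lin = loc_prolong_vert(2)[OF assms]
  have "inj (fibre_map \<Phi> U c d (fst w, fst (snd w)))"
    unfolding linear_injective_0[OF lin] using z by blast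
  then show "surj (fibre_map \<Phi> U c d (fst w, fst (snd w)))"
    by (rule linear_inj_imp_surj[OF lin])
qed

text \<open>The relation between \<open>L1\<close> and \<open>L2\<close> is differentiated along
  vertical lines, once for \<open>d10\<close> and twice for \<open>hess\<close>. Since
  \<open>k\<close> depends on x alone, it is constant along these lines and passes through both
  derivatives.\<close>

lemma form_transform:
  fixes k :: "real \<Rightarrow> real"
  assumes \<Phi>: "\<Phi> \<in> Aut M" and U: "(U, c) \<in> M" "a \<in> jdom U" and V: "(V, d) \<in> M" "prolong1 M \<Phi> a \<in> jdom V"
    and L1: "smooth_J1 N1 L1" "a \<in> N1" and L2: "smooth_J1 N2 L2" "prolong1 M \<Phi> a \<in> N2"
    and k: "\<And>b. b \<in> N1 \<Longrightarrow> prolong1 M \<Phi> b \<in> N2 \<Longrightarrow> L2 (prolong1 M \<Phi> b) = k (fst b) * L1 b"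
  shows "d10 (jdom V, jcoord d) L2 (prolong1 M \<Phi> a) (fibre_map \<Phi> U c d (fst a, c (snd (jet_target a))) u) =
      k (fst a) * d10 (jdom U, jcoord c) L1 a u"
    "hess (jdom V, jcoord d) L2 (prolong1 M \<Phi> a) (fibre_map \<Phi> U c d (fst a, c (snd (jet_target a))) u)
        (fibre_map \<Phi> U c d (fst a, c (snd (jet_target a))) v) =
      k (fst a) * hess (jdom U, jcoord c) L1 a u v"
proof -
  define p where "p = (fst a, c (snd (jet_target a)))"
  let ?T = "loc_prolong \<Phi> U c d" and ?A = "fibre_map \<Phi> U c d p"
  define f1 where "f1 z = L1 (inv_into (jdom U) (jcoord c) z)" for z
  define f2 where "f2 z = L2 (inv_into (jdom V) (jcoord d) z)" for z
  define R1 where "R1 = jcoord c ` (N1 \<inter> jdom U)"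
  define R2 where "R2 = jcoord d ` (N2 \<inter> jdom V)"
  note sm1 = smooth_map_to_lineD[OF L1(1) J1_chart[OF U(1)], folded R1_def f1_def]
  note sm2 = smooth_map_to_lineD[OF L2(1) J1_chart[OF V(1)], folded R2_def f2_def]
  note T = loc_prolong_smooth[OF \<Phi> U(1) V(1)]
  \<comment> \<open>The coordinates where both local expressions are smooth and \<open>?T\<close>
    represents the prolongation; there the relation between \<open>L1\<close> and \<open>L2\<close>
    becomes one between \<open>f1\<close> and \<open>f2\<close>.\<close>
  define Q where "Q = R1 \<inter> (loc_prolong_dom \<Phi> U c V \<inter> ?T -` R2)"
  have Q: "open Q" unfolding Q_def
    by (intro open_Int sm1(1) continuous_open_preimage[OF smooth_on_continuous_on[OF T(2)] T(1) sm2(1)])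
  have f: "f2 (?T z) = k (fst z) * f1 z" if z: "z \<in> Q" for z
  proof -
    have "z \<in> R1" "z \<in> loc_prolong_dom \<Phi> U c V" "?T z \<in> R2" using z by (auto simp: Q_def)
    obtain b where b: "b \<in> jdom U" "prolong1 M \<Phi> b \<in> jdom V" "z = jcoord c b" "?T z = jcoord d (prolong1 M \<Phi> b)"
      by (rule loc_prolong_chart_inverse[OF \<Phi> U(1) V(1) \<open>z \<in> loc_prolong_dom \<Phi> U c V\<close>])
    have "b \<in> N1" using \<open>z \<in> R1\<close> b inj_on_jcoord[OF U(1)] by (auto simp: R1_def dest: inj_onD)
    moreover have "prolong1 M \<Phi> b \<in> N2"
      using \<open>?T z \<in> R2\<close> b inj_on_jcoord[OF V(1)] by (auto simp: R2_def dest: inj_onD)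
    moreover have "fst z = fst b" using b(3) by (simp add: jcoord_def)
    ultimately show ?thesis
      using k b inj_on_jcoord[OF U(1)] inj_on_jcoord[OF V(1)] by (simp add: f1_def f2_def)
  qed
  \<comment> \<open>One more vertical derivative on both sides. The induction hypothesis is required
    at all points of \<open>Q\<close> in the fibre over \<open>p\<close>, since it is differentiated
    along a line in that fibre.\<close>
  have step: "nderiv (vert (?A u) # vs2) f2 (?T z) = k (fst a) * nderiv (vert u # vs1) f1 z"
    if IH: "\<And>z. z \<in> Q \<Longrightarrow> (fst z, fst (snd z)) = p \<Longrightarrow> nderiv vs2 f2 (?T z) = k (fst a) * nderiv vs1 f1 z"
      and z: "z \<in> Q" "(fst z, fst (snd z)) = p" for u vs1 vs2 z
  proof -
    have zd: "z \<in> loc_prolong_dom \<Phi> U c V" "z \<in> R1" "?T z \<in> R2" using z by (auto simp: Q_def)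
    have "((\<lambda>t. nderiv vs1 f1 (z + t *\<^sub>R vert u)) has_vector_derivative nderiv (vert u # vs1) f1 z) (at 0)"
      by (rule nderiv_Cons_line[OF sm1(2) zd(2)])
    then have "((\<lambda>t. k (fst a) * nderiv vs1 f1 (z + t *\<^sub>R vert u)) has_vector_derivative
        k (fst a) * nderiv (vert u # vs1) f1 z) (at 0)"
      by (rule has_vector_derivative_mult_right)
    \<comment> \<open>The same function of t is differentiated a second time, now read in the target
      chart: by affineness \<open>?T\<close> sends the line through \<open>z\<close> in direction
      \<open>u\<close> to the line through \<open>?T z\<close> in direction \<open>?A u\<close>.
      Uniqueness of the derivative compares the two results.\<close>
    moreover have "((\<lambda>t. k (fst a) * nderiv vs1 f1 (z + t *\<^sub>R vert u)) has_vector_derivative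
        nderiv (vert (?A u) # vs2) f2 (?T z)) (at 0)"
    proof (rule has_vector_derivative_transform_within_open)
      show "((\<lambda>t. nderiv vs2 f2 (?T z + t *\<^sub>R vert (?A u))) has_vector_derivative
          nderiv (vert (?A u) # vs2) f2 (?T z)) (at 0)"
        by (rule nderiv_Cons_line[OF sm2(2) zd(3)])
      show "open (UNIV \<inter> (\<lambda>t. z + t *\<^sub>R vert u) -` Q)"
        by (intro continuous_open_preimage[OF _ open_UNIV Q] continuous_intros)
      show "0 \<in> UNIV \<inter> (\<lambda>t. z + t *\<^sub>R vert u) -` Q" using z by simp
      fix t assume t: "t \<in> UNIV \<inter> (\<lambda>t. z + t *\<^sub>R vert u) -` Q"
      have zt: "z + t *\<^sub>R vert u = z + vert (t *\<^sub>R u)" by (simp add: vert_def)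
      have "?T (z + t *\<^sub>R vert u) = ?T z + t *\<^sub>R vert (?A u)"
        using loc_prolong_vert[OF \<Phi> U(1) V(1) zd(1)] z(2)
        by (simp add: zt linear_scale) (simp add: vert_def)
      moreover have "nderiv vs2 f2 (?T (z + t *\<^sub>R vert u)) = k (fst a) * nderiv vs1 f1 (z + t *\<^sub>R vert u)"
        using t z(2) by (intro IH) (simp_all add: vert_def)
      ultimately show "nderiv vs2 f2 (?T z + t *\<^sub>R vert (?A u)) = k (fst a) * nderiv vs1 f1 (z + t *\<^sub>R vert u)"
        by simp
    qed
    ultimately show ?thesis by (metis vector_derivative_unique_at)
  qed
  have fst_p: "fst p = fst a" by (simp add: p_def)
  have 0: "nderiv [] f2 (?T z) = k (fst a) * nderiv [] f1 z" if "z \<in> Q" "(fst z, fst (snd z)) = p" for z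
    using f[OF that(1)] that(2) fst_p by auto
  have 1: "nderiv [vert (?A v)] f2 (?T z) = k (fst a) * nderiv [vert v] f1 z"
    if "z \<in> Q" "(fst z, fst (snd z)) = p" for z v
    by (rule step[OF _ that]) (rule 0)
  have 2: "nderiv [vert (?A u), vert (?A v)] f2 (?T z) = k (fst a) * nderiv [vert u, vert v] f1 z"
    if "z \<in> Q" "(fst z, fst (snd z)) = p" for z u v
    by (rule step[OF _ that]) (rule 1)
  have Ta: "?T (jcoord c a) = jcoord d (prolong1 M \<Phi> a)"
    using loc_prolong[OF \<Phi> U(1) V(1) U(2) V(2)] by simp
  have a: "jcoord c a \<in> Q" "(fst (jcoord c a), fst (snd (jcoord c a))) = p"
  proof -
    have "jcoord c a \<in> R1" "jcoord d (prolong1 M \<Phi> a) \<in> R2"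
      using U(2) V(2) L1(2) L2(2) unfolding R1_def R2_def by blast+
    then show "jcoord c a \<in> Q" using prolong1_in_jdom[OF \<Phi> U] V(2) by (simp add: Q_def Ta)
  qed (simp add: jcoord_def p_def)
  show "d10 (jdom V, jcoord d) L2 (prolong1 M \<Phi> a) (fibre_map \<Phi> U c d (fst a, c (snd (jet_target a))) u) =
      k (fst a) * d10 (jdom U, jcoord c) L1 a u"
    using 1[OF a] unfolding Ta p_def[symmetric] d10_def split comp_def f1_def[abs_def] f2_def[abs_def] by simp
  show "hess (jdom V, jcoord d) L2 (prolong1 M \<Phi> a) (fibre_map \<Phi> U c d (fst a, c (snd (jet_target a))) u)
        (fibre_map \<Phi> U c d (fst a, c (snd (jet_target a))) v) =
      k (fst a) * hess (jdom U, jcoord c) L1 a u v"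
    using 2[OF a] unfolding Ta p_def[symmetric] hess_def split comp_def f1_def[abs_def] f2_def[abs_def] by simp
qed

text \<open>The factor is left general so as to cover two cases: 1/\<phi>' for the action of an
  automorphism, and 1 for a change of chart.\<close>

lemma sharp_hess_transform:
  fixes k :: "real \<Rightarrow> real"
  assumes \<Phi>: "\<Phi> \<in> Aut M" and \<kappa>: "\<kappa> \<in> JA" "a \<in> fst \<kappa>" and \<mu>: "\<mu> \<in> JA" "prolong1 M \<Phi> a \<in> fst \<mu>"
    and L1: "smooth_J1 N1 L1" "a \<in> N1" and L2: "smooth_J1 N2 L2" "prolong1 M \<Phi> a \<in> N2"
    and k: "\<And>b. b \<in> N1 \<Longrightarrow> prolong1 M \<Phi> b \<in> N2 \<Longrightarrow> L2 (prolong1 M \<Phi> b) = k (fst b) * L1 b"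
    and k0: "k (fst a) \<noteq> 0" and ns: "nonsingular (hess \<kappa> L1 a)"
  shows "nonsingular (hess \<mu> L2 (prolong1 M \<Phi> a))"
    "sharp (hess \<mu> L2 (prolong1 M \<Phi> a)) (d10 \<mu> L2 (prolong1 M \<Phi> a)) (d10 \<mu> L2 (prolong1 M \<Phi> a)) =
      k (fst a) * sharp (hess \<kappa> L1 a) (d10 \<kappa> L1 a) (d10 \<kappa> L1 a)"
proof -
  obtain U c where U: "(U, c) \<in> M" "a \<in> jdom U" "\<kappa> = (jdom U, jcoord c)"
    using \<kappa> by (cases \<kappa>) (auto elim!: J1_atlasE)
  obtain V d where V: "(V, d) \<in> M" "prolong1 M \<Phi> a \<in> jdom V" "\<mu> = (jdom V, jcoord d)"
    using \<mu> by (cases \<mu>) (auto elim!: J1_atlasE)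
  have w: "jcoord c a \<in> loc_prolong_dom \<Phi> U c V" using prolong1_in_jdom[OF \<Phi> U(1,2)] V(2) by blast
  have p: "(fst (jcoord c a), fst (snd (jcoord c a))) = (fst a, c (snd (jet_target a)))"
    by (simp add: jcoord_def)
  note A = fibre_map_bij[OF \<Phi> U(1) V(1) w, unfolded p] loc_prolong_vert(2)[OF \<Phi> U(1) V(1) w, unfolded p]
  note B = d10_hess_linear[OF L1 \<kappa>] and B' = d10_hess_linear[OF L2 \<mu>]
  note F = form_transform[OF \<Phi> U(1,2) V(1,2) L1 L2 k, folded U(3) V(3)]
  note S = sharp_transform[OF B(3,2) B'(3,2) ns B(1) B'(1) A(1,2) linear_0[OF A(3)] k0 F(2,1)]
  show "nonsingular (hess \<mu> L2 (prolong1 M \<Phi> a))" by (rule S(1))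
  show "sharp (hess \<mu> L2 (prolong1 M \<Phi> a)) (d10 \<mu> L2 (prolong1 M \<Phi> a)) (d10 \<mu> L2 (prolong1 M \<Phi> a)) =
      k (fst a) * sharp (hess \<kappa> L1 a) (d10 \<kappa> L1 a) (d10 \<kappa> L1 a)" by (rule S(2))
qed

section \<open>Well-definedness and transformation of \<open>V\<close>\<close>

lemma qjetsD:
  assumes "j \<in> jets (q_fib M) 2"
  obtains N where "fst j \<in> N" "open_J1 N" "\<And>b. b \<in> N \<Longrightarrow> fst (jet_rep j b) = b"
    "smooth_J1 N (jet_fun j)"
  using qsectionD[OF jets_rep(1)[OF assms]] unfolding jet_fun_def comp_def by metis

lemma qjets_J1:
  assumes "j \<in> jets (q_fib M) 2"
  shows "fst j \<in> J1 M"
proof -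
  obtain N where "fst j \<in> N" "open_J1 N" by (rule qjetsD[OF assms])
  then show ?thesis using open_J1_subset by blast
qed

lemma J1_chart_at:
  assumes "a \<in> J1 M"
  obtains \<kappa> where "\<kappa> \<in> JA" "a \<in> fst \<kappa>"
proof -
  have "a \<in> points JA" using assms by (simp add: points_J1)
  then obtain D e where "(D, e) \<in> JA" "a \<in> D" by (rule obtain_chart)
  then show thesis using that[of "(D, e)"] by simp
qed

lemma chart_independent:
  assumes j: "j \<in> jets (q_fib M) 2" and \<kappa>: "\<kappa> \<in> JA" "fst j \<in> fst \<kappa>" and \<mu>: "\<mu> \<in> JA" "fst j \<in> fst \<mu>"
    and ns: "nonsingular (hess \<kappa> (jet_fun j) (fst j))"
  shows "nonsingular (hess \<mu> (jet_fun j) (fst j))"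
    "sharp (hess \<mu> (jet_fun j) (fst j)) (d10 \<mu> (jet_fun j) (fst j)) (d10 \<mu> (jet_fun j) (fst j)) =
      sharp (hess \<kappa> (jet_fun j) (fst j)) (d10 \<kappa> (jet_fun j) (fst j)) (d10 \<kappa> (jet_fun j) (fst j))"
proof -
  obtain N where N: "fst j \<in> N" "open_J1 N" "smooth_J1 N (jet_fun j)" by (rule qjetsD[OF j])
  have id: "prolong1 M id b = b" if "b \<in> N" for b
    using that open_J1_subset[OF N(2)] prolong1_id by blast
  note S = sharp_hess_transform[OF Aut_id \<kappa> _ _ N(3,1) N(3), of \<mu> "\<lambda>_. 1"]
  show "nonsingular (hess \<mu> (jet_fun j) (fst j))"
    using S(1) \<mu> ns id N(1) by simp
  show "sharp (hess \<mu> (jet_fun j) (fst j)) (d10 \<mu> (jet_fun j) (fst j)) (d10 \<mu> (jet_fun j) (fst j)) =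
      sharp (hess \<kappa> (jet_fun j) (fst j)) (d10 \<kappa> (jet_fun j) (fst j)) (d10 \<kappa> (jet_fun j) (fst j))"
    using S(2) \<mu> ns id N(1) by simp
qed

lemma O2_iff:
  assumes \<kappa>: "\<kappa> \<in> JA" "fst j \<in> fst \<kappa>"
  shows "j \<in> O2 M \<longleftrightarrow> j \<in> jets (q_fib M) 2 \<and> nonsingular (hess \<kappa> (jet_fun j) (fst j))"
  unfolding O2_def using chart_independent(1)[OF _ \<kappa>] \<kappa> by blast

text \<open>Independence of the chart gives existence of the common value, and the chart \<kappa>
  around the base point gives its uniqueness.\<close>

lemma V_fun_eq:
  assumes j: "j \<in> O2 M" and \<kappa>: "\<kappa> \<in> JA" "fst j \<in> fst \<kappa>"
  shows "V_fun M j = sharp (hess \<kappa> (jet_fun j) (fst j)) (d10 \<kappa> (jet_fun j) (fst j)) (d10 \<kappa> (jet_fun j) (fst j))"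
proof -
  have j': "j \<in> jets (q_fib M) 2" "nonsingular (hess \<kappa> (jet_fun j) (fst j))"
    using j O2_iff[OF \<kappa>] by auto
  show ?thesis
    unfolding V_fun_def
  proof (rule the_equality, intro ballI impI)
    fix \<mu> assume "\<mu> \<in> JA" "fst j \<in> fst \<mu>"
    then show "sharp (hess \<kappa> (jet_fun j) (fst j)) (d10 \<kappa> (jet_fun j) (fst j)) (d10 \<kappa> (jet_fun j) (fst j)) =
        sharp (hess \<mu> (jet_fun j) (fst j)) (d10 \<mu> (jet_fun j) (fst j)) (d10 \<mu> (jet_fun j) (fst j))"
      by (rule chart_independent(2)[OF j'(1) \<kappa> _ _ j'(2), symmetric])
  qed (use \<kappa> in blast)
qed

lemma deriv_base_map_inv:
  assumes \<Phi>: "\<Phi> \<in> Aut M"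
  shows "deriv (inv_into UNIV (base_map \<Phi>)) (base_map \<Phi> x) = inverse (deriv (base_map \<Phi>) x)"
    "deriv (base_map \<Phi>) x \<noteq> 0"
proof -
  let ?\<phi> = "base_map \<Phi>" and ?\<psi> = "inv_into UNIV (base_map \<Phi>)"
  have d: "(f has_real_derivative deriv f t) (at t)" if "smooth_on UNIV f" for f :: "real \<Rightarrow> real" and t
    using smooth_on_differentiable[OF that, of t] by (simp add: DERIV_deriv_iff_real_differentiable)
  have "((\<lambda>t. ?\<psi> (?\<phi> t)) has_real_derivative deriv ?\<psi> (?\<phi> x) * deriv ?\<phi> x) (at x)"
    by (rule DERIV_chain2[OF d[OF AutD(8)[OF \<Phi>]] d[OF AutD(7)[OF \<Phi>]]])
  then have "deriv ?\<psi> (?\<phi> x) * deriv ?\<phi> x = 1"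
    using DERIV_unique[OF _ DERIV_ident] by (simp add: AutD(10)[OF \<Phi>])
  then show "deriv ?\<psi> (?\<phi> x) = inverse (deriv ?\<phi> x)" "deriv ?\<phi> x \<noteq> 0"
    by (auto simp: inverse_eq_divide eq_divide_eq)
qed

lemma dx_factor_eq:
  assumes "\<Phi> \<in> Aut M"
  shows "dx_factor \<Phi> x = deriv (base_map \<Phi>) x"
proof -
  have diff: "base_map \<Phi> differentiable (at x)"
    using smooth_on_differentiable[OF AutD(7)[OF assms]] by simp
  then have "frechet_derivative (base_map \<Phi>) (at x) h = deriv (base_map \<Phi>) x * h" for h
    unfolding deriv_eq_frechet_derivative[OF diff] frechet_derivative_eq_vector_derivative[OF diff] by simp
  then show ?thesis unfolding dx_factor_def
    by (intro the_equality) (simp_all, metis mult.right_neutral)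
qed

lemma smooth_J1_fst:
  assumes g: "smooth_on UNIV g" and N: "open_J1 N"
  shows "smooth_J1 N (\<lambda>b. g (fst b))"
proof (rule smooth_map_to_lineI[OF atlas_J1 N])
  fix b assume b: "b \<in> N"
  obtain U c where U: "(U, c) \<in> M" "snd (jet_target b) \<in> U" by (rule chart_at)
  have o: "open (jcoord c ` (N \<inter> jdom U))" by (rule openin_manifoldD[OF atlas_J1 N J1_chart[OF U(1)]])
  have "smooth_on (jcoord c ` (N \<inter> jdom U)) (\<lambda>z. g (fst z))"
    by (rule smooth_on_compose[OF o open_UNIV subset_UNIV smooth_on_fst[OF o smooth_on_ident] g])
  then have "smooth_on (jcoord c ` (N \<inter> jdom U)) (\<lambda>z. g (fst (inv_into (jdom U) (jcoord c) z)))"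
  proof (rule smooth_on_cong[OF o, rotated])
    fix z assume "z \<in> jcoord c ` (N \<inter> jdom U)"
    then obtain b where "b \<in> jdom U" "z = jcoord c b" by blast
    then show "g (fst z) = g (fst (inv_into (jdom U) (jcoord c) z))"
      using inj_on_jcoord[OF U(1)] by simp (simp add: jcoord_def)
  qed
  moreover have "b \<in> jdom U" using b open_J1_subset[OF N] U(2) by (auto simp: jdom_def)
  ultimately show "\<exists>U c. (U, c) \<in> JA \<and> b \<in> U \<and> smooth_on (c ` (N \<inter> U)) (\<lambda>z. g (fst (inv_into U c z)))"
    using J1_chart[OF U(1)] by blast
qed

text \<open>Exhibits the section behind \<open>action\<close> as smooth near the image point,
  together with the relation between the two functions near both base points in the form that the
  transformation of forms takes as input.\<close>

lemma action_section:
  assumes \<Phi>: "\<Phi> \<in> Aut M" and j: "j \<in> jets (q_fib M) 2"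
  obtains N1 N2 s where "fst j \<in> N1" "smooth_J1 N1 (jet_fun j)"
    "prolong1 M \<Phi> (fst j) \<in> N2" "smooth_J1 N2 (\<lambda>b. snd (s b))"
    "qsection (prolong1 M \<Phi> (fst j)) s" "action M \<Phi> j = jet (q_fib M) 2 (prolong1 M \<Phi> (fst j)) s"
    "\<forall>b\<in>N1. prolong1 M \<Phi> b \<in> N2 \<longrightarrow>
      snd (s (prolong1 M \<Phi> b)) = inverse (deriv (base_map \<Phi>) (fst b)) * jet_fun j b"
proof -
  let ?\<Phi>' = "inv_into UNIV \<Phi>" and ?\<psi> = "inv_into UNIV (base_map \<Phi>)"
  note \<Phi>' = Aut_inv[OF \<Phi>]
  obtain N where N: "fst j \<in> N" "open_J1 N" "\<And>b. b \<in> N \<Longrightarrow> fst (jet_rep j b) = b" "smooth_J1 N (jet_fun j)"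
    by (rule qjetsD[OF j]) (rule that; blast)
  note NJ = open_J1_subset[OF N(2)]
  define s where "s = lift_q M \<Phi> \<circ> jet_rep j \<circ> inv_into (J1 M) (prolong1 M \<Phi>)"
  \<comment> \<open>The image of \<open>N\<close> under the prolongation, written as a preimage
    under the inverse prolongation so that continuity makes it open.\<close>
  define N2 where "N2 = J1 M \<inter> prolong1 M ?\<Phi>' -` N"
  have N2: "open_J1 N2" unfolding N2_def
    by (rule openin_vimage_smooth_map[OF atlas_J1 atlas_J1 smooth_map_prolong1[OF \<Phi>'] N(2)])
  \<comment> \<open>Expressed at the image point \<open>b\<close>, the multiplier 1/\<phi>' becomes
    the derivative of the inverse base map at \<open>fst b\<close>, visibly a smooth function of
    \<open>b\<close>.\<close>
  have sb: "s b = (b, frechet_derivative ?\<psi> (at (fst b)) 1 * jet_fun j (prolong1 M ?\<Phi>' b))" if b: "b \<in> N2" for b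
  proof -
    let ?b = "prolong1 M ?\<Phi>' b"
    have b': "b \<in> J1 M" "?b \<in> N" using b by (auto simp: N2_def)
    have "?b \<in> J1 M" using b'(2) NJ by blast
    have "s b = lift_q M \<Phi> (jet_rep j ?b)" by (simp add: s_def inv_into_prolong1[OF \<Phi> b'(1)])
    also have "jet_rep j ?b = (?b, jet_fun j ?b)" using N(3)[OF b'(2)] by (simp add: jet_fun_def prod_eq_iff)
    also have "lift_q M \<Phi> \<dots> = (b, inverse (deriv (base_map \<Phi>) (fst ?b)) * jet_fun j ?b)"
      by (simp add: lift_q_def prolong1_inv'[OF \<Phi> b'(1)] dx_factor_eq[OF \<Phi>])
    also have "inverse (deriv (base_map \<Phi>) (fst ?b)) = deriv ?\<psi> (fst b)"
      unfolding deriv_base_map_inv(1)[OF \<Phi>, symmetric]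
      by (simp add: base_map_inv[OF \<Phi>] AutD(9)[OF \<Phi>])
    also have "\<dots> = frechet_derivative ?\<psi> (at (fst b)) 1"
      using smooth_on_differentiable[OF AutD(8)[OF \<Phi>]] by (simp add: deriv_eq_frechet_derivative)
    finally show ?thesis .
  qed
  have "smooth_J1 N2 (\<lambda>b. frechet_derivative ?\<psi> (at (fst b)) 1)"
    by (rule smooth_J1_fst[OF smooth_on_derivative[OF AutD(8)[OF \<Phi>]] N2])
  moreover have "smooth_J1 N2 (\<lambda>b. jet_fun j (prolong1 M ?\<Phi>' b))"
    unfolding N2_def
    by (rule smooth_map_compose[OF atlas_J1 atlas_J1 smooth_atlas_line smooth_map_prolong1[OF \<Phi>'] N(4)])
  ultimately have "smooth_J1 N2 (\<lambda>b. frechet_derivative ?\<psi> (at (fst b)) 1 * jet_fun j (prolong1 M ?\<Phi>' b))"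
    by (rule smooth_map_mult[OF atlas_J1])
  then have sm: "smooth_J1 N2 (\<lambda>b. snd (s b))"
    by (rule smooth_map_cong[OF _ _ atlas_J1 smooth_atlas_line]) (simp add: sb)
  have a: "prolong1 M \<Phi> (fst j) \<in> N2"
    using N(1) prolong1_in_J1[OF \<Phi> qjets_J1[OF j]] prolong1_inv[OF \<Phi> qjets_J1[OF j]]
    by (simp add: N2_def)
  have q: "qsection (prolong1 M \<Phi> (fst j)) s"
    by (rule qsectionI[OF a _ sm]) (simp add: sb)
  show ?thesis
  proof (rule that[OF N(1) N(4) a sm q], safe)
    show "action M \<Phi> j = jet (q_fib M) 2 (prolong1 M \<Phi> (fst j)) s"
      by (simp add: action_def prolong_def s_def points_J1)
    fix b assume b: "b \<in> N" "prolong1 M \<Phi> b \<in> N2"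
    have "frechet_derivative ?\<psi> (at (base_map \<Phi> (fst b))) 1 = inverse (deriv (base_map \<Phi>) (fst b))"
      unfolding deriv_base_map_inv(1)[OF \<Phi>, symmetric]
      using smooth_on_differentiable[OF AutD(8)[OF \<Phi>]] by (simp add: deriv_eq_frechet_derivative)
    then show "snd (s (prolong1 M \<Phi> b)) = inverse (deriv (base_map \<Phi>) (fst b)) * jet_fun j b"
      using sb[OF b(2)] prolong1_inv[OF \<Phi>, of b] b(1) NJ by auto
  qed
qed

lemma fst_action: "fst (action M \<Phi> j) = prolong1 M \<Phi> (fst j)"
  by (simp add: action_def prolong_def)

lemma action_jets:
  assumes "\<Phi> \<in> Aut M" "j \<in> jets (q_fib M) 2"
  shows "action M \<Phi> j \<in> jets (q_fib M) 2"
proof -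
  obtain s where "qsection (prolong1 M \<Phi> (fst j)) s" and "action M \<Phi> j = jet (q_fib M) 2 (prolong1 M \<Phi> (fst j)) s"
    by (rule action_section[OF assms])
  then show ?thesis by (simp add: jet_in_jets)
qed

lemma jet_fun_action:
  assumes \<Phi>: "\<Phi> \<in> Aut M" and j: "j \<in> jets (q_fib M) 2"
  shows "jet_fun (action M \<Phi> j) (fst (action M \<Phi> j)) =
    inverse (deriv (base_map \<Phi>) (fst (fst j))) * jet_fun j (fst j)"
proof -
  obtain N1 N2 s where "fst j \<in> N1" "prolong1 M \<Phi> (fst j) \<in> N2"
    and "qsection (prolong1 M \<Phi> (fst j)) s" "action M \<Phi> j = jet (q_fib M) 2 (prolong1 M \<Phi> (fst j)) s"
    "\<forall>b\<in>N1. prolong1 M \<Phi> b \<in> N2 \<longrightarrow>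
      snd (s (prolong1 M \<Phi> b)) = inverse (deriv (base_map \<Phi>) (fst b)) * jet_fun j b"
    by (rule action_section[OF assms])
  then show ?thesis using qjet_fun(1) by simp
qed

lemma V_fun_action:
  assumes \<Phi>: "\<Phi> \<in> Aut M" and j: "j \<in> O2 M"
  shows "action M \<Phi> j \<in> O2 M"
    "V_fun M (action M \<Phi> j) = inverse (deriv (base_map \<Phi>) (fst (fst j))) * V_fun M j"
proof -
  have jj: "j \<in> jets (q_fib M) 2" using j by (simp add: O2_def)
  let ?b = "prolong1 M \<Phi> (fst j)"
  obtain N1 N2 s where L1: "smooth_J1 N1 (jet_fun j)" "fst j \<in> N1"
    and L2: "smooth_J1 N2 (\<lambda>b. snd (s b))" "?b \<in> N2"
    and s: "qsection ?b s" "action M \<Phi> j = jet (q_fib M) 2 ?b s"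
    and k: "\<forall>b\<in>N1. prolong1 M \<Phi> b \<in> N2 \<longrightarrow>
      snd (s (prolong1 M \<Phi> b)) = inverse (deriv (base_map \<Phi>) (fst b)) * jet_fun j b"
    by (rule action_section[OF \<Phi> jj])
  have b: "?b \<in> J1 M" by (rule prolong1_in_J1[OF \<Phi> qjets_J1[OF jj]])
  obtain \<kappa> where \<kappa>: "\<kappa> \<in> JA" "fst j \<in> fst \<kappa>" by (rule J1_chart_at[OF qjets_J1[OF jj]])
  obtain \<mu> where \<mu>: "\<mu> \<in> JA" "?b \<in> fst \<mu>" by (rule J1_chart_at[OF b])
  have ns: "nonsingular (hess \<kappa> (jet_fun j) (fst j))" using j O2_iff[OF \<kappa>] by blast
  have k0: "inverse (deriv (base_map \<Phi>) (fst (fst j))) \<noteq> 0"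
    using deriv_base_map_inv(2)[OF \<Phi>] by simp
  note S = sharp_hess_transform[OF \<Phi> \<kappa> \<mu> L1 L2 k[rule_format] k0 ns]
  note J = qjet_fun(2,3)[OF s(1) \<mu>, folded s(2)]
  have \<mu>': "fst (action M \<Phi> j) \<in> fst \<mu>" using \<mu>(2) by (simp add: fst_action)
  show O2: "action M \<Phi> j \<in> O2 M"
    unfolding O2_iff[OF \<mu>(1) \<mu>'] using S(1) action_jets[OF \<Phi> jj] by (simp add: fst_action J)
  show "V_fun M (action M \<Phi> j) = inverse (deriv (base_map \<Phi>) (fst (fst j))) * V_fun M j"
    unfolding V_fun_eq[OF O2 \<mu>(1) \<mu>'] V_fun_eq[OF j \<kappa>] using S(2) by (simp add: fst_action J)
qed

lemma I_fun_action:
  assumes \<Phi>: "\<Phi> \<in> Aut M" and j: "j \<in> O2' M"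
  shows "action M \<Phi> j \<in> O2' M" "I_fun M (action M \<Phi> j) = I_fun M j"
proof -
  have j': "j \<in> O2 M" "jet_fun j (fst j) \<noteq> 0" "j \<in> jets (q_fib M) 2"
    using j by (simp_all add: O2'_def O2_def)
  note V = V_fun_action[OF \<Phi> j'(1)] and L = jet_fun_action[OF \<Phi> j'(3)]
  note nz = deriv_base_map_inv(2)[OF \<Phi>, of "fst (fst j)"]
  show "action M \<Phi> j \<in> O2' M" using V(1) j'(2) nz by (simp add: O2'_def L)
  show "I_fun M (action M \<Phi> j) = I_fun M j" using nz by (simp add: I_fun_def V(2) L)
qed

end

section \<open>Non-singular forms: openness and density\<close>

text \<open>For a bilinear form this is the endomorphism representing it through the inner product.
  Only the entries on the basis are used, so it is linear in \<open>u\<close> even for values of jet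
  coordinates that come from no bilinear form.\<close>

definition matrix_map :: "('e::euclidean_space \<Rightarrow> 'e \<Rightarrow> real) \<Rightarrow> 'e \<Rightarrow> 'e" where
  "matrix_map m u = (\<Sum>b\<in>Basis. (u \<bullet> b) *\<^sub>R (\<Sum>b'\<in>Basis. m b b' *\<^sub>R b'))"

lemma linear_matrix_map: "linear (matrix_map m)"
proof (rule linearI)
  show "matrix_map m (u + v) = matrix_map m u + matrix_map m v" for u v
    by (simp add: matrix_map_def inner_add_left scaleR_add_left sum.distrib)
  show "matrix_map m (r *\<^sub>R u) = r *\<^sub>R matrix_map m u" for r u
    by (simp add: matrix_map_def scaleR_sum_right mult.assoc)
qed

lemma nonsingular_iff_matrix_map:
  fixes B :: "'e::euclidean_space \<Rightarrow> 'e \<Rightarrow> real"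
  assumes l: "\<And>v. linear (\<lambda>u. B u v)" and r: "\<And>u. linear (B u)"
  shows "nonsingular B \<longleftrightarrow> (\<forall>u. matrix_map B u = 0 \<longrightarrow> u = 0)"
proof -
  have "matrix_map B u \<bullet> v = B u v" for u v
  proof -
    have "(\<Sum>b'\<in>Basis. B b b' * (b' \<bullet> v)) = B b v" for b
      using linear_form_inner[OF r, of b v] by (simp add: inner_sum_left)
    then have "matrix_map B u \<bullet> v = (\<Sum>b\<in>Basis. (u \<bullet> b) * B b v)"
      by (simp add: matrix_map_def inner_sum_left)
    also have "\<dots> = (\<Sum>b\<in>Basis. B b v *\<^sub>R b) \<bullet> u"
      by (simp add: inner_sum_left inner_commute[of u] mult.commute)
    finally show ?thesis using linear_form_inner[OF l] by simp
  qed
  then have "matrix_map B u = 0 \<longleftrightarrow> (\<forall>v. B u v = 0)" for u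
    by (metis inner_eq_zero_iff inner_zero_left)
  then show ?thesis unfolding nonsingular_def by simp
qed

text \<open>An injective linear map satisfies
  \<open>B * norm u \<le> norm (matrix_map (m p) u)\<close> for some positive \<open>B\<close>, and
  nearby entries change the image by at most half of that bound, so the kernel stays
  trivial.\<close>

lemma open_matrix_map_inj:
  fixes m :: "'t::topological_space \<Rightarrow> 'e::euclidean_space \<Rightarrow> 'e \<Rightarrow> real"
  assumes cont: "\<And>b b'. continuous_on UNIV (\<lambda>p. m p b b')"
  shows "open {p. \<forall>u. matrix_map (m p) u = 0 \<longrightarrow> u = 0}"
proof (subst open_subopen, clarify)
  fix p assume p: "\<forall>u. matrix_map (m p) u = 0 \<longrightarrow> u = 0"
  then have "inj (matrix_map (m p))" unfolding linear_injective_0[OF linear_matrix_map] .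
  then obtain B where B: "B > 0" "\<And>u. B * norm u \<le> norm (matrix_map (m p) u)"
    using linear_inj_bounded_below_pos[OF linear_matrix_map] by blast
  define n where "n = real DIM('e)"
  have n: "n > 0" by (simp add: n_def)
  \<comment> \<open>The difference of the two maps is a double sum of \<open>n * n\<close> terms,
    each at most \<open>norm u * \<eta>\<close>; this \<eta> makes the total
    \<open>B / 2 * norm u\<close>.\<close>
  define \<eta> where "\<eta> = B / (2 * n * n)"
  define W where "W = (\<Inter>b\<in>Basis. \<Inter>b'\<in>Basis. (\<lambda>q. m q b b') -` ball (m p b b') \<eta>)"
  have "open W" unfolding W_def using cont by (intro open_INT finite_Basis ballI open_vimage open_ball)
  moreover have "p \<in> W" using B(1) n by (simp add: W_def \<eta>_def)
  moreover have "u = 0" if q: "q \<in> W" and u: "matrix_map (m q) u = 0" for q u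
  proof (rule ccontr)
    assume "u \<noteq> 0"
    have le: "norm ((u \<bullet> b) *\<^sub>R ((m p b b' - m q b b') *\<^sub>R b')) \<le> norm u * \<eta>" if b: "b \<in> Basis" "b' \<in> Basis" for b b'
    proof -
      have "\<bar>m p b b' - m q b b'\<bar> \<le> \<eta>" using q b by (fastforce simp: W_def dist_real_def)
      then show ?thesis using Basis_le_norm[OF b(1), of u] b(2) by (simp add: abs_mult mult_mono)
    qed
    have "matrix_map (m p) u - matrix_map (m q) u =
        (\<Sum>b\<in>Basis. \<Sum>b'\<in>Basis. (u \<bullet> b) *\<^sub>R ((m p b b' - m q b b') *\<^sub>R b'))"
      by (simp add: matrix_map_def sum_subtractf[symmetric] scaleR_diff_right[symmetric]
          scaleR_diff_left[symmetric] scaleR_sum_right[symmetric] del: scaleR_scaleR)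
    also have "norm \<dots> \<le> (\<Sum>b\<in>(Basis::'e set). \<Sum>b'\<in>(Basis::'e set). norm u * \<eta>)"
      by (intro sum_norm_le le)
    also have "\<dots> = n * n * \<eta> * norm u" by (simp add: n_def)
    also have "n * n * \<eta> = B / 2" using n by (simp add: \<eta>_def)
    finally have "B * norm u \<le> B / 2 * norm u" using B(2)[of u] u by simp
    then show False using B(1) \<open>u \<noteq> 0\<close> by simp
  qed
  ultimately show "\<exists>T. open T \<and> p \<in> T \<and> T \<subseteq> {p. \<forall>u. matrix_map (m p) u = 0 \<longrightarrow> u = 0}"
    by blast
qed

text \<open>Apply \<open>R\<close> to the relation and subtract \<open>q\<close> times the relation:
  the term with \<open>v q\<close> cancels, and the others keep the coefficients
  \<open>a r * (r - q)\<close>, where \<open>r - q\<close> is nonzero.\<close>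

lemma eigenvectors_sum_zero:
  fixes R :: "'e::real_vector \<Rightarrow> 'e"
  assumes R: "linear R" and "finite S"
    and "\<And>r. r \<in> S \<Longrightarrow> v r \<noteq> 0 \<and> R (v r) = r *\<^sub>R v r" and "(\<Sum>r\<in>S. a r *\<^sub>R v r) = 0" and "r \<in> S"
  shows "a r = 0"
  using assms(2-)
proof (induction S arbitrary: a r rule: finite_induct)
  case (insert q S)
  have z: "a q *\<^sub>R v q + (\<Sum>r\<in>S. a r *\<^sub>R v r) = 0" using insert.prems(2) insert.hyps by simp
  have ev: "R (v r) = r *\<^sub>R v r" if "r \<in> insert q S" for r using insert.prems(1)[OF that] by simp
  have "R (\<Sum>r\<in>S. a r *\<^sub>R v r) = (\<Sum>r\<in>S. (a r * r) *\<^sub>R v r)"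
    unfolding linear_sum[OF R] linear_scale[OF R] by (rule sum.cong) (simp_all add: ev)
  moreover have "R (a q *\<^sub>R v q + (\<Sum>r\<in>S. a r *\<^sub>R v r)) = 0" unfolding z by (rule linear_0[OF R])
  ultimately have "(a q * q) *\<^sub>R v q + (\<Sum>r\<in>S. (a r * r) *\<^sub>R v r) = 0"
    by (simp add: linear_add[OF R] linear_scale[OF R] ev)
  moreover have "(a q * q) *\<^sub>R v q + (\<Sum>r\<in>S. (a r * q) *\<^sub>R v r) = 0"
  proof -
    have "(a q * q) *\<^sub>R v q + (\<Sum>r\<in>S. (a r * q) *\<^sub>R v r) = q *\<^sub>R (a q *\<^sub>R v q + (\<Sum>r\<in>S. a r *\<^sub>R v r))"
      by (simp add: scaleR_add_right scaleR_sum_right mult.commute)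
    then show ?thesis by (simp add: z)
  qed
  ultimately have "(a q * q) *\<^sub>R v q + (\<Sum>r\<in>S. (a r * r) *\<^sub>R v r) =
      (a q * q) *\<^sub>R v q + (\<Sum>r\<in>S. (a r * q) *\<^sub>R v r)"
    by (simp only:)
  then have "(\<Sum>r\<in>S. (a r * r) *\<^sub>R v r) = (\<Sum>r\<in>S. (a r * q) *\<^sub>R v r)"
    by (simp only: add_left_cancel)
  then have "(\<Sum>r\<in>S. (a r * (r - q)) *\<^sub>R v r) = 0"
    by (simp add: right_diff_distrib scaleR_diff_left sum_subtractf)
  then have "a r * (r - q) = 0" if "r \<in> S" for r
    using insert.IH[of "\<lambda>r. a r * (r - q)" r] insert.prems(1) that by simp
  then have aS: "a r = 0" if "r \<in> S" for r using that insert.hyps(2) by fastforce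
  then have "a q *\<^sub>R v q = 0" using z by simp
  then have "a q = 0" using insert.prems(1)[of q] by simp
  then show ?case using aS insert.prems(3) by blast
qed simp

text \<open>One eigenvalue more than the dimension would yield that many independent
  eigenvectors.\<close>

lemma finite_eigenvalues:
  fixes R :: "'e::euclidean_space \<Rightarrow> 'e"
  assumes R: "linear R"
  shows "finite {r. \<exists>u. u \<noteq> 0 \<and> R u = r *\<^sub>R u}" (is "finite ?E")
proof (rule ccontr)
  assume "infinite ?E"
  then obtain S where S: "S \<subseteq> ?E" "finite S" "card S = Suc DIM('e)"
    using infinite_arbitrarily_large[of ?E "Suc DIM('e)"] by blast
  then have "\<forall>r\<in>S. \<exists>u. u \<noteq> 0 \<and> R u = r *\<^sub>R u" by blast
  from bchoice[OF this] obtain v where v: "\<And>r. r \<in> S \<Longrightarrow> v r \<noteq> 0 \<and> R (v r) = r *\<^sub>R v r"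
    by blast
  have inj: "inj_on v S"
  proof (rule inj_onI)
    fix r q assume "r \<in> S" "q \<in> S" "v r = v q"
    then have "r *\<^sub>R v r = q *\<^sub>R v r" "v r \<noteq> 0" using v by metis+
    then show "r = q" by simp
  qed
  have "independent (v ` S)"
  proof (rule independent_if_scalars_zero)
    show "finite (v ` S)" using S(2) by simp
    fix f x assume f: "(\<Sum>x\<in>v ` S. f x *\<^sub>R x) = 0" and "x \<in> v ` S"
    then obtain r where r: "r \<in> S" "x = v r" by blast
    have "(\<Sum>r\<in>S. f (v r) *\<^sub>R v r) = 0" using f by (simp add: sum.reindex[OF inj])
    from eigenvectors_sum_zero[OF R S(2) v this r(1)] show "f x = 0" using r(2) by simp
  qed
  then have "card (v ` S) \<le> DIM('e)" using independent_bound by blast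
  then show False using S(3) card_image[OF inj] by simp
qed

text \<open>If \<open>R\<close> represents \<open>B\<close>, a nonzero vector in the kernel of the
  perturbed form is an eigenvector of \<open>R\<close> for - \<epsilon>.\<close>

lemma finite_singular_perturbations:
  fixes B :: "'e::euclidean_space \<Rightarrow> 'e \<Rightarrow> real"
  assumes l: "\<And>v. linear (\<lambda>u. B u v)" and r: "\<And>u. linear (B u)"
  shows "finite {\<epsilon>. \<not> nonsingular (\<lambda>u v. B u v + \<epsilon> * (u \<bullet> v))}"
proof -
  obtain R where R: "linear R" "\<And>u v. R u \<bullet> v = B u v" using bilinear_form_inner[of B, OF l r] by metis
  have "{\<epsilon>. \<not> nonsingular (\<lambda>u v. B u v + \<epsilon> * (u \<bullet> v))} \<subseteq> uminus ` {r. \<exists>u. u \<noteq> 0 \<and> R u = r *\<^sub>R u}"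
  proof
    fix \<epsilon> assume "\<epsilon> \<in> {\<epsilon>. \<not> nonsingular (\<lambda>u v. B u v + \<epsilon> * (u \<bullet> v))}"
    then obtain u where u: "u \<noteq> 0" "\<And>v. B u v + \<epsilon> * (u \<bullet> v) = 0" unfolding nonsingular_def by blast
    have "(R u + \<epsilon> *\<^sub>R u) \<bullet> v = 0" for v using u(2)[of v] by (simp add: inner_add_left R(2))
    then have "R u + \<epsilon> *\<^sub>R u = 0" by (metis inner_eq_zero_iff)
    then have "R u = (- \<epsilon>) *\<^sub>R u" by (simp add: eq_neg_iff_add_eq_0)
    then show "\<epsilon> \<in> uminus ` {r. \<exists>u. u \<noteq> 0 \<and> R u = r *\<^sub>R u}"
      using u(1) by (intro image_eqI[of _ _ "- \<epsilon>"]) auto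
  qed
  then show ?thesis using finite_eigenvalues[OF R(1)] by (meson finite_imageI finite_subset)
qed

text \<open>The factor 1/2 makes the vertical Hessian equal to the inner product. The constant 1
  keeps the function positive, so that adding a multiple of it also changes the value of the
  Lagrangian at every point.\<close>

definition quad :: "real \<times> 'e \<times> 'e::euclidean_space \<Rightarrow> real" where
  "quad z = 1 + (snd (snd z) \<bullet> snd (snd z)) / 2"

lemma quad_pos: "quad z > 0"
  by (simp add: quad_def add_pos_nonneg)

lemma smooth_on_quad: "open S \<Longrightarrow> smooth_on S (quad :: real \<times> 'e \<times> 'e::euclidean_space \<Rightarrow> real)"
proof -
  assume S: "open S"
  have s: "smooth_on S (\<lambda>z::real \<times> 'e \<times> 'e. snd (snd z))"
    by (rule smooth_on_snd[OF S smooth_on_snd[OF S smooth_on_ident]])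
  have "smooth_on S (\<lambda>z::real \<times> 'e \<times> 'e. 1 + (1/2) *\<^sub>R (snd (snd z) \<bullet> snd (snd z)))"
    by (rule smooth_on_add[OF S smooth_on_const smooth_on_scaleR[OF S smooth_on_const smooth_on_inner[OF S s s]]])
  then show ?thesis by (simp add: quad_def[abs_def])
qed

lemma nderiv_quad: "nderiv [vert u, vert v] quad z = u \<bullet> v"
proof -
  have "(quad has_derivative (\<lambda>h. snd (snd z) \<bullet> snd (snd h))) (at z)" for z :: "real \<times> 'a \<times> 'a"
    unfolding quad_def by (auto intro!: derivative_eq_intros simp: inner_commute)
  from frechet_derivative_at[OF this]
  have 1: "nderiv [vert v] quad = (\<lambda>z. snd (snd z) \<bullet> v)"
    by (simp add: fun_eq_iff vert_def)
  have "((\<lambda>z::real \<times> 'a \<times> 'a. snd (snd z) \<bullet> v) has_derivative (\<lambda>h. snd (snd h) \<bullet> v)) (at z)"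
    by (auto intro!: derivative_eq_intros)
  then have "frechet_derivative (\<lambda>z::real \<times> 'a \<times> 'a. snd (snd z) \<bullet> v) (at z) = (\<lambda>h. snd (snd h) \<bullet> v)"
    by (rule frechet_derivative_at[symmetric])
  then show ?thesis unfolding nderiv.simps(2)[of "vert u" "[vert v]"] 1 by (simp add: vert_def)
qed

context smooth_mfd
begin

section \<open>The topology of \<open>J\<^sup>2(q)\<close>\<close>

abbreviation "J2q \<equiv> jets (q_fib M) 2"
abbreviation "J2q_topology \<equiv> jet_topology (q_fib M) 2"

lemma openin_J2q:
  "openin J2q_topology W \<longleftrightarrow> W \<subseteq> J2q \<and> (\<forall>\<kappa>\<in>JA. \<forall>\<mu>\<in>TQ. \<exists>S. open S \<and>
     (\<forall>j\<in>J2q. fst j \<in> fst \<kappa> \<longrightarrow> jet_target j \<in> fst \<mu> \<longrightarrow>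
       (j \<in> W \<longleftrightarrow> section_coord 2 \<kappa> \<mu> (fst j) (jet_rep j) \<in> S)))"
proof -
  have eq: "W \<inter> {j \<in> J2q. fst j \<in> fst \<kappa> \<and> jet_target j \<in> fst \<mu>} =
        {j \<in> J2q. fst j \<in> fst \<kappa> \<and> jet_target j \<in> fst \<mu>} \<inter> f -` S \<longleftrightarrow>
      (\<forall>j\<in>J2q. fst j \<in> fst \<kappa> \<longrightarrow> jet_target j \<in> fst \<mu> \<longrightarrow> (j \<in> W \<longleftrightarrow> f j \<in> S))" for \<kappa> \<mu> f S
    by blast
  have charts: "(\<forall>(D, c)\<in>{(A \<kappa> \<mu>, f \<kappa> \<mu>) |\<kappa> \<mu>. \<kappa> \<in> JA \<and> \<mu> \<in> TQ}. R D c) \<longleftrightarrow>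
      (\<forall>\<kappa>\<in>JA. \<forall>\<mu>\<in>TQ. R (A \<kappa> \<mu>) (f \<kappa> \<mu>))" for A f R
    by blast
  show ?thesis
    unfolding jet_topology_def openin_chart_topology q_fib_simps charts eq ..
qed

lemma topspace_J2q: "topspace J2q_topology = J2q"
  unfolding jet_topology_def by (rule topspace_chart_topology) blast

lemma snd_qjet_coord:
  assumes j: "j \<in> J2q" "fst j \<in> fst \<kappa>" "jet_target j \<in> fst \<mu>" and "\<kappa> \<in> JA" "\<mu> \<in> TQ" "length vs \<le> 2"
  shows "snd (snd (section_coord 2 \<kappa> \<mu> (fst j) (jet_rep j)) vs) =
    nderiv vs (jet_fun j \<circ> inv_into (fst \<kappa>) (snd \<kappa>)) (snd \<kappa> (fst j))"
  using snd_section_coord[of "fst j" "jet_rep j" "fst \<kappa>" "snd \<kappa>" "fst \<mu>" "snd \<mu>" vs] assms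
    jets_rep(1)[OF j(1)] by (simp add: jet_fun_def comp_def jet_target_def)

lemma qjet_hess_linear:
  assumes "j \<in> J2q" "\<kappa> \<in> JA" "fst j \<in> fst \<kappa>"
  shows "linear (hess \<kappa> (jet_fun j) (fst j) u)" "linear (\<lambda>u. hess \<kappa> (jet_fun j) (fst j) u v)"
proof -
  obtain N where "fst j \<in> N" "smooth_J1 N (jet_fun j)" by (rule qjetsD[OF assms(1)])
  then show "linear (hess \<kappa> (jet_fun j) (fst j) u)" "linear (\<lambda>u. hess \<kappa> (jet_fun j) (fst j) u v)"
    using d10_hess_linear[of N "jet_fun j" "fst j"] assms(2,3) by blast+
qed

text \<open>Openness of a set of jets is tested by open sets of the full codomain of the jet
  coordinates, so the condition is imposed on all its elements, including those that are coordinates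
  of no jet.\<close>

definition regular_coords :: "((real \<times> 'e \<times> 'e) \<times> ((real \<times> 'e \<times> 'e) list \<Rightarrow> (real \<times> 'e \<times> 'e) \<times> real)) set" where
  "regular_coords = {p. \<forall>u. matrix_map (\<lambda>b b'. snd (snd p [vert b, vert b'])) u = 0 \<longrightarrow> u = 0}"

lemma continuous_on_coord: "continuous_on UNIV
    (\<lambda>p::(real \<times> 'e \<times> 'e) \<times> ((real \<times> 'e \<times> 'e) list \<Rightarrow> (real \<times> 'e \<times> 'e) \<times> real). snd (snd p vs))"
proof -
  have "continuous_on UNIV (\<lambda>p. snd p vs) "
    if "p \<in> UNIV" for p :: "(real \<times> 'e \<times> 'e) \<times> ((real \<times> 'e \<times> 'e) list \<Rightarrow> (real \<times> 'e \<times> 'e) \<times> real)"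
    by (rule continuous_on_product_then_coordinatewise[OF continuous_on_snd[OF continuous_on_id]])
  then show ?thesis by (intro continuous_on_snd) auto
qed

lemma open_regular_coords: "open regular_coords"
  unfolding regular_coords_def by (rule open_matrix_map_inj) (rule continuous_on_coord)

lemma O2_coords:
  assumes j: "j \<in> J2q" "fst j \<in> fst \<kappa>" "jet_target j \<in> fst \<mu>" and \<kappa>: "\<kappa> \<in> JA" and \<mu>: "\<mu> \<in> TQ"
  shows "j \<in> O2 M \<longleftrightarrow> section_coord 2 \<kappa> \<mu> (fst j) (jet_rep j) \<in> regular_coords"
proof -
  have "snd (snd (section_coord 2 \<kappa> \<mu> (fst j) (jet_rep j)) [vert u, vert v]) = hess \<kappa> (jet_fun j) (fst j) u v" for u v
    using snd_qjet_coord[OF j \<kappa> \<mu>, of "[vert u, vert v]"] by (simp add: hess_def case_prod_unfold)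
  then show ?thesis
    using O2_iff[OF \<kappa> j(2)] j(1) nonsingular_iff_matrix_map[OF qjet_hess_linear(2,1)[OF j(1) \<kappa> j(2)]]
    by (simp add: regular_coords_def)
qed

lemma openin_O2: "openin J2q_topology (O2 M)"
  unfolding openin_J2q
proof (intro conjI ballI)
  show "O2 M \<subseteq> J2q" by (auto simp: O2_def)
  fix \<kappa> \<mu> assume "\<kappa> \<in> JA" "\<mu> \<in> TQ"
  then show "\<exists>S. open S \<and> (\<forall>j\<in>J2q. fst j \<in> fst \<kappa> \<longrightarrow> jet_target j \<in> fst \<mu> \<longrightarrow>
      (j \<in> O2 M \<longleftrightarrow> section_coord 2 \<kappa> \<mu> (fst j) (jet_rep j) \<in> S))"
    using O2_coords open_regular_coords by (intro exI[of _ regular_coords]) simp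
qed

lemma openin_O2': "openin J2q_topology (O2' M)"
  unfolding openin_J2q
proof (intro conjI ballI)
  show "O2' M \<subseteq> J2q" by (auto simp: O2'_def O2_def)
  fix \<kappa> \<mu> assume \<kappa>: "\<kappa> \<in> JA" and \<mu>: "\<mu> \<in> TQ"
  \<comment> \<open>The coordinate at the empty list holds the value of the section; its second
    component is the value of the Lagrangian.\<close>
  let ?S = "regular_coords \<inter> ((\<lambda>p. snd (snd p [])) -` (- {0}))"
  have "open ?S"
    by (intro open_Int open_regular_coords open_vimage open_Compl closed_singleton continuous_on_coord)
  moreover have "j \<in> O2' M \<longleftrightarrow> section_coord 2 \<kappa> \<mu> (fst j) (jet_rep j) \<in> ?S"
    if j: "j \<in> J2q" "fst j \<in> fst \<kappa>" "jet_target j \<in> fst \<mu>" for j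
  proof -
    have "inj_on (snd \<kappa>) (fst \<kappa>)" using smooth_atlas_inj[OF atlas_J1, of "fst \<kappa>" "snd \<kappa>"] \<kappa> by simp
    then have "snd (snd (section_coord 2 \<kappa> \<mu> (fst j) (jet_rep j)) []) = jet_fun j (fst j)"
      using snd_qjet_coord[OF j \<kappa> \<mu>, of "[]"] j(2) by simp
    then show ?thesis using O2_coords[OF j \<kappa> \<mu>] by (simp add: O2'_def)
  qed
  ultimately show "\<exists>S. open S \<and> (\<forall>j\<in>J2q. fst j \<in> fst \<kappa> \<longrightarrow> jet_target j \<in> fst \<mu> \<longrightarrow>
      (j \<in> O2' M \<longleftrightarrow> section_coord 2 \<kappa> \<mu> (fst j) (jet_rep j) \<in> S))"
    by blast
qed

lemma section_coord_jet_rep: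
  assumes s: "qsection a s" and D: "(D, e) \<in> JA" "a \<in> D"
  shows "section_coord 2 (D, e) (D \<times> UNIV, map_prod e id) a (jet_rep (jet (q_fib M) 2 a s)) =
    section_coord 2 (D, e) (D \<times> UNIV, map_prod e id) a s"
proof -
  obtain N where "a \<in> N" "\<forall>b\<in>N. fst (s b) = b" using s unfolding local_section_def by auto
  then have "s a \<in> D \<times> UNIV" using D(2) by (simp add: mem_Times_iff)
  then show ?thesis
    using jet_rep_jet(2)[OF s, of 2] D TQ_chart[OF D(1)]
    unfolding same_jet_def q_fib_simps by (metis fst_conv)
qed

text \<open>Adding a small multiple of \<open>1 + y' \<bullet> y' / 2\<close> shifts the Hessian by a multiple of the identity;
  it becomes singular only at the finitely many negatives of eigenvalues.\<close>

lemma dense_O2': "J2q_topology closure_of (O2' M) = J2q"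
proof (intro equalityI subsetI)
  fix j assume "j \<in> J2q_topology closure_of (O2' M)"
  then show "j \<in> J2q" using closure_of_subset_topspace[of J2q_topology] topspace_J2q by auto
next
  fix j assume j: "j \<in> J2q"
  show "j \<in> J2q_topology closure_of (O2' M)"
    unfolding in_closure_of topspace_J2q
  proof (intro conjI j allI impI, elim conjE)
    fix T assume jT: "j \<in> T" and T: "openin J2q_topology T"
    define a where "a = fst j"
    obtain N where N: "a \<in> N" "open_J1 N" "smooth_J1 N (jet_fun j)"
      unfolding a_def by (rule qjetsD[OF j])
    have aJ: "a \<in> J1 M" using N open_J1_subset by blast
    obtain \<kappa> where "\<kappa> \<in> JA" "a \<in> fst \<kappa>" by (rule J1_chart_at[OF aJ])
    then obtain D e where \<kappa>: "\<kappa> = (D, e)" and D: "(D, e) \<in> JA" "a \<in> D" by (cases \<kappa>) auto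
    note inj = smooth_atlas_inj[OF atlas_J1 D(1)]
    define N' where "N' = N \<inter> D"
    have N': "open_J1 N'" "a \<in> N'" "N' \<subseteq> D"
      unfolding N'_def using N D openin_chart_domain[OF atlas_J1 D(1)] by auto
    define s where "s \<epsilon> b = (b, jet_fun j b + \<epsilon> * quad (e b))" for \<epsilon> b
    define f where "f z = jet_fun j (inv_into D e z)" for z
    define Q where "Q = e ` (N \<inter> D)"
    note sf = smooth_map_to_lineD[OF N(3) D(1), folded Q_def f_def]
    have ea: "e a \<in> Q" using N(1) D(2) by (simp add: Q_def)
    have fq: "snd (s \<epsilon> (inv_into D e z)) = f z + \<epsilon> *\<^sub>R quad z" "fst (s \<epsilon> (inv_into D e z)) = inv_into D e z"
      "e (inv_into D e z) = z" if "z \<in> Q" for \<epsilon> z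
      using that inj by (auto simp: s_def f_def Q_def)
    have sq: "smooth_on Q (quad :: real \<times> 'e \<times> 'e \<Rightarrow> real)" by (rule smooth_on_quad[OF sf(1)])
    have s\<epsilon>q: "smooth_on Q (\<lambda>z. \<epsilon> *\<^sub>R quad z)" for \<epsilon>
      by (rule smooth_on_scaleR[OF sf(1) smooth_on_const sq])
    have sfq: "smooth_on Q (\<lambda>z. f z + \<epsilon> *\<^sub>R quad z)" for \<epsilon>
      by (rule smooth_on_add[OF sf s\<epsilon>q])
    have qs: "qsection a (s \<epsilon>)" for \<epsilon>
    proof (rule qsectionI[OF N'(2)])
      show "smooth_J1 N' (\<lambda>b. snd (s \<epsilon> b))"
      proof (rule smooth_map_to_lineI[OF atlas_J1 N'(1)])
        fix b assume "b \<in> N'"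
        have eq: "e ` (N' \<inter> D) = Q" by (simp add: N'_def Q_def Int_assoc)
        have "smooth_on Q (\<lambda>z. snd (s \<epsilon> (inv_into D e z)))"
          by (rule smooth_on_cong[OF sf(1) _ sfq[of \<epsilon>]]) (simp add: fq)
        then show "\<exists>U c. (U, c) \<in> JA \<and> b \<in> U \<and> smooth_on (c ` (N' \<inter> U)) (\<lambda>z. snd (s \<epsilon> (inv_into U c z)))"
          using D(1) N'(3) \<open>b \<in> N'\<close> by (intro exI[of _ D] exI[of _ e]) (auto simp: eq)
      qed
    qed (simp add: s_def)
    define g where "g = (\<lambda>\<epsilon>. jet (q_fib M) 2 a (s \<epsilon>))"
    have gJ: "g \<epsilon> \<in> J2q" and fst_g: "fst (g \<epsilon>) = a" and tg: "jet_target (g \<epsilon>) = s \<epsilon> a" for \<epsilon>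
      using qs by (simp_all add: g_def jet_in_jets jet_target_jet)
    let ?\<mu> = "(D \<times> (UNIV::real set), map_prod e (id :: real \<Rightarrow> real))"
    let ?C = "section_coord 2 (D, e) ?\<mu> a"
    \<comment> \<open>The coordinates of the jet of \<open>s \<epsilon>\<close>. Each entry is
      affine in \<epsilon>, so in the product topology the whole family depends continuously on
      \<epsilon>.\<close>
    define C where "C \<epsilon> = (e a, \<lambda>vs::(real \<times> 'e \<times> 'e) list. if length vs \<le> 2
        then nderiv vs (\<lambda>z. (z, f z)) (e a) + \<epsilon> *\<^sub>R nderiv vs (\<lambda>z. (0 :: real \<times> 'e \<times> 'e, quad z)) (e a) else 0)" for \<epsilon>
    have szf: "smooth_on Q (\<lambda>z. (z, f z))" by (rule smooth_on_Pair[OF sf(1) smooth_on_ident sf(2)])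
    have szq: "smooth_on Q (\<lambda>z. (0 :: real \<times> 'e \<times> 'e, quad z))"
      by (rule smooth_on_Pair[OF sf(1) smooth_on_const sq])
    have szq': "smooth_on Q (\<lambda>z. \<epsilon> *\<^sub>R (0 :: real \<times> 'e \<times> 'e, quad z))" for \<epsilon>
      by (rule smooth_on_scaleR[OF sf(1) smooth_on_const szq])
    have Cs: "?C (s \<epsilon>) = C \<epsilon>" for \<epsilon>
    proof -
      have "nderiv vs (\<lambda>z. map_prod e id (s \<epsilon> (inv_into D e z))) (e a) =
          nderiv vs (\<lambda>z. (z, f z)) (e a) + \<epsilon> *\<^sub>R nderiv vs (\<lambda>z. (0 :: real \<times> 'e \<times> 'e, quad z)) (e a)" for vs
      proof -
        have "nderiv vs (\<lambda>z. (z, f z) + \<epsilon> *\<^sub>R (0 :: real \<times> 'e \<times> 'e, quad z)) (e a) =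
            nderiv vs (\<lambda>z. map_prod e id (s \<epsilon> (inv_into D e z))) (e a)"
        proof (rule nderiv_cong[OF sf(1) _ smooth_on_add[OF sf(1) szf szq'] ea])
          fix z assume "z \<in> Q"
          then show "(z, f z) + \<epsilon> *\<^sub>R (0 :: real \<times> 'e \<times> 'e, quad z) = map_prod e id (s \<epsilon> (inv_into D e z))"
            using fq by (simp add: map_prod_def split_beta)
        qed
        then show ?thesis
          by (simp only: nderiv_add[OF sf(1) szf szq' ea] nderiv_scaleR[OF sf(1) szq ea])
      qed
      then show ?thesis unfolding C_def section_coord_def comp_def by (simp cong: if_cong)
    qed
    \<comment> \<open>At \<epsilon> = 0 the original jet is recovered. Its representative is known
      to return its argument in the first component only near \<open>a\<close>, whence the smaller
      set \<open>Q'\<close>.\<close>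
    have j_rep: "?C (jet_rep j) = C 0"
    proof -
      obtain N1 where N1: "a \<in> N1" "open_J1 N1" "smooth_map JA TQ N1 (jet_rep j)" "\<forall>b\<in>N1. fst (jet_rep j b) = b"
        using jets_rep(1)[OF j] unfolding a_def[symmetric] local_section_def
        by (auto dest: smooth_mapD(1))
      define Q' where "Q' = e ` (N1 \<inter> D) \<inter> Q"
      have Q': "open Q'" "e a \<in> Q'" "Q' \<subseteq> Q"
        unfolding Q'_def using openin_manifoldD[OF atlas_J1 N1(2) D(1)] sf(1) ea N1(1) D(2) by auto
      have "nderiv vs (\<lambda>z. (z, f z)) (e a) = nderiv vs (\<lambda>z. map_prod e id (jet_rep j (inv_into D e z))) (e a)" for vs
      proof (rule nderiv_cong[OF Q'(1) _ smooth_on_subset[OF szf Q'(3)] Q'(2)])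
        fix z assume "z \<in> Q'"
        then obtain b where b: "b \<in> N1" "b \<in> D" "z = e b" unfolding Q'_def by blast
        then have "fst (jet_rep j b) = b" using N1(4) by blast
        then show "(z, f z) = map_prod e id (jet_rep j (inv_into D e z))"
          using b inj by (simp add: f_def jet_fun_def map_prod_def split_beta)
      qed
      then show ?thesis unfolding C_def section_coord_def comp_def by (simp cong: if_cong)
    qed
    \<comment> \<open>For jets over \<open>a\<close>, membership in \<open>T\<close> is decided by
      an open set of coordinates in this one chart. It remains to see that the perturbed coordinates
      stay in it for small \<epsilon>.\<close>
    obtain S where S: "open S" "\<And>i. i \<in> J2q \<Longrightarrow> fst i = a \<Longrightarrow> jet_target i \<in> D \<times> UNIV \<Longrightarrow>
        (i \<in> T \<longleftrightarrow> ?C (jet_rep i) \<in> S)"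
    proof -
      have "\<exists>S. open S \<and> (\<forall>i\<in>J2q. fst i \<in> fst (D, e) \<longrightarrow> jet_target i \<in> fst ?\<mu> \<longrightarrow>
          (i \<in> T \<longleftrightarrow> section_coord 2 (D, e) ?\<mu> (fst i) (jet_rep i) \<in> S))"
        using T D(1) TQ_chart[OF D(1)] unfolding openin_J2q by blast
      then obtain S where "open S" "\<forall>i\<in>J2q. fst i \<in> D \<longrightarrow> jet_target i \<in> D \<times> UNIV \<longrightarrow>
          (i \<in> T \<longleftrightarrow> section_coord 2 (D, e) ?\<mu> (fst i) (jet_rep i) \<in> S)" by auto
      then show thesis using that[of S] D(2) by auto
    qed
    have gT: "g \<epsilon> \<in> T \<longleftrightarrow> C \<epsilon> \<in> S" for \<epsilon>
    proof -
      have "jet_target (g \<epsilon>) \<in> D \<times> UNIV" using D(2) by (simp add: tg) (simp add: s_def)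
      moreover have "?C (jet_rep (g \<epsilon>)) = C \<epsilon>"
        unfolding g_def section_coord_jet_rep[OF qs D] by (rule Cs)
      ultimately show ?thesis using S(2)[OF gJ fst_g] by metis
    qed
    have "jet_target j \<in> D \<times> UNIV"
    proof -
      have "fst (jet_rep j a) = a" using jets_rep(1)[OF j] unfolding a_def[symmetric] local_section_def by auto
      then show ?thesis using D(2) by (simp add: jet_target_def a_def[symmetric] mem_Times_iff)
    qed
    then have "C 0 \<in> S" using S(2)[OF j] jT j_rep by (simp add: a_def)
    have "continuous_on UNIV C" unfolding C_def
    proof (intro continuous_on_Pair continuous_on_const continuous_on_coordinatewise_then_product)
      fix vs
      show "continuous_on UNIV (\<lambda>\<epsilon>. if length vs \<le> 2 then nderiv vs (\<lambda>z. (z, f z)) (e a) +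
          \<epsilon> *\<^sub>R nderiv vs (\<lambda>z. (0 :: real \<times> 'e \<times> 'e, quad z)) (e a) else 0)"
        by (cases "length vs \<le> 2") (simp_all add: continuous_intros)
    qed
    then have "open (C -` S)" using S(1) by (metis open_vimage)
    then obtain \<delta> where \<delta>: "\<delta> > 0" "ball 0 \<delta> \<subseteq> C -` S"
      using \<open>C 0 \<in> S\<close> by (meson openE vimageI)
    let ?H = "hess (D, e) (jet_fun j) a"
    have linH: "\<And>v. linear (\<lambda>u. ?H u v)" "\<And>u. linear (?H u)"
      using qjet_hess_linear[OF j D(1)] D(2) by (simp_all add: a_def)
    \<comment> \<open>The values of \<epsilon> to avoid: finitely many that make the Hessian
      singular, and the one at which the perturbed Lagrangian vanishes at \<open>a\<close>. An
      interval of small positive numbers is infinite, so it contains an admissible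
      \<epsilon>.\<close>
    have "finite ({\<epsilon>. \<not> nonsingular (\<lambda>u v. ?H u v + \<epsilon> * (u \<bullet> v))} \<union> {- jet_fun j a / quad (e a)})"
      using finite_singular_perturbations[of ?H, OF linH] by simp
    moreover have "infinite {0<..<\<delta>}" using \<delta>(1) by simp
    ultimately have "{0<..<\<delta>} - ({\<epsilon>. \<not> nonsingular (\<lambda>u v. ?H u v + \<epsilon> * (u \<bullet> v))} \<union>
        {- jet_fun j a / quad (e a)}) \<noteq> {}"
      using Diff_infinite_finite infinite_imp_nonempty by blast
    then obtain \<epsilon> where \<epsilon>: "\<epsilon> \<in> {0<..<\<delta>}"
      "nonsingular (\<lambda>u v. ?H u v + \<epsilon> * (u \<bullet> v))" "\<epsilon> \<noteq> - jet_fun j a / quad (e a)"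
      by blast
    have "\<epsilon> \<in> ball 0 \<delta>" using \<epsilon>(1) by simp
    then have "g \<epsilon> \<in> T" using \<delta>(2) unfolding gT by blast
    moreover have "g \<epsilon> \<in> O2' M"
    proof -
      have "hess (D, e) (jet_fun (g \<epsilon>)) a = (\<lambda>u v. ?H u v + \<epsilon> * (u \<bullet> v))"
      proof (intro ext)
        fix u v
        have "hess (D, e) (jet_fun (g \<epsilon>)) a u v = nderiv [vert u, vert v] (\<lambda>z. snd (s \<epsilon> (inv_into D e z))) (e a)"
          unfolding g_def using qjet_fun(3)[OF qs D(1)] D(2) by (simp add: hess_def comp_def)
        also have "\<dots> = nderiv [vert u, vert v] (\<lambda>z. f z + \<epsilon> *\<^sub>R quad z) (e a)"
          by (rule nderiv_cong[OF sf(1) _ sfq ea, symmetric]) (simp add: fq)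
        also have "\<dots> = nderiv [vert u, vert v] f (e a) + \<epsilon> *\<^sub>R (u \<bullet> v)"
          by (simp only: nderiv_add[OF sf s\<epsilon>q ea] nderiv_scaleR[OF sf(1) sq ea] nderiv_quad)
        also have "nderiv [vert u, vert v] f (e a) = ?H u v"
          by (simp add: hess_def f_def[abs_def] comp_def)
        finally show "hess (D, e) (jet_fun (g \<epsilon>)) a u v = ?H u v + \<epsilon> * (u \<bullet> v)" by simp
      qed
      then have "g \<epsilon> \<in> O2 M"
        using O2_iff[OF D(1), of "g \<epsilon>"] D(2) gJ \<epsilon>(2) by (simp add: fst_g)
      moreover have "jet_fun (g \<epsilon>) a \<noteq> 0"
      proof -
        have "jet_fun (g \<epsilon>) a = jet_fun j a + \<epsilon> * quad (e a)"
          unfolding g_def using qjet_fun(1)[OF qs] by (simp add: s_def)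
        then show ?thesis using \<epsilon>(3) quad_pos[of "e a"] by (simp add: field_simps add_eq_0_iff)
      qed
      ultimately show ?thesis by (simp add: O2'_def fst_g)
    qed
    ultimately show "\<exists>i. i \<in> O2' M \<and> i \<in> T" by blast
  qed
qed

lemma dense_O2: "J2q_topology closure_of (O2 M) = J2q"
proof -
  have "O2' M \<subseteq> O2 M" by (auto simp: O2'_def)
  then have "J2q \<subseteq> J2q_topology closure_of (O2 M)"
    using closure_of_mono[of "O2' M" "O2 M" J2q_topology] dense_O2' by simp
  then show ?thesis using closure_of_subset_topspace[of J2q_topology "O2 M"] topspace_J2q by auto
qed

section \<open>The vertical group\<close>

text \<open>The vertical group is the kernel of the homomorphism from \<Phi> to \<phi>; the group of
  all bijections of the line serves as its target.\<close>

lemma Aut_vert_normal: "Aut_vert M \<lhd> Aut_group M"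
proof -
  define K :: "(real \<Rightarrow> real) monoid" where "K = \<lparr>carrier = {f. bij f}, mult = (\<circ>), one = id\<rparr>"
  have G: "group (Aut_group M)"
  proof (rule groupI)
    fix \<Phi> assume "\<Phi> \<in> carrier (Aut_group M)"
    then have \<Phi>: "\<Phi> \<in> Aut M" by (simp add: Aut_group_def)
    have "inv_into UNIV \<Phi> \<circ> \<Phi> = id" using AutD(4)[OF \<Phi>] by (simp add: bij_is_inj)
    then show "\<exists>\<Psi>\<in>carrier (Aut_group M). \<Psi> \<otimes>\<^bsub>Aut_group M\<^esub> \<Phi> = \<one>\<^bsub>Aut_group M\<^esub>"
      using Aut_inv[OF \<Phi>] by (auto simp: Aut_group_def)
  qed (simp_all add: Aut_group_def Aut_compose Aut_id comp_assoc)
  have K: "group K"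
  proof (rule groupI)
    fix f assume "f \<in> carrier K"
    then have f: "bij f" by (simp add: K_def)
    then have "inv_into UNIV f \<circ> f = id" by (simp add: bij_is_inj)
    then show "\<exists>g\<in>carrier K. g \<otimes>\<^bsub>K\<^esub> f = \<one>\<^bsub>K\<^esub>"
      using bij_imp_bij_inv[OF f] by (auto simp: K_def)
  qed (simp_all add: K_def bij_comp comp_assoc)
  have "base_map \<in> hom (Aut_group M) K"
    by (rule homI) (simp_all add: Aut_group_def K_def AutD(6) Aut_compose)
  then have "group_hom (Aut_group M) K base_map"
    using G K by (simp add: group_hom_def group_hom_axioms_def)
  then have "kernel (Aut_group M) K base_map \<lhd> Aut_group M"
    by (rule group_hom.normal_kernel)
  moreover have "kernel (Aut_group M) K base_map = Aut_vert M"
    by (simp add: kernel_def Aut_group_def K_def Aut_vert_def)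
  ultimately show ?thesis by simp
qed

end

theorem proposition3p3:
  fixes M :: "('m, 'e::euclidean_space) atlas"
  assumes "smooth_manifold M" and "connected_space (manifold_topology M)"
  shows
    "openin (jet_topology (q_fib M) 2) (O2 M) \<and>
     jet_topology (q_fib M) 2 closure_of O2 M = jets (q_fib M) 2 \<and>
     (\<forall>\<Phi>\<in>Aut M. \<forall>L\<in>Lagrangians M. \<forall>a\<in>J1 M.
        jet2 M (prolong1 M \<Phi> a) L \<in> O2 M \<longrightarrow>
          action M (inv_into UNIV \<Phi>) (jet2 M (prolong1 M \<Phi> a) L) \<in> O2 M \<and>
          V_fun M (action M (inv_into UNIV \<Phi>) (jet2 M (prolong1 M \<Phi> a) L)) =
            deriv (base_map \<Phi>) (fst a) * V_fun M (jet2 M (prolong1 M \<Phi> a) L)) \<and>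
     (\<forall>\<Phi>\<in>Aut M. \<forall>L\<in>Lagrangians M. \<forall>a\<in>J1 M.
        jet2 M a L \<in> O2 M \<longrightarrow>
          action M \<Phi> (jet2 M a L) \<in> O2 M \<and>
          V_fun M (action M \<Phi> (jet2 M a L)) =
            inverse (deriv (base_map \<Phi>) (fst a)) * V_fun M (jet2 M a L)) \<and>
     Aut_vert M \<lhd> Aut_group M \<and>
     (\<forall>\<Phi>\<in>Aut_vert M. \<forall>j\<in>O2 M. action M \<Phi> j \<in> O2 M \<and> V_fun M (action M \<Phi> j) = V_fun M j) \<and>
     openin (jet_topology (q_fib M) 2) (O2' M) \<and>
     jet_topology (q_fib M) 2 closure_of O2' M = jets (q_fib M) 2 \<and>
     (\<forall>\<Phi>\<in>Aut M. \<forall>j\<in>O2' M. action M \<Phi> j \<in> O2' M \<and> I_fun M (action M \<Phi> j) = I_fun M j)"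
proof -
  interpret smooth_mfd M
    using assms(1) by unfold_locales (simp_all add: smooth_manifold_def)
  have fst_jet2: "fst (jet2 M a L) = a" for a L by (simp add: jet2_def)
  show ?thesis
  proof (intro conjI ballI impI openin_O2 openin_O2' dense_O2 dense_O2' Aut_vert_normal)
    fix \<Phi> L a assume \<Phi>: "\<Phi> \<in> Aut M" and j: "jet2 M (prolong1 M \<Phi> a) L \<in> O2 M"
    note V = V_fun_action[OF Aut_inv[OF \<Phi>] j]
    show "action M (inv_into UNIV \<Phi>) (jet2 M (prolong1 M \<Phi> a) L) \<in> O2 M" by (rule V(1))
    \<comment> \<open>The multiplier of dx for the inverse automorphism at \<phi> x is 1/\<phi>' x,
      and the lift divides by it, so this action scales \<open>V\<close> by \<phi>' x. The factor
      1/\<phi>' x belongs to the action of \<Phi> itself, which is the case that follows.\<close>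
    show "V_fun M (action M (inv_into UNIV \<Phi>) (jet2 M (prolong1 M \<Phi> a) L)) =
        deriv (base_map \<Phi>) (fst a) * V_fun M (jet2 M (prolong1 M \<Phi> a) L)"
      unfolding V(2) by (simp add: fst_jet2 base_map_inv[OF \<Phi>] deriv_base_map_inv(1)[OF \<Phi>])
  next
    fix \<Phi> L a assume \<Phi>: "\<Phi> \<in> Aut M" and j: "jet2 M a L \<in> O2 M"
    show "action M \<Phi> (jet2 M a L) \<in> O2 M" by (rule V_fun_action(1)[OF \<Phi> j])
    show "V_fun M (action M \<Phi> (jet2 M a L)) = inverse (deriv (base_map \<Phi>) (fst a)) * V_fun M (jet2 M a L)"
      using V_fun_action(2)[OF \<Phi> j] by (simp only: fst_jet2)
  next
    fix \<Phi> j assume "\<Phi> \<in> Aut_vert M" and j: "j \<in> O2 M"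
    then have \<Phi>: "\<Phi> \<in> Aut M" "base_map \<Phi> = id" by (simp_all add: Aut_vert_def)
    show "action M \<Phi> j \<in> O2 M" by (rule V_fun_action(1)[OF \<Phi>(1) j])
    show "V_fun M (action M \<Phi> j) = V_fun M j"
      using V_fun_action(2)[OF \<Phi>(1) j] by (simp add: \<Phi>(2))
  next
    fix \<Phi> j assume "\<Phi> \<in> Aut M" "j \<in> O2' M"
    then show "action M \<Phi> j \<in> O2' M" "I_fun M (action M \<Phi> j) = I_fun M j" by (rule I_fun_action)+
  qed
qed

end
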